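(* Let $\mathbb{F}$ be a field of characteristic not two, let $n\ge 3$, and let $X:V^{n-1}\to V$ be an $(n-1)$-fold cross product on the $n$-dimensional $\mathbb{F}$-vector space $V$, relative to a nondegenerate symmetric bilinear form $b$. Then the following equalities of affine group schemes hold: (1) $\mathbf{Aut}(V,X)=\widetilde{\mathbf{O}}(V,b)$. (2) $\mathbf{Aut}(V,X,b)=\mathbf{O}^+(V,b)$.
   Context: An $r$-fold cross product on $V$ relative to a nondegenerate symmetric bilinear form $b$ is a multilinear map $X:V^r\to V$ such that, for all $v_1,\dots,v_r\in V$, $b(X(v_1,\dots,v_r),v_i)=0$ for $1\le i\le r$, and $b(X(v_1,\dots,v_r),X(v_1,\dots,v_r))=\det\big(b(v_i,v_j)\big)$. Affine group schemes are viewed as functors on unital commutative associative $\mathbb{F}$-algebras $R$; $V_R=V\otimes_{\mathbb{F}}R$ and a subscript $R$ denotes scalar extension. $\mathbf{Aut}(V,X)(R)$ is the group of $\varphi\in\mathrm{GL}_R(V_R)$ with $\varphi(X_R(v_1,\dots,v_r))=X_R(\varphi(v_1),\dots,\varphi(v_r))$ for all $v_i\in V_R$; $\mathbf{Aut}(V,X,b)(R)=\mathbf{Aut}(V,X)(R)\cap\mathbf{O}(V,b)(R)$, with $\mathbf{O}(V,b)$ the orthogonal group scheme. $\mathbf{O}^+(V,b)$ is the special orthogonal group scheme (elements of $\mathbf{O}(V,b)$ of determinant $1$). $\widetilde{\mathbf{O}}(V,b)(R)$ is the group of $\varphi\in\mathrm{GL}_R(V_R)$ such that $b_R(\varphi(u),\varphi(v))=\det(\varphi)\,b_R(u,v)$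 for all $u,v\in V_R$. *)

theory Defs
  imports
    "HOL-Algebra.Bij"
    "HOL-Algebra.Generated_Groups"
    "HOL-Algebra.Free_Abelian_Groups"
    "HOL-Combinatorics.Permutations"
    "Jordan_Normal_Form.Missing_VectorSpace"
begin

section \<open>Determinants over commutative rings\<close>

definition leibniz_det :: "('r, 'm) ring_scheme \<Rightarrow> nat \<Rightarrow> (nat \<Rightarrow> nat \<Rightarrow> 'r) \<Rightarrow> 'r" where
  "leibniz_det R n A =
     (\<Oplus>\<^bsub>R\<^esub>p\<in>{p. p permutes {..<n}}. [(sign p :: int)] \<cdot>\<^bsub>R\<^esub> (\<Otimes>\<^bsub>R\<^esub>i\<in>{..<n}. A i (p i)))"

definition ordered_basis :: "('r, 'm) ring_scheme \<Rightarrow> ('r, 'v, 'k) module_scheme \<Rightarrow> 'v list \<Rightarrow> bool" where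
  "ordered_basis R M bs \<longleftrightarrow>
     distinct bs \<and> set bs \<subseteq> carrier M \<and>
     \<not> module.lin_dep R M (set bs) \<and> module.span R M (set bs) = carrier M"

text \<open>The determinant of an endomorphism \<open>\<phi>\<close> of a free module of finite rank is the determinant of its
  matrix with respect to any basis; the value does not depend on the basis. Over the zero ring the
  length of a basis is not determined, but there all determinants are equal.\<close>

definition lin_det :: "('r, 'm) ring_scheme \<Rightarrow> ('r, 'v, 'k) module_scheme \<Rightarrow> ('v \<Rightarrow> 'v) \<Rightarrow> 'r" where
  "lin_det R M \<phi> =
     (THE d. \<exists>bs A. ordered_basis R M bs \<and>
        (\<forall>i<length bs. \<forall>j<length bs. A i j \<in> carrier R) \<and>
        (\<forall>j<length bs. \<phi> (bs ! j) = (\<Oplus>\<^bsub>M\<^esub>i\<in>{..<length bs}. A i j \<odot>\<^bsub>M\<^esub> bs ! i)) \<and>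
        d = leibniz_det R (length bs) A)"


section \<open>Multilinear maps, bilinear forms and cross products\<close>

text \<open>An element of \<open>M\<^sup>r\<close> is a list of length \<open>r\<close>.\<close>

definition tuples :: "('r, 'v, 'k) module_scheme \<Rightarrow> nat \<Rightarrow> 'v list set" where
  "tuples M r = {vs. length vs = r \<and> set vs \<subseteq> carrier M}"

definition multilinear_map ::
  "('r, 'm) ring_scheme \<Rightarrow> ('r, 'v, 'k) module_scheme \<Rightarrow> nat \<Rightarrow> ('v list \<Rightarrow> 'v) \<Rightarrow> bool" where
  "multilinear_map R M r X \<longleftrightarrow>
     (\<forall>vs\<in>tuples M r. X vs \<in> carrier M) \<and>
     (\<forall>vs\<in>tuples M r. \<forall>i<r. \<forall>u\<in>carrier M. \<forall>w\<in>carrier M.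
        X (vs[i := u \<oplus>\<^bsub>M\<^esub> w]) = X (vs[i := u]) \<oplus>\<^bsub>M\<^esub> X (vs[i := w])) \<and>
     (\<forall>vs\<in>tuples M r. \<forall>i<r. \<forall>a\<in>carrier R. \<forall>u\<in>carrier M.
        X (vs[i := a \<odot>\<^bsub>M\<^esub> u]) = a \<odot>\<^bsub>M\<^esub> X (vs[i := u]))"

definition bilinear_form ::
  "('r, 'm) ring_scheme \<Rightarrow> ('r, 'v, 'k) module_scheme \<Rightarrow> ('v \<Rightarrow> 'v \<Rightarrow> 'r) \<Rightarrow> bool" where
  "bilinear_form R M b \<longleftrightarrow>
     (\<forall>u\<in>carrier M. \<forall>v\<in>carrier M. b u v \<in> carrier R) \<and>
     (\<forall>u\<in>carrier M. \<forall>v\<in>carrier M. \<forall>w\<in>carrier M.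
        b (u \<oplus>\<^bsub>M\<^esub> v) w = b u w \<oplus>\<^bsub>R\<^esub> b v w \<and> b w (u \<oplus>\<^bsub>M\<^esub> v) = b w u \<oplus>\<^bsub>R\<^esub> b w v) \<and>
     (\<forall>a\<in>carrier R. \<forall>u\<in>carrier M. \<forall>v\<in>carrier M.
        b (a \<odot>\<^bsub>M\<^esub> u) v = a \<otimes>\<^bsub>R\<^esub> b u v \<and> b u (a \<odot>\<^bsub>M\<^esub> v) = a \<otimes>\<^bsub>R\<^esub> b u v)"

definition symmetric_form :: "('r, 'v, 'k) module_scheme \<Rightarrow> ('v \<Rightarrow> 'v \<Rightarrow> 'r) \<Rightarrow> bool" where
  "symmetric_form M b \<longleftrightarrow> (\<forall>u\<in>carrier M. \<forall>v\<in>carrier M. b u v = b v u)"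

definition nondegenerate_form ::
  "('r, 'm) ring_scheme \<Rightarrow> ('r, 'v, 'k) module_scheme \<Rightarrow> ('v \<Rightarrow> 'v \<Rightarrow> 'r) \<Rightarrow> bool" where
  "nondegenerate_form R M b \<longleftrightarrow>
     (\<forall>u\<in>carrier M. (\<forall>v\<in>carrier M. b u v = \<zero>\<^bsub>R\<^esub>) \<longrightarrow> u = \<zero>\<^bsub>M\<^esub>)"

definition cross_product ::
  "('f, 'm) ring_scheme \<Rightarrow> ('f, 'v, 'k) module_scheme \<Rightarrow> ('v \<Rightarrow> 'v \<Rightarrow> 'f) \<Rightarrow> nat \<Rightarrow> ('v list \<Rightarrow> 'v) \<Rightarrow> bool"
  where
  "cross_product F V b r X \<longleftrightarrow>
     multilinear_map F V r X \<and>
     (\<forall>vs\<in>tuples V r.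
        (\<forall>i<r. b (X vs) (vs ! i) = \<zero>\<^bsub>F\<^esub>) \<and>
        b (X vs) (X vs) = leibniz_det F r (\<lambda>i j. b (vs ! i) (vs ! j)))"


section \<open>Extension of scalars\<close>

text \<open>\<open>V\<^sub>R\<close> is the tensor product of \<open>V\<close> and \<open>R\<close> over \<open>F\<close>: the free abelian group on
  \<open>carrier V \<times> carrier R\<close> modulo the subgroup generated by the biadditivity and balancing relations.
  Its elements are cosets. The fields \<open>mult\<close> and \<open>one\<close> that a module record inherits from the
  record of rings play no role.\<close>

definition tensor_relations ::
  "('f, 'm) ring_scheme \<Rightarrow> ('f, 'v, 'k) module_scheme \<Rightarrow> ('f, 'r, 'l) module_scheme
     \<Rightarrow> ('v \<times> 'r \<Rightarrow>\<^sub>0 int) set" where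
  "tensor_relations F V R =
     {frag_of (u \<oplus>\<^bsub>V\<^esub> v, s) - frag_of (u, s) - frag_of (v, s) | u v s.
        u \<in> carrier V \<and> v \<in> carrier V \<and> s \<in> carrier R} \<union>
     {frag_of (v, s \<oplus>\<^bsub>R\<^esub> t) - frag_of (v, s) - frag_of (v, t) | v s t.
        v \<in> carrier V \<and> s \<in> carrier R \<and> t \<in> carrier R} \<union>
     {frag_of (a \<odot>\<^bsub>V\<^esub> v, s) - frag_of (v, a \<odot>\<^bsub>R\<^esub> s) | a v s.
        a \<in> carrier F \<and> v \<in> carrier V \<and> s \<in> carrier R}"

definition tensor_free ::
  "('f, 'v, 'k) module_scheme \<Rightarrow> ('f, 'r, 'l) module_scheme \<Rightarrow> ('v \<times> 'r \<Rightarrow>\<^sub>0 int) monoid" where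
  "tensor_free V R = free_Abelian_group (carrier V \<times> carrier R)"

definition tensor_kernel ::
  "('f, 'm) ring_scheme \<Rightarrow> ('f, 'v, 'k) module_scheme \<Rightarrow> ('f, 'r, 'l) module_scheme
     \<Rightarrow> ('v \<times> 'r \<Rightarrow>\<^sub>0 int) set" where
  "tensor_kernel F V R = generate (tensor_free V R) (tensor_relations F V R)"

definition pure_tensor ::
  "('f, 'm) ring_scheme \<Rightarrow> ('f, 'v, 'k) module_scheme \<Rightarrow> ('f, 'r, 'l) module_scheme
     \<Rightarrow> 'v \<Rightarrow> 'r \<Rightarrow> ('v \<times> 'r \<Rightarrow>\<^sub>0 int) set" where
  "pure_tensor F V R v s = tensor_kernel F V R #>\<^bsub>tensor_free V R\<^esub> frag_of (v, s)"

text \<open>The scalar \<open>r\<close> acts by \<open>r (v \<otimes> s) = v \<otimes> r s\<close>. All cosets in the union below are equal.\<close>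

definition scalar_extension ::
  "('f, 'm) ring_scheme \<Rightarrow> ('f, 'v, 'k) module_scheme \<Rightarrow> ('f, 'r, 'l) module_scheme
     \<Rightarrow> ('r, ('v \<times> 'r \<Rightarrow>\<^sub>0 int) set) module" where
  "scalar_extension F V R =
     (let G = tensor_free V R; N = tensor_kernel F V R in
      \<lparr>carrier = carrier (G Mod N),
       mult = undefined,
       one = undefined,
       zero = \<one>\<^bsub>G Mod N\<^esub>,
       add = (\<lambda>C D. C \<otimes>\<^bsub>G Mod N\<^esub> D),
       smult = (\<lambda>r C. \<Union>c\<in>C. N #>\<^bsub>G\<^esub> frag_extend (\<lambda>(v, s). frag_of (v, r \<otimes>\<^bsub>R\<^esub> s)) c)\<rparr>)"

text \<open>\<open>X\<^sub>R\<close> and \<open>b\<^sub>R\<close> are the unique \<open>R\<close>-multilinear extensions of \<open>X\<close> and \<open>b\<close> along \<open>v \<mapsto> v \<otimes> 1\<close>.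
  Extensionality only makes the total HOL functions unique.\<close>

definition multilinear_extension ::
  "('f, 'm) ring_scheme \<Rightarrow> ('f, 'v, 'k) module_scheme \<Rightarrow> nat \<Rightarrow> ('v list \<Rightarrow> 'v)
     \<Rightarrow> ('f, 'r, 'l) module_scheme
     \<Rightarrow> ('v \<times> 'r \<Rightarrow>\<^sub>0 int) set list \<Rightarrow> ('v \<times> 'r \<Rightarrow>\<^sub>0 int) set" where
  "multilinear_extension F V r X R =
     (THE Y. Y \<in> extensional (tuples (scalar_extension F V R) r) \<and>
        multilinear_map R (scalar_extension F V R) r Y \<and>
        (\<forall>vs\<in>tuples V r.
           Y (map (\<lambda>v. pure_tensor F V R v \<one>\<^bsub>R\<^esub>) vs) = pure_tensor F V R (X vs) \<one>\<^bsub>R\<^esub>))"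

definition bilinear_extension ::
  "('f, 'm) ring_scheme \<Rightarrow> ('f, 'v, 'k) module_scheme \<Rightarrow> ('v \<Rightarrow> 'v \<Rightarrow> 'f)
     \<Rightarrow> ('f, 'r, 'l) module_scheme
     \<Rightarrow> ('v \<times> 'r \<Rightarrow>\<^sub>0 int) set \<Rightarrow> ('v \<times> 'r \<Rightarrow>\<^sub>0 int) set \<Rightarrow> 'r" where
  "bilinear_extension F V b R =
     (THE B. case_prod B \<in> extensional
          (carrier (scalar_extension F V R) \<times> carrier (scalar_extension F V R)) \<and>
        bilinear_form R (scalar_extension F V R) B \<and>
        (\<forall>u\<in>carrier V. \<forall>v\<in>carrier V.
           B (pure_tensor F V R u \<one>\<^bsub>R\<^esub>) (pure_tensor F V R v \<one>\<^bsub>R\<^esub>) = b u v \<odot>\<^bsub>R\<^esub> \<one>\<^bsub>R\<^esub>))"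


section \<open>The group schemes\<close>

text \<open>A group scheme is given by its groups of points, as a function of the \<open>F\<close>-algebra \<open>R\<close>. All of
  them are subgroups of \<open>GL\<^sub>R(V\<^sub>R)\<close> with composition as multiplication, and on algebra
  homomorphisms all of them are restrictions of the functor \<open>GL(V)\<close>.\<close>

definition GL_module :: "('r, 'm) ring_scheme \<Rightarrow> ('r, 'v, 'k) module_scheme \<Rightarrow> ('v \<Rightarrow> 'v) monoid" where
  "GL_module R M = (BijGroup (carrier M))\<lparr>carrier := Bij (carrier M) \<inter> module_hom R M M\<rparr>"

definition GL_scheme ::
  "('f, 'm) ring_scheme \<Rightarrow> ('f, 'v, 'k) module_scheme \<Rightarrow> ('f, 'r, 'l) module_scheme
     \<Rightarrow> (('v \<times> 'r \<Rightarrow>\<^sub>0 int) set \<Rightarrow> ('v \<times> 'r \<Rightarrow>\<^sub>0 int) set) monoid" where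
  "GL_scheme F V R = GL_module R (scalar_extension F V R)"

definition Aut_scheme ::
  "('f, 'm) ring_scheme \<Rightarrow> ('f, 'v, 'k) module_scheme \<Rightarrow> nat \<Rightarrow> ('v list \<Rightarrow> 'v)
     \<Rightarrow> ('f, 'r, 'l) module_scheme
     \<Rightarrow> (('v \<times> 'r \<Rightarrow>\<^sub>0 int) set \<Rightarrow> ('v \<times> 'r \<Rightarrow>\<^sub>0 int) set) monoid" where
  "Aut_scheme F V r X R = (GL_scheme F V R)\<lparr>carrier :=
     {\<phi> \<in> carrier (GL_scheme F V R). \<forall>vs\<in>tuples (scalar_extension F V R) r.
        \<phi> (multilinear_extension F V r X R vs) = multilinear_extension F V r X R (map \<phi> vs)}\<rparr>"

definition O_scheme ::
  "('f, 'm) ring_scheme \<Rightarrow> ('f, 'v, 'k) module_scheme \<Rightarrow> ('v \<Rightarrow> 'v \<Rightarrow> 'f)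
     \<Rightarrow> ('f, 'r, 'l) module_scheme
     \<Rightarrow> (('v \<times> 'r \<Rightarrow>\<^sub>0 int) set \<Rightarrow> ('v \<times> 'r \<Rightarrow>\<^sub>0 int) set) monoid" where
  "O_scheme F V b R = (GL_scheme F V R)\<lparr>carrier :=
     {\<phi> \<in> carrier (GL_scheme F V R).
        \<forall>u\<in>carrier (scalar_extension F V R). \<forall>v\<in>carrier (scalar_extension F V R).
          bilinear_extension F V b R (\<phi> u) (\<phi> v) = bilinear_extension F V b R u v}\<rparr>"

definition Aut_form_scheme ::
  "('f, 'm) ring_scheme \<Rightarrow> ('f, 'v, 'k) module_scheme \<Rightarrow> nat \<Rightarrow> ('v list \<Rightarrow> 'v)
     \<Rightarrow> ('v \<Rightarrow> 'v \<Rightarrow> 'f) \<Rightarrow> ('f, 'r, 'l) module_scheme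
     \<Rightarrow> (('v \<times> 'r \<Rightarrow>\<^sub>0 int) set \<Rightarrow> ('v \<times> 'r \<Rightarrow>\<^sub>0 int) set) monoid" where
  "Aut_form_scheme F V r X b R = (GL_scheme F V R)\<lparr>carrier :=
     carrier (Aut_scheme F V r X R) \<inter> carrier (O_scheme F V b R)\<rparr>"

definition SO_scheme ::
  "('f, 'm) ring_scheme \<Rightarrow> ('f, 'v, 'k) module_scheme \<Rightarrow> ('v \<Rightarrow> 'v \<Rightarrow> 'f)
     \<Rightarrow> ('f, 'r, 'l) module_scheme
     \<Rightarrow> (('v \<times> 'r \<Rightarrow>\<^sub>0 int) set \<Rightarrow> ('v \<times> 'r \<Rightarrow>\<^sub>0 int) set) monoid" where
  "SO_scheme F V b R = (GL_scheme F V R)\<lparr>carrier :=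
     {\<phi> \<in> carrier (O_scheme F V b R). lin_det R (scalar_extension F V R) \<phi> = \<one>\<^bsub>R\<^esub>}\<rparr>"

definition O_tilde_scheme ::
  "('f, 'm) ring_scheme \<Rightarrow> ('f, 'v, 'k) module_scheme \<Rightarrow> ('v \<Rightarrow> 'v \<Rightarrow> 'f)
     \<Rightarrow> ('f, 'r, 'l) module_scheme
     \<Rightarrow> (('v \<times> 'r \<Rightarrow>\<^sub>0 int) set \<Rightarrow> ('v \<times> 'r \<Rightarrow>\<^sub>0 int) set) monoid" where
  "O_tilde_scheme F V b R = (GL_scheme F V R)\<lparr>carrier :=
     {\<phi> \<in> carrier (GL_scheme F V R).
        \<forall>u\<in>carrier (scalar_extension F V R). \<forall>v\<in>carrier (scalar_extension F V R).
          bilinear_extension F V b R (\<phi> u) (\<phi> v) =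
            lin_det R (scalar_extension F V R) \<phi> \<otimes>\<^bsub>R\<^esub> bilinear_extension F V b R u v}\<rparr>"

end

(* By orthogonality the n-form b(X(v_1,...,v_{n-1}), v_n) on V is alternating, hence equal to
   delta * det in coordinates. Since X is nonzero on an orthogonal system of n-1 anisotropic vectors,
   delta is nonzero in F, so it stays invertible in every F-algebra R. The identity persists over R,
   and for phi in GL(V_R) it gives
     b(X(phi v_1,...,phi v_{n-1}), phi u) = det(phi) b(X(v_1,...,v_{n-1}), u).
   If phi preserves X, the left side is b(phi(X(v)), phi u), and the vectors X(v) span V_R, so phi is a
   similitude with multiplier det(phi). Conversely, for such a similitude the right side is
   b(phi(X(v)), phi u), and nondegeneracy of b over R yields X(phi v) = phi(X(v)). The second equality
   follows because b_R takes an invertible value. An orthogonal basis of V makes b_R and X_R explicit. *)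

theory Submission
  imports Defs
begin

section \<open>Multilinear and alternating forms\<close>

text \<open>All field arguments are therefore spent over F, on an orthogonal basis E with dual
  coordinates c_i and on the scalars q_i = b(E_i, E_i), \<delta> = b(X(E_0,...,E_{n-2}), E_{n-1})
  and w_i = \<delta> / q_i. In these terms b(u,v) is the sum of q_i c_i(u) c_i(v), and the i-th
  coordinate of X(v_1,...,v_{n-1}) is w_i det(v_1,...,v_{n-1}, E_i). Such formulas, the equations
  q_i w_i = \<delta> and the invertibility of q_i and \<delta> survive every ring homomorphism out
  of F. The equivalence is proved once for data of this kind over any commutative ring and is
  applied over R. The other obstacle is that X_R, b_R and the determinant are definite descriptions,
  usable only after existence and uniqueness are known. For X_R and b_R this rests on the tensors of
  E_i with one being a basis of V_R; for the determinant it rests on independence of the basis,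
  which follows because alternating forms of top degree are multiples of a single one. The zero ring
  needs its own argument there.\<close>

definition multilinear_form ::
  "('r, 'm) ring_scheme \<Rightarrow> ('r, 'v, 'k) module_scheme \<Rightarrow> nat \<Rightarrow> ('v list \<Rightarrow> 'r) \<Rightarrow> bool" where
  "multilinear_form R M r f \<longleftrightarrow>
     (\<forall>vs\<in>tuples M r. f vs \<in> carrier R) \<and>
     (\<forall>vs\<in>tuples M r. \<forall>i<r. \<forall>u\<in>carrier M. \<forall>w\<in>carrier M.
        f (vs[i := u \<oplus>\<^bsub>M\<^esub> w]) = f (vs[i := u]) \<oplus>\<^bsub>R\<^esub> f (vs[i := w])) \<and>
     (\<forall>vs\<in>tuples M r. \<forall>i<r. \<forall>a\<in>carrier R. \<forall>u\<in>carrier M.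
        f (vs[i := a \<odot>\<^bsub>M\<^esub> u]) = a \<otimes>\<^bsub>R\<^esub> f (vs[i := u]))"

definition alternating_form ::
  "('r, 'm) ring_scheme \<Rightarrow> ('r, 'v, 'k) module_scheme \<Rightarrow> nat \<Rightarrow> ('v list \<Rightarrow> 'r) \<Rightarrow> bool" where
  "alternating_form R M r f \<longleftrightarrow>
     multilinear_form R M r f \<and>
     (\<forall>vs\<in>tuples M r. \<forall>i<r. \<forall>j<r. i \<noteq> j \<longrightarrow> vs ! i = vs ! j \<longrightarrow> f vs = \<zero>\<^bsub>R\<^esub>)"

lemma tuples_update [intro]: "vs \<in> tuples M r \<Longrightarrow> u \<in> carrier M \<Longrightarrow> vs[i := u] \<in> tuples M r"
  unfolding tuples_def using set_update_subset_insert[of vs i u] by auto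

lemma tuples_nth [intro]: "vs \<in> tuples M r \<Longrightarrow> i < r \<Longrightarrow> vs ! i \<in> carrier M"
  unfolding tuples_def by auto

lemma tuples_length: "vs \<in> tuples M r \<Longrightarrow> length vs = r"
  unfolding tuples_def by auto

lemma tuples_map: "(\<And>x. x \<in> carrier M \<Longrightarrow> h x \<in> carrier N) \<Longrightarrow> vs \<in> tuples M r \<Longrightarrow> map h vs \<in> tuples N r"
  unfolding tuples_def by auto

lemma tuples_append1: "vs \<in> tuples M r \<Longrightarrow> u \<in> carrier M \<Longrightarrow> vs @ [u] \<in> tuples M (Suc r)"
  unfolding tuples_def by auto

lemma multilinear_formI:
  assumes "\<And>vs. vs \<in> tuples M r \<Longrightarrow> f vs \<in> carrier R"
    and "\<And>vs i u w. vs \<in> tuples M r \<Longrightarrow> i < r \<Longrightarrow> u \<in> carrier M \<Longrightarrow> w \<in> carrier M \<Longrightarrow>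
        f (vs[i := u \<oplus>\<^bsub>M\<^esub> w]) = f (vs[i := u]) \<oplus>\<^bsub>R\<^esub> f (vs[i := w])"
    and "\<And>vs i a u. vs \<in> tuples M r \<Longrightarrow> i < r \<Longrightarrow> a \<in> carrier R \<Longrightarrow> u \<in> carrier M \<Longrightarrow>
        f (vs[i := a \<odot>\<^bsub>M\<^esub> u]) = a \<otimes>\<^bsub>R\<^esub> f (vs[i := u])"
  shows "multilinear_form R M r f"
  unfolding multilinear_form_def using assms by simp

context
  fixes R M r f
  assumes f: "multilinear_form R M r f"
begin

lemma form_closed: "vs \<in> tuples M r \<Longrightarrow> f vs \<in> carrier R"
  using f unfolding multilinear_form_def by simp

lemma form_add: "vs \<in> tuples M r \<Longrightarrow> i < r \<Longrightarrow> u \<in> carrier M \<Longrightarrow> w \<in> carrier M \<Longrightarrow>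
    f (vs[i := u \<oplus>\<^bsub>M\<^esub> w]) = f (vs[i := u]) \<oplus>\<^bsub>R\<^esub> f (vs[i := w])"
  using f unfolding multilinear_form_def by simp

lemma form_smult: "vs \<in> tuples M r \<Longrightarrow> i < r \<Longrightarrow> a \<in> carrier R \<Longrightarrow> u \<in> carrier M \<Longrightarrow>
    f (vs[i := a \<odot>\<^bsub>M\<^esub> u]) = a \<otimes>\<^bsub>R\<^esub> f (vs[i := u])"
  using f unfolding multilinear_form_def by simp

end

lemma alternating_form_multilinear: "alternating_form R M r f \<Longrightarrow> multilinear_form R M r f"
  unfolding alternating_form_def by blast

lemma alternating_form_zero:
  "alternating_form R M r f \<Longrightarrow> vs \<in> tuples M r \<Longrightarrow> i < r \<Longrightarrow> j < r \<Longrightarrow> i \<noteq> j \<Longrightarrow>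
    vs ! i = vs ! j \<Longrightarrow> f vs = \<zero>\<^bsub>R\<^esub>"
  unfolding alternating_form_def by simp

context module
begin

lemma form_slot_zero:
  assumes "multilinear_form R M r f" "vs \<in> tuples M r" "i < r"
  shows "f (vs[i := \<zero>\<^bsub>M\<^esub>]) = \<zero>"
  using form_smult[OF assms R.zero_closed M.zero_closed] form_closed[OF assms(1)] tuples_update[OF assms(2) M.zero_closed]
  by simp

lemma form_slot_sum:
  assumes f: "multilinear_form R M r f" and vs: "vs \<in> tuples M r" "k < r" and fin: "finite I"
    and a: "a \<in> I \<rightarrow> carrier R" and e: "e \<in> I \<rightarrow> carrier M"
  shows "f (vs[k := (\<Oplus>\<^bsub>M\<^esub>i\<in>I. a i \<odot>\<^bsub>M\<^esub> e i)]) = (\<Oplus>i\<in>I. a i \<otimes> f (vs[k := e i]))"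
  using fin a e
proof (induction I)
  case empty
  show ?case using form_slot_zero[OF f vs] by simp
next
  case (insert x I)
  have ax: "a x \<in> carrier R" "e x \<in> carrier M" "a \<in> I \<rightarrow> carrier R" "e \<in> I \<rightarrow> carrier M"
    using insert.prems by auto
  have c: "\<And>i. i \<in> I \<Longrightarrow> f (vs[k := e i]) \<in> carrier R"
    using ax(4) form_closed[OF f] vs by (auto intro: tuples_update)
  have cx: "f (vs[k := e x]) \<in> carrier R" using ax(2) form_closed[OF f] vs by (auto intro: tuples_update)
  have s: "(\<Oplus>\<^bsub>M\<^esub>i\<in>I. a i \<odot>\<^bsub>M\<^esub> e i) \<in> carrier M"
    using ax by (intro M.finsum_closed) auto
  have "(\<Oplus>\<^bsub>M\<^esub>i\<in>insert x I. a i \<odot>\<^bsub>M\<^esub> e i) = a x \<odot>\<^bsub>M\<^esub> e x \<oplus>\<^bsub>M\<^esub> (\<Oplus>\<^bsub>M\<^esub>i\<in>I. a i \<odot>\<^bsub>M\<^esub> e i)"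
    using insert.hyps ax by (intro M.finsum_insert) auto
  moreover have "(\<Oplus>i\<in>insert x I. a i \<otimes> f (vs[k := e i])) = a x \<otimes> f (vs[k := e x]) \<oplus> (\<Oplus>i\<in>I. a i \<otimes> f (vs[k := e i]))"
    using insert.hyps ax c cx by (intro R.finsum_insert) auto
  ultimately show ?case
    using insert.IH[OF ax(3,4)] form_add[OF f vs _ s, of "a x \<odot>\<^bsub>M\<^esub> e x"] form_smult[OF f vs ax(1,2)] ax by simp
qed

text \<open>Polarization: with the sum of \<open>vs ! i\<close> and \<open>vs ! j\<close> in both
  slots the form vanishes, and after expansion only the two mixed terms survive.\<close>

lemma form_swap:
  assumes f: "alternating_form R M r f" and vs: "vs \<in> tuples M r" and ij: "i < r" "j < r" "i \<noteq> j"
  shows "f (vs[i := vs ! j, j := vs ! i]) = \<ominus> f vs"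
proof -
  let ?u = "vs ! i" and ?w = "vs ! j"
  have uw: "?u \<in> carrier M" "?w \<in> carrier M" using vs ij by auto
  have m: "multilinear_form R M r f" by (rule alternating_form_multilinear[OF f])
  have t: "vs[i := x, j := y] \<in> tuples M r" if "x \<in> carrier M" "y \<in> carrier M" for x y
    using that vs by auto
  have l: "length vs = r" using vs by (rule tuples_length)
  have diag: "f (vs[i := x, j := x]) = \<zero>" if "x \<in> carrier M" for x
    by (rule alternating_form_zero[OF f t[OF that that] ij]) (use ij l in simp)
  have id: "vs[i := ?u, j := ?w] = vs" by simp
  have add: "f (vs[i := u \<oplus>\<^bsub>M\<^esub> w, j := x]) = f (vs[i := u, j := x]) \<oplus> f (vs[i := w, j := x])"
    if "u \<in> carrier M" "w \<in> carrier M" "x \<in> carrier M" for u w x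
    unfolding list_update_swap[OF ij(3)] using that ij vs by (intro form_add[OF m]) auto
  have "\<zero> = f (vs[i := ?u \<oplus>\<^bsub>M\<^esub> ?w, j := ?u \<oplus>\<^bsub>M\<^esub> ?w])" using diag uw by simp
  also have "\<dots> = f (vs[i := ?u \<oplus>\<^bsub>M\<^esub> ?w, j := ?u]) \<oplus> f (vs[i := ?u \<oplus>\<^bsub>M\<^esub> ?w, j := ?w])"
    using uw ij vs by (intro form_add[OF m]) auto
  also have "\<dots> = (f (vs[i := ?u, j := ?u]) \<oplus> f (vs[i := ?w, j := ?u])) \<oplus>
      (f (vs[i := ?u, j := ?w]) \<oplus> f (vs[i := ?w, j := ?w]))"
    by (simp only: add uw)
  finally have "\<zero> = f (vs[i := ?w, j := ?u]) \<oplus> f vs"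
    unfolding id diag[OF uw(1)] diag[OF uw(2)] using form_closed[OF m t[OF uw(2,1)]] form_closed[OF m vs] by simp
  then show ?thesis
    using R.minus_equality[of "f (vs[i := ?w, j := ?u])" "f vs"] form_closed[OF m t[OF uw(2,1)]] form_closed[OF m vs] by simp
qed

end

text \<open>A finite free module, given by a basis \<open>E\<close> together with its dual
  functionals \<open>c\<close>. With \<open>c\<close> as data no injectivity of \<open>E\<close> is
  demanded, so the zero ring, where all \<open>E i\<close> coincide, is covered, and the functionals
  can be carried through scalar extension.\<close>

locale coordinates = module R M for R (structure) and M (structure) +
  fixes n :: nat and E :: "nat \<Rightarrow> 'c" and c :: "nat \<Rightarrow> 'c \<Rightarrow> 'a"
  assumes E_closed [intro, simp]: "i < n \<Longrightarrow> E i \<in> carrier M"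
    and c_closed [intro, simp]: "i < n \<Longrightarrow> v \<in> carrier M \<Longrightarrow> c i v \<in> carrier R"
    and c_add: "i < n \<Longrightarrow> u \<in> carrier M \<Longrightarrow> v \<in> carrier M \<Longrightarrow> c i (u \<oplus>\<^bsub>M\<^esub> v) = c i u \<oplus> c i v"
    and c_smult: "i < n \<Longrightarrow> a \<in> carrier R \<Longrightarrow> v \<in> carrier M \<Longrightarrow> c i (a \<odot>\<^bsub>M\<^esub> v) = a \<otimes> c i v"
    and c_E: "i < n \<Longrightarrow> j < n \<Longrightarrow> c i (E j) = (if i = j then \<one> else \<zero>)"
    and expand: "v \<in> carrier M \<Longrightarrow> (\<Oplus>\<^bsub>M\<^esub>i\<in>{..<n}. c i v \<odot>\<^bsub>M\<^esub> E i) = v"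
begin

lemma tuples_basis: "set ws \<subseteq> {..<n} \<Longrightarrow> length ws = r \<Longrightarrow> map E ws \<in> tuples M r"
  unfolding tuples_def by auto

lemma form_slot_expand:
  assumes f: "multilinear_form R M r f" and vs: "vs \<in> tuples M r" "k < r" and u: "u \<in> carrier M"
  shows "f (vs[k := u]) = (\<Oplus>i\<in>{..<n}. c i u \<otimes> f (vs[k := E i]))"
  using form_slot_sum[OF f vs, of "{..<n}" "\<lambda>i. c i u" E] u expand[OF u] by simp

lemma multilinear_form_eqI:
  assumes f: "multilinear_form R M r f" and g: "multilinear_form R M r g"
    and eq: "\<And>ws. set ws \<subseteq> {..<n} \<Longrightarrow> length ws = r \<Longrightarrow> f (map E ws) = g (map E ws)"
    and vs: "vs \<in> tuples M r"
  shows "f vs = g vs"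
proof -
  \<comment> \<open>\<open>k\<close> counts the leading slots that may still be arbitrary; all later
    slots hold basis vectors. Expanding the last free slot in the basis lowers \<open>k\<close>, and
    for \<open>k = r\<close> the restriction is void.\<close>
  have "f vs = g vs" if "k \<le> r" "vs \<in> tuples M r" "\<forall>i. k \<le> i \<longrightarrow> i < r \<longrightarrow> vs ! i \<in> E ` {..<n}" for k vs
    using that
  proof (induction k arbitrary: vs)
    case 0
    have "\<forall>i<r. \<exists>j<n. vs ! i = E j" using 0 by auto
    then obtain j where j: "\<And>i. i < r \<Longrightarrow> j i < n \<and> vs ! i = E (j i)" by metis
    have "vs = map E (map j [0..<r])" using j tuples_length[OF 0(2)] by (auto intro!: nth_equalityI)
    moreover have "f (map E (map j [0..<r])) = g (map E (map j [0..<r]))"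
      by (rule eq) (use j in auto)
    ultimately show ?case by simp
  next
    case (Suc k)
    have k: "k < r" using Suc.prems by simp
    have "f (vs[k := E i]) = g (vs[k := E i])" if "i < n" for i
    proof (rule Suc.IH)
      show "vs[k := E i] \<in> tuples M r" using Suc.prems(2) that by (intro tuples_update) auto
      show "\<forall>l\<ge>k. l < r \<longrightarrow> vs[k := E i] ! l \<in> E ` {..<n}"
      proof (intro allI impI)
        fix l assume "k \<le> l" "l < r"
        then show "vs[k := E i] ! l \<in> E ` {..<n}"
          using that Suc.prems(3)[rule_format, of l] tuples_length[OF Suc.prems(2)] by (cases "l = k") auto
      qed
    qed (use k in simp)
    moreover have c: "vs ! k \<in> carrier M" by (rule tuples_nth[OF Suc.prems(2) k])
    moreover have "f (vs[k := E i]) \<in> carrier R" "g (vs[k := E i]) \<in> carrier R" if "i < n" for i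
      using tuples_update[OF Suc.prems(2) E_closed[OF that]] form_closed[OF f] form_closed[OF g] by blast+
    ultimately have "(\<Oplus>i\<in>{..<n}. c i (vs ! k) \<otimes> f (vs[k := E i])) = (\<Oplus>i\<in>{..<n}. c i (vs ! k) \<otimes> g (vs[k := E i]))"
      by (intro R.finsum_cong') auto
    then have "f (vs[k := vs ! k]) = g (vs[k := vs ! k])"
      using form_slot_expand[OF f Suc.prems(2) k c] form_slot_expand[OF g Suc.prems(2) k c] by simp
    then show ?case by simp
  qed
  from this[of r vs] vs show ?thesis by simp
qed

lemma alternating_form_repeat:
  assumes f: "alternating_form R M r f" and ws: "set ws \<subseteq> {..<n}" "length ws = r" "\<not> distinct ws"
  shows "f (map E ws) = \<zero>"
proof -
  obtain i j where "i < r" "j < r" "i \<noteq> j" "ws ! i = ws ! j"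
    using ws(2,3) by (auto simp: distinct_conv_nth)
  then show ?thesis using ws
    by (intro alternating_form_zero[OF f tuples_basis[OF ws(1,2)], of i j]) auto
qed

text \<open>Index lists with repetitions contribute zero, so only permutations matter. A
  transposition negates both forms, hence agreement spreads from the identity to every permutation
  and no sign has to be computed.\<close>

lemma alternating_form_eqI:
  assumes f: "alternating_form R M n f" and g: "alternating_form R M n g"
    and eq: "f (map E [0..<n]) = g (map E [0..<n])" and vs: "vs \<in> tuples M n"
  shows "f vs = g vs"
proof (rule multilinear_form_eqI[OF alternating_form_multilinear[OF f] alternating_form_multilinear[OF g] _ vs])
  fix ws assume ws: "set ws \<subseteq> {..<n}" "length ws = n"
  show "f (map E ws) = g (map E ws)"
  proof (cases "distinct ws")
    case False
    then show ?thesis using alternating_form_repeat[OF f ws] alternating_form_repeat[OF g ws] by simp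
  next
    case True
    have *: "f (map (E \<circ> p) [0..<n]) = g (map (E \<circ> p) [0..<n])" if "p permutes {..<n}" for p
      using finite_lessThan that
    proof (induction p rule: permutes_rev_induct)
      case id
      then show ?case using eq by simp
    next
      case (swap a b p)
      let ?vs = "map (E \<circ> p) [0..<n]"
      have pn: "\<And>i. i < n \<Longrightarrow> p i < n" using permutes_in_image[of p "{..<n}"] swap.hyps(4) by simp
      have ab: "a < n" "b < n" "a \<noteq> b" using swap.hyps(1-3) by auto
      have t: "?vs \<in> tuples M n" using pn by (auto simp: tuples_def)
      have "map (E \<circ> (p \<circ> Transposition.transpose a b)) [0..<n] = ?vs[a := ?vs ! b, b := ?vs ! a]"
        using swap(1-3) by (auto intro!: nth_equalityI simp: nth_list_update transpose_def)
      then show ?case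
        using form_swap[OF f t ab] form_swap[OF g t ab] swap.IH by (simp only:)
    qed
    \<comment> \<open>\<open>n\<close> distinct indices below \<open>n\<close> exhaust all of them,
      so \<open>ws\<close> is a rearrangement of \<open>[0..<n]\<close>.\<close>
    have "set ws = set [0..<n]"
      using card_subset_eq[of "{..<n}" "set ws"] distinct_card[OF True] ws by (simp add: lessThan_atLeast0)
    then have "mset ws = mset [0..<n]"
      using set_eq_iff_mset_eq_distinct[OF True distinct_upt] by blast
    then obtain p where "p permutes {..<length [0..<n]}" "permute_list p [0..<n] = ws"
      by (metis mset_eq_permutation)
    moreover from this have "\<And>i. i < n \<Longrightarrow> p i < n" using permutes_in_image[of p "{..<n}"] by auto
    ultimately have "map E ws = map (E \<circ> p) [0..<n]" "p permutes {..<n}"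
      by (auto simp: permute_list_def)
    then show ?thesis using * by simp
  qed
qed

end

section \<open>The Leibniz determinant\<close>

lemma (in ring) add_pow_sign:
  assumes "x \<in> carrier R"
  shows "[(sign p :: int)] \<cdot> x = (if evenperm p then x else \<ominus> x)"
  using assms by (simp add: sign_def add_pow_def int_pow_def nat_pow_def a_inv_def)

lemma square_entry: "A \<in> {..<n} \<rightarrow> {..<n} \<rightarrow> C \<Longrightarrow> i < n \<Longrightarrow> j < n \<Longrightarrow> A i j \<in> C" for n :: nat
  by (auto simp: Pi_iff)

context cring
begin

lemma leibniz_term_closed [intro]:
  fixes n :: nat
  assumes "A \<in> {..<n} \<rightarrow> {..<n} \<rightarrow> carrier R" and "p permutes {..<n}"
  shows "(\<Otimes>i\<in>{..<n}. A i (p i)) \<in> carrier R"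
proof (rule finprod_closed, rule Pi_I)
  fix i assume "i \<in> {..<n}"
  then show "A i (p i) \<in> carrier R" using square_entry[OF assms(1), of i "p i"] permutes_in_image[OF assms(2), of i] by simp
qed

lemma leibniz_det_closed:
  assumes "A \<in> {..<n} \<rightarrow> {..<n} \<rightarrow> carrier R"
  shows "leibniz_det R n A \<in> carrier R"
  unfolding leibniz_det_def
  by (rule finsum_closed) (use leibniz_term_closed[OF assms] in \<open>auto simp: add_pow_sign\<close>)

lemma leibniz_det_cong:
  assumes A: "A \<in> {..<n} \<rightarrow> {..<n} \<rightarrow> carrier R"
    and eq: "\<And>i j. i < n \<Longrightarrow> j < n \<Longrightarrow> A i j = B i j"
  shows "leibniz_det R n A = leibniz_det R n B"
proof -
  have "(\<Otimes>i\<in>{..<n}. A i (p i)) = (\<Otimes>i\<in>{..<n}. B i (p i))" if "p permutes {..<n}" for p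
  proof (rule finprod_cong')
    show "\<And>i. i \<in> {..<n} \<Longrightarrow> A i (p i) = B i (p i)"
      using eq permutes_in_image[OF that] by simp
    show "(\<lambda>i. B i (p i)) \<in> {..<n} \<rightarrow> carrier R"
    proof (rule Pi_I)
      fix i assume "i \<in> {..<n}"
      then have "i < n" "p i < n" using permutes_in_image[OF that] by auto
      then show "B i (p i) \<in> carrier R" using square_entry[OF A] eq by simp
    qed
  qed simp
  then show ?thesis unfolding leibniz_det_def
    using leibniz_term_closed[OF A] by (intro finsum_cong') (auto simp: add_pow_sign)
qed

text \<open>A permutation other than the identity moves some \<open>k\<close>, and its product then
  contains the vanishing factor \<open>A k (p k)\<close>.\<close>

lemma leibniz_det_diagonal:
  assumes A: "A \<in> {..<n} \<rightarrow> {..<n} \<rightarrow> carrier R"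
    and z: "\<And>i j. i < n \<Longrightarrow> j < n \<Longrightarrow> i \<noteq> j \<Longrightarrow> A i j = \<zero>"
  shows "leibniz_det R n A = (\<Otimes>i\<in>{..<n}. A i i)"
proof -
  have *: "(\<Otimes>i\<in>{..<n}. A i (p i)) = \<zero>" if p: "p permutes {..<n}" "p \<noteq> id" for p
  proof -
    obtain k where k: "p k \<noteq> k" using p(2) by fastforce
    then have kn: "k < n" using permutes_not_in[OF p(1), of k] by auto
    have pn: "\<And>i. i < n \<Longrightarrow> p i < n" using permutes_in_image[OF p(1)] by simp
    have "(\<Otimes>i\<in>{..<n}. A i (p i)) = (\<Otimes>i\<in>insert k ({..<n} - {k}). A i (p i))"
      using kn by (simp add: insert_absorb)
    also have "\<dots> = A k (p k) \<otimes> (\<Otimes>i\<in>{..<n} - {k}. A i (p i))"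
      using square_entry[OF A] pn kn by (intro finprod_insert) auto
    also have "\<dots> = \<zero>"
      using z[of k "p k"] k kn pn square_entry[OF A] by (simp add: Pi_def)
    finally show ?thesis .
  qed
  have "leibniz_det R n A = (\<Oplus>p\<in>{p. p permutes {..<n}}. if id = p then (\<Otimes>i\<in>{..<n}. A i i) else \<zero>)"
    unfolding leibniz_det_def
    using leibniz_term_closed[OF A] leibniz_term_closed[OF A permutes_id] *
    by (intro finsum_cong') (auto simp: add_pow_sign)
  also have "\<dots> = (\<Otimes>i\<in>{..<n}. A i i)"
    using leibniz_term_closed[OF A permutes_id] permutes_id[of "{..<n}"]
    by (intro add.finprod_singleton) (auto simp: finite_permutations)
  finally show ?thesis .
qed

text \<open>Each Leibniz term meets column \<open>k\<close> exactly once, in the row that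
  \<open>p\<close> sends to \<open>k\<close>. Isolating this factor reduces linearity in a column to
  a ring law in each term.\<close>

lemma leibniz_term_split:
  fixes n :: nat
  assumes A: "A \<in> {..<n} \<rightarrow> {..<n} \<rightarrow> carrier R" and p: "p permutes {..<n}" and k: "k < n"
  shows "(\<Otimes>i\<in>{..<n}. A i (p i)) = A (inv_into UNIV p k) k \<otimes> (\<Otimes>i\<in>{..<n} - {inv_into UNIV p k}. A i (p i))"
proof -
  have i: "inv_into UNIV p k < n" using permutes_in_image[OF permutes_inv[OF p]] k by simp
  have pn: "\<And>i. i < n \<Longrightarrow> p i < n" using permutes_in_image[OF p] by simp
  have "(\<Otimes>i\<in>{..<n}. A i (p i)) = (\<Otimes>i\<in>insert (inv_into UNIV p k) ({..<n} - {inv_into UNIV p k}). A i (p i))"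
    using i by (simp add: insert_absorb)
  also have "\<dots> = A (inv_into UNIV p k) (p (inv_into UNIV p k)) \<otimes> (\<Otimes>i\<in>{..<n} - {inv_into UNIV p k}. A i (p i))"
    using square_entry[OF A] pn i by (intro finprod_insert) auto
  finally show ?thesis using permutes_inverses(1)[OF p] by simp
qed

text \<open>The factors outside that row avoid column \<open>k\<close>, so matrices that differ only
  in column \<open>k\<close> share them.\<close>

lemma leibniz_rest_eq:
  fixes n :: nat
  assumes p: "p permutes {..<n}" and B: "B \<in> {..<n} \<rightarrow> {..<n} \<rightarrow> carrier R"
    and eq: "\<And>i j. i < n \<Longrightarrow> j < n \<Longrightarrow> j \<noteq> k \<Longrightarrow> A i j = B i j"
  shows "(\<Otimes>i\<in>{..<n} - {inv_into UNIV p k}. A i (p i)) = (\<Otimes>i\<in>{..<n} - {inv_into UNIV p k}. B i (p i))"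
    and "(\<Otimes>i\<in>{..<n} - {inv_into UNIV p k}. B i (p i)) \<in> carrier R"
proof -
  have pn: "\<And>i. i < n \<Longrightarrow> p i < n" using permutes_in_image[OF p] by simp
  have pk: "p i \<noteq> k" if "i \<noteq> inv_into UNIV p k" for i using that permutes_inverses(2)[OF p] by metis
  show "(\<Otimes>i\<in>{..<n} - {inv_into UNIV p k}. A i (p i)) = (\<Otimes>i\<in>{..<n} - {inv_into UNIV p k}. B i (p i))"
    using pn pk square_entry[OF B] eq by (intro finprod_cong') auto
  show "(\<Otimes>i\<in>{..<n} - {inv_into UNIV p k}. B i (p i)) \<in> carrier R"
    using pn square_entry[OF B] by (intro finprod_closed) auto
qed

lemma leibniz_det_column_add:
  assumes A: "A \<in> {..<n} \<rightarrow> {..<n} \<rightarrow> carrier R"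
    and B: "B \<in> {..<n} \<rightarrow> {..<n} \<rightarrow> carrier R"
    and C: "C \<in> {..<n} \<rightarrow> {..<n} \<rightarrow> carrier R"
    and k: "k < n" and col: "\<And>i. i < n \<Longrightarrow> C i k = A i k \<oplus> B i k"
    and eq: "\<And>i j. i < n \<Longrightarrow> j < n \<Longrightarrow> j \<noteq> k \<Longrightarrow> C i j = A i j"
      "\<And>i j. i < n \<Longrightarrow> j < n \<Longrightarrow> j \<noteq> k \<Longrightarrow> B i j = A i j"
  shows "leibniz_det R n C = leibniz_det R n A \<oplus> leibniz_det R n B"
proof -
  have t: "(\<Otimes>i\<in>{..<n}. C i (p i)) = (\<Otimes>i\<in>{..<n}. A i (p i)) \<oplus> (\<Otimes>i\<in>{..<n}. B i (p i))"
    if p: "p permutes {..<n}" for p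
  proof -
    have i: "inv_into UNIV p k < n" using permutes_in_image[OF permutes_inv[OF p]] k by simp
    have r: "(\<Otimes>i\<in>{..<n} - {inv_into UNIV p k}. C i (p i)) = (\<Otimes>i\<in>{..<n} - {inv_into UNIV p k}. A i (p i))"
      "(\<Otimes>i\<in>{..<n} - {inv_into UNIV p k}. B i (p i)) = (\<Otimes>i\<in>{..<n} - {inv_into UNIV p k}. A i (p i))"
      using leibniz_rest_eq(1)[OF p A] eq by blast+
    show ?thesis
      unfolding leibniz_term_split[OF A p k] leibniz_term_split[OF B p k] leibniz_term_split[OF C p k] r col[OF i]
      using square_entry[OF A i k] square_entry[OF B i k] leibniz_rest_eq(2)[where A=A and B=A and k=k, OF p A refl] by (rule l_distr)
  qed
  have "leibniz_det R n C = (\<Oplus>p\<in>{p. p permutes {..<n}}.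
      [(sign p :: int)] \<cdot> (\<Otimes>i\<in>{..<n}. A i (p i)) \<oplus> [(sign p :: int)] \<cdot> (\<Otimes>i\<in>{..<n}. B i (p i)))"
    unfolding leibniz_det_def
    using leibniz_term_closed[OF A] leibniz_term_closed[OF B]
    by (intro finsum_cong') (auto simp: add_pow_sign t minus_add)
  also have "\<dots> = leibniz_det R n A \<oplus> leibniz_det R n B"
    unfolding leibniz_det_def using leibniz_term_closed[OF A] leibniz_term_closed[OF B]
    by (intro finsum_addf) (auto simp: add_pow_sign)
  finally show ?thesis .
qed

lemma leibniz_det_column_smult:
  assumes A: "A \<in> {..<n} \<rightarrow> {..<n} \<rightarrow> carrier R"
    and C: "C \<in> {..<n} \<rightarrow> {..<n} \<rightarrow> carrier R"
    and a: "a \<in> carrier R"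
    and k: "k < n" and col: "\<And>i. i < n \<Longrightarrow> C i k = a \<otimes> A i k"
    and eq: "\<And>i j. i < n \<Longrightarrow> j < n \<Longrightarrow> j \<noteq> k \<Longrightarrow> C i j = A i j"
  shows "leibniz_det R n C = a \<otimes> leibniz_det R n A"
proof -
  have t: "(\<Otimes>i\<in>{..<n}. C i (p i)) = a \<otimes> (\<Otimes>i\<in>{..<n}. A i (p i))"
    if p: "p permutes {..<n}" for p
  proof -
    have i: "inv_into UNIV p k < n" using permutes_in_image[OF permutes_inv[OF p]] k by simp
    have r: "(\<Otimes>i\<in>{..<n} - {inv_into UNIV p k}. C i (p i)) = (\<Otimes>i\<in>{..<n} - {inv_into UNIV p k}. A i (p i))"
      using leibniz_rest_eq(1)[OF p A] eq by blast
    show ?thesis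
      unfolding leibniz_term_split[OF A p k] leibniz_term_split[OF C p k] r col[OF i]
      using a square_entry[OF A i k] leibniz_rest_eq(2)[where A=A and B=A and k=k, OF p A refl] by (rule m_assoc)
  qed
  have "leibniz_det R n C = (\<Oplus>p\<in>{p. p permutes {..<n}}.
      a \<otimes> ([(sign p :: int)] \<cdot> (\<Otimes>i\<in>{..<n}. A i (p i))))"
    unfolding leibniz_det_def
    using leibniz_term_closed[OF A] a
    by (intro finsum_cong') (auto simp: add_pow_sign t r_minus)
  also have "\<dots> = a \<otimes> leibniz_det R n A"
    unfolding leibniz_det_def using leibniz_term_closed[OF A] a
    by (intro finsum_rdistr[symmetric]) (auto simp: add_pow_sign finite_permutations)
  finally show ?thesis .
qed

text \<open>Let \<tau> be the transposition of \<open>a\<close> and \<open>b\<close>. Composing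
  \<open>p\<close> with \<tau> keeps the product, since the two columns agree, and flips the parity;
  so the even and the odd terms cancel in pairs.\<close>

lemma leibniz_det_equal_columns:
  assumes A: "A \<in> {..<n} \<rightarrow> {..<n} \<rightarrow> carrier R"
    and ab: "a < n" "b < n" "a \<noteq> b" and eq: "\<And>i. i < n \<Longrightarrow> A i a = A i b"
  shows "leibniz_det R n A = \<zero>"
proof -
  define t where "t p = (\<Otimes>i\<in>{..<n}. A i (p i))" for p
  define \<tau> where "\<tau> = Transposition.transpose a b"
  let ?S = "{p. p permutes {..<n}}"
  let ?ev = "{p \<in> ?S. evenperm p}" and ?od = "{p \<in> ?S. \<not> evenperm p}"
  have tc: "t p \<in> carrier R" if "p permutes {..<n}" for p
    unfolding t_def using leibniz_term_closed[OF A that] .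
  have \<tau>: "\<tau> permutes {..<n}" unfolding \<tau>_def using ab by (intro permutes_swap_id) auto
  have tt: "\<tau> \<circ> (\<tau> \<circ> p) = p" for p :: "nat \<Rightarrow> nat" unfolding \<tau>_def by (simp add: fun_eq_iff)
  have ev: "evenperm (\<tau> \<circ> p) \<longleftrightarrow> \<not> evenperm p" if "p permutes {..<n}" for p
  proof -
    have "permutation \<tau>" "permutation p"
      using \<tau> that permutation_permutes by (auto intro!: permutation_permutes[THEN iffD2])
    then show ?thesis
      using evenperm_comp[of \<tau> p] evenperm_swap[of a b] ab unfolding \<tau>_def by simp
  qed
  have od: "?od = (\<lambda>p. \<tau> \<circ> p) ` ?ev"
  proof (intro equalityI subsetI)
    fix p assume "p \<in> ?od"
    then have "\<tau> \<circ> p \<in> ?ev" using ev permutes_compose[OF _ \<tau>] by simp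
    then have "\<tau> \<circ> (\<tau> \<circ> p) \<in> (\<lambda>p. \<tau> \<circ> p) ` ?ev" by (rule imageI)
    then show "p \<in> (\<lambda>p. \<tau> \<circ> p) ` ?ev" by (simp only: tt)
  next
    fix p assume "p \<in> (\<lambda>p. \<tau> \<circ> p) ` ?ev"
    then show "p \<in> ?od" using ev permutes_compose[OF _ \<tau>] by auto
  qed
  have t\<tau>: "t (\<tau> \<circ> p) = t p" if "p permutes {..<n}" for p
  proof -
    have "\<And>i. i < n \<Longrightarrow> p i < n" using permutes_in_image[OF that] by simp
    then show ?thesis unfolding t_def \<tau>_def
      using square_entry[OF A] eq ab by (intro finprod_cong') (auto simp: transpose_def)
  qed
  have fin: "finite ?S" by (simp add: finite_permutations)
  have "leibniz_det R n A = (\<Oplus>p\<in>?ev \<union> ?od. if evenperm p then t p else \<ominus> t p)"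
    unfolding leibniz_det_def
    using tc by (intro finsum_cong') (auto simp: add_pow_sign t_def)
  also have "\<dots> = (\<Oplus>p\<in>?ev. if evenperm p then t p else \<ominus> t p) \<oplus> (\<Oplus>p\<in>?od. if evenperm p then t p else \<ominus> t p)"
    using tc fin by (intro finsum_Un_disjoint) auto
  also have "(\<Oplus>p\<in>?od. if evenperm p then t p else \<ominus> t p) = (\<Oplus>p\<in>?ev. if evenperm (\<tau> \<circ> p) then t (\<tau> \<circ> p) else \<ominus> t (\<tau> \<circ> p))"
    unfolding od
    using tc permutes_compose[OF _ \<tau>] tt by (intro finsum_reindex) (auto intro!: inj_on_inverseI[where g="\<lambda>p. \<tau> \<circ> p"])
  also have "(\<Oplus>p\<in>?ev. if evenperm p then t p else \<ominus> t p) \<oplus> \<dots> = (\<Oplus>p\<in>?ev. (if evenperm p then t p else \<ominus> t p) \<oplus> (if evenperm (\<tau> \<circ> p) then t (\<tau> \<circ> p) else \<ominus> t (\<tau> \<circ> p)))"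
    using tc permutes_compose[OF _ \<tau>] by (intro finsum_addf[symmetric]) auto
  also have "\<dots> = (\<Oplus>p\<in>?ev. \<zero>)"
    using tc t\<tau> ev by (intro finsum_cong') (auto simp: r_neg)
  finally show ?thesis by simp
qed

end

lemma (in ring_hom_cring) leibniz_det_hom:
  assumes A: "A \<in> {..<n} \<rightarrow> {..<n} \<rightarrow> carrier R"
  shows "h (leibniz_det R n A) = leibniz_det S n (\<lambda>i j. h (A i j))"
proof -
  have t: "h (\<Otimes>i\<in>{..<n}. A i (p i)) = (\<Otimes>\<^bsub>S\<^esub>i\<in>{..<n}. h (A i (p i)))" if p: "p permutes {..<n}" for p
  proof -
    have "(\<lambda>i. A i (p i)) \<in> {..<n} \<rightarrow> carrier R" using square_entry[OF A] permutes_in_image[OF p] by auto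
    then show ?thesis using hom_finprod[of "\<lambda>i. A i (p i)" "{..<n}"] by (simp add: comp_def)
  qed
  have c: "(\<Otimes>\<^bsub>S\<^esub>i\<in>{..<n}. h (A i (p i))) \<in> carrier S" if p: "p permutes {..<n}" for p
    using S.leibniz_term_closed[where A="\<lambda>i j. h (A i j)", OF _ p] square_entry[OF A] by auto
  have "h (leibniz_det R n A) = (\<Oplus>\<^bsub>S\<^esub>p\<in>{p. p permutes {..<n}}. h ([(sign p :: int)] \<cdot> (\<Otimes>i\<in>{..<n}. A i (p i))))"
    unfolding leibniz_det_def using R.leibniz_term_closed[OF A]
    by (subst hom_finsum) (auto simp: R.add_pow_sign comp_def)
  also have "\<dots> = leibniz_det S n (\<lambda>i j. h (A i j))"
    unfolding leibniz_det_def using R.leibniz_term_closed[OF A] c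
    by (intro S.finsum_cong') (auto simp: R.add_pow_sign S.add_pow_sign t)
  finally show ?thesis .
qed

section \<open>The coordinate determinant as generator of the alternating forms of top
  degree\<close>

context coordinates
begin

text \<open>The vectors form the columns, to match the column rules for
  \<open>leibniz_det\<close>.\<close>

definition coord_det :: "'c list \<Rightarrow> 'a" where
  "coord_det vs = leibniz_det R n (\<lambda>i j. c i (vs ! j))"

lemma coord_det_alternating: "alternating_form R M n coord_det"
proof -
  have cl: "(\<lambda>i j. c i (vs ! j)) \<in> {..<n} \<rightarrow> {..<n} \<rightarrow> carrier R" if "vs \<in> tuples M n" for vs
    using tuples_nth[OF that] by auto
  have "multilinear_form R M n coord_det"
  proof (rule multilinear_formI)
    show "coord_det vs \<in> carrier R" if "vs \<in> tuples M n" for vs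
      unfolding coord_det_def by (rule R.leibniz_det_closed) (rule cl[OF that])
  next
    fix vs i u w assume h: "vs \<in> tuples M n" "i < n" "u \<in> carrier M" "w \<in> carrier M"
    note t = tuples_update[OF h(1,3), of i] tuples_update[OF h(1,4), of i] tuples_update[OF h(1) M.a_closed[OF h(3,4)], of i]
    show "coord_det (vs[i := u \<oplus>\<^bsub>M\<^esub> w]) = coord_det (vs[i := u]) \<oplus> coord_det (vs[i := w])"
      unfolding coord_det_def
      by (rule R.leibniz_det_column_add[OF cl[OF t(1)] cl[OF t(2)] cl[OF t(3)] h(2)])
        (use h tuples_length[OF h(1)] c_add in auto)
  next
    fix vs i a u assume h: "vs \<in> tuples M n" "i < n" "a \<in> carrier R" "u \<in> carrier M"
    note t = tuples_update[OF h(1,4), of i] tuples_update[OF h(1) smult_closed[OF h(3,4)], of i]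
    show "coord_det (vs[i := a \<odot>\<^bsub>M\<^esub> u]) = a \<otimes> coord_det (vs[i := u])"
      unfolding coord_det_def
      by (rule R.leibniz_det_column_smult[OF cl[OF t(1)] cl[OF t(2)] h(3) h(2)])
        (use h tuples_length[OF h(1)] c_smult in auto)
  qed
  moreover have "coord_det vs = \<zero>" if "vs \<in> tuples M n" "i < n" "j < n" "i \<noteq> j" "vs ! i = vs ! j" for vs i j
    unfolding coord_det_def
    by (rule R.leibniz_det_equal_columns[OF cl[OF that(1)] that(2-4)]) (use that in auto)
  ultimately show ?thesis unfolding alternating_form_def by simp
qed

lemmas coord_det_multilinear = alternating_form_multilinear[OF coord_det_alternating]

lemmas coord_det_closed = form_closed[OF coord_det_multilinear]

lemma tuples_E: "map E [0..<n] \<in> tuples M n"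
  by (auto simp: tuples_def)

lemma coord_det_basis: "coord_det (map E [0..<n]) = \<one>"
proof -
  have "coord_det (map E [0..<n]) = (\<Otimes>i\<in>{..<n}. c i (map E [0..<n] ! i))"
    unfolding coord_det_def by (intro R.leibniz_det_diagonal) (auto simp: c_E)
  also have "\<dots> = \<one>" by (intro R.finprod_one_eqI) (auto simp: c_E)
  finally show ?thesis .
qed

lemma alternating_form_scale:
  assumes f: "alternating_form R M n f" and a: "a \<in> carrier R"
  shows "alternating_form R M n (\<lambda>vs. a \<otimes> f vs)"
proof -
  note m = alternating_form_multilinear[OF f]
  have "multilinear_form R M n (\<lambda>vs. a \<otimes> f vs)"
    using a form_closed[OF m] by (intro multilinear_formI)
      (auto simp: form_add[OF m] form_smult[OF m] tuples_update R.r_distr R.m_lcomm)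
  then show ?thesis using f a unfolding alternating_form_def by simp
qed

text \<open>Both sides are alternating and agree on the basis, where \<open>coord_det\<close> is
  one. This is the source of the multiplicativity of determinants, of their independence of the
  basis and of the shape of the volume form.\<close>

lemma alternating_form_eq_coord_det:
  assumes f: "alternating_form R M n f" and vs: "vs \<in> tuples M n"
  shows "f vs = f (map E [0..<n]) \<otimes> coord_det vs"
proof -
  have c: "f (map E [0..<n]) \<in> carrier R" by (rule form_closed[OF alternating_form_multilinear[OF f] tuples_E])
  show ?thesis
    by (rule alternating_form_eqI[OF f alternating_form_scale[OF coord_det_alternating c] _ vs])
      (simp add: coord_det_basis c)
qed

end

section \<open>Bases and the determinant of an endomorphism\<close>

context coordinates
begin

lemma c_zero: "i < n \<Longrightarrow> c i \<zero>\<^bsub>M\<^esub> = \<zero>"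
  using c_smult[of i \<zero> "\<zero>\<^bsub>M\<^esub>"] by simp

lemma c_finsum:
  assumes i: "i < n" and "finite I" "f \<in> I \<rightarrow> carrier M"
  shows "c i (\<Oplus>\<^bsub>M\<^esub>j\<in>I. f j) = (\<Oplus>j\<in>I. c i (f j))"
  using assms(2,3)
proof (induction I)
  case empty
  then show ?case using c_zero i by simp
next
  case (insert x I)
  then have f: "f x \<in> carrier M" "f \<in> I \<rightarrow> carrier M" by auto
  moreover have "(\<lambda>j. c i (f j)) \<in> I \<rightarrow> carrier R" using i f(2) by auto
  ultimately show ?case using insert.hyps insert.IH i by (simp add: c_add M.finsum_closed)
qed

lemma c_combination:
  assumes i: "i < n" and x: "x \<in> {..<n} \<rightarrow> carrier R"
  shows "c i (\<Oplus>\<^bsub>M\<^esub>j\<in>{..<n}. x j \<odot>\<^bsub>M\<^esub> E j) = x i"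
proof -
  have "c i (\<Oplus>\<^bsub>M\<^esub>j\<in>{..<n}. x j \<odot>\<^bsub>M\<^esub> E j) = (\<Oplus>j\<in>{..<n}. c i (x j \<odot>\<^bsub>M\<^esub> E j))"
    using x by (intro c_finsum[OF i]) auto
  also have "\<dots> = (\<Oplus>j\<in>{..<n}. if i = j then x j else \<zero>)"
    using x i by (intro R.finsum_cong') (auto simp: c_smult c_E Pi_iff)
  also have "\<dots> = x i" using x i by (intro R.finsum_singleton) auto
  finally show ?thesis .
qed

lemma coordinates_eqI:
  assumes "u \<in> carrier M" "v \<in> carrier M" "\<And>i. i < n \<Longrightarrow> c i u = c i v"
  shows "u = v"
proof -
  have "(\<Oplus>\<^bsub>M\<^esub>i\<in>{..<n}. c i u \<odot>\<^bsub>M\<^esub> E i) = (\<Oplus>\<^bsub>M\<^esub>i\<in>{..<n}. c i v \<odot>\<^bsub>M\<^esub> E i)"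
    using assms by (intro M.finsum_cong') auto
  then show ?thesis using expand assms by simp
qed

text \<open>Bridges the sums over indices used here and the set-based \<open>lincomb\<close>;
  injectivity allows coefficients to move from indices to vectors.\<close>

lemma combination_as_lincomb:
  assumes "inj_on E {..<n}" "x \<in> {..<n} \<rightarrow> carrier R"
  shows "(\<Oplus>\<^bsub>M\<^esub>i\<in>{..<n}. x i \<odot>\<^bsub>M\<^esub> E i) = lincomb (x \<circ> the_inv_into {..<n} E) (E ` {..<n})"
    and "x \<circ> the_inv_into {..<n} E \<in> E ` {..<n} \<rightarrow> carrier R"
proof -
  show c: "x \<circ> the_inv_into {..<n} E \<in> E ` {..<n} \<rightarrow> carrier R"
    using assms by (auto simp: the_inv_into_f_f)
  have "lincomb (x \<circ> the_inv_into {..<n} E) (E ` {..<n}) =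
      (\<Oplus>\<^bsub>M\<^esub>i\<in>{..<n}. (x \<circ> the_inv_into {..<n} E) (E i) \<odot>\<^bsub>M\<^esub> E i)"
    unfolding lincomb_def using assms c by (intro M.finsum_reindex) (auto simp: the_inv_into_f_f Pi_iff)
  also have "\<dots> = (\<Oplus>\<^bsub>M\<^esub>i\<in>{..<n}. x i \<odot>\<^bsub>M\<^esub> E i)"
    using assms by (intro M.finsum_cong') (auto simp: the_inv_into_f_f Pi_iff)
  finally show "(\<Oplus>\<^bsub>M\<^esub>i\<in>{..<n}. x i \<odot>\<^bsub>M\<^esub> E i) = lincomb (x \<circ> the_inv_into {..<n} E) (E ` {..<n})" ..
qed

lemma lincomb_as_combination:
  assumes "inj_on E {..<n}" "a \<in> E ` {..<n} \<rightarrow> carrier R"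
  shows "lincomb a (E ` {..<n}) = (\<Oplus>\<^bsub>M\<^esub>i\<in>{..<n}. a (E i) \<odot>\<^bsub>M\<^esub> E i)"
  unfolding lincomb_def using assms by (intro M.finsum_reindex) auto

lemma inj_E: "\<one> \<noteq> \<zero> \<Longrightarrow> inj_on E {..<n}"
  by (metis (no_types, lifting) c_E inj_onI lessThan_iff)

lemma ordered_basis_E:
  assumes nt: "\<one> \<noteq> \<zero>"
  shows "ordered_basis R M (map E [0..<n])"
proof -
  note inj = inj_E[OF nt]
  have set: "set (map E [0..<n]) = E ` {..<n}" by auto
  have "lin_indpt (E ` {..<n})"
  proof (rule finite_lin_indpt2)
    fix a assume a: "a \<in> E ` {..<n} \<rightarrow> carrier R" "lincomb a (E ` {..<n}) = \<zero>\<^bsub>M\<^esub>"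
    have "(\<lambda>i. a (E i)) \<in> {..<n} \<rightarrow> carrier R" using a(1) by auto
    then have "a (E i) = \<zero>" if "i < n" for i
      using c_combination[OF that] lincomb_as_combination[OF inj a(1)] c_zero[OF that] a(2) by metis
    then show "\<forall>v\<in>E ` {..<n}. a v = \<zero>" by auto
  qed auto
  moreover have "span (E ` {..<n}) = carrier M"
  proof
    show "span (E ` {..<n}) \<subseteq> carrier M" by (rule span_is_subset2) auto
    show "carrier M \<subseteq> span (E ` {..<n})"
    proof
      fix v assume v: "v \<in> carrier M"
      then have x: "(\<lambda>i. c i v) \<in> {..<n} \<rightarrow> carrier R" by auto
      show "v \<in> span (E ` {..<n})"
        unfolding span_def using combination_as_lincomb[OF inj x] expand[OF v] by force
    qed
  qed
  moreover have "distinct (map E [0..<n])"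
    using inj by (simp add: distinct_map lessThan_atLeast0)
  ultimately show ?thesis unfolding ordered_basis_def set by auto
qed

text \<open>Pigeonhole: among \<open>m\<close> indices below \<open>n < m\<close> one repeats, so
  the form is zero on all lists of basis vectors.\<close>

lemma alternating_form_vanishes:
  assumes f: "alternating_form R M m f" and "n < m" and vs: "vs \<in> tuples M m"
  shows "f vs = \<zero>"
proof (rule multilinear_form_eqI[OF alternating_form_multilinear[OF f] _ _ vs])
  show "multilinear_form R M m (\<lambda>_. \<zero>)" by (rule multilinear_formI) auto
  fix ws assume ws: "set ws \<subseteq> {..<n}" "length ws = m"
  then have "\<not> distinct ws" using \<open>n < m\<close> card_mono[of "{..<n}" "set ws"] distinct_card[of ws] by auto
  then show "f (map E ws) = \<zero>" using alternating_form_repeat[OF f ws] by simp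
qed

end

text \<open>Invariance of rank without a field: if \<open>m\<close> exceeded \<open>n\<close>, the
  determinant of the second basis would be an alternating form in too many variables, hence zero,
  although it is one on its own basis.\<close>

lemma coordinates_rank_le:
  assumes "coordinates R M n E c" "coordinates R M m E' c'" "\<one>\<^bsub>R\<^esub> \<noteq> \<zero>\<^bsub>R\<^esub>"
  shows "m \<le> n"
proof (rule ccontr)
  interpret A: coordinates R M n E c by fact
  interpret B: coordinates R M m E' c' by fact
  assume "\<not> m \<le> n"
  then show False
    using A.alternating_form_vanishes[OF B.coord_det_alternating _ B.tuples_E] B.coord_det_basis assms(3) by simp
qed

context module
begin

text \<open>The coefficients are picked by choice. Additivity, homogeneity and duality follow from
  their uniqueness, because both sides of each law are coefficient families of the same
  vector.\<close>

lemma coordinates_exist: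
  assumes E: "\<And>i. i < n \<Longrightarrow> E i \<in> carrier M"
    and span: "\<And>v. v \<in> carrier M \<Longrightarrow> \<exists>x\<in>{..<n} \<rightarrow> carrier R. (\<Oplus>\<^bsub>M\<^esub>i\<in>{..<n}. x i \<odot>\<^bsub>M\<^esub> E i) = v"
    and indep: "\<And>x i. x \<in> {..<n} \<rightarrow> carrier R \<Longrightarrow> (\<Oplus>\<^bsub>M\<^esub>i\<in>{..<n}. x i \<odot>\<^bsub>M\<^esub> E i) = \<zero>\<^bsub>M\<^esub> \<Longrightarrow> i < n \<Longrightarrow> x i = \<zero>"
  shows "\<exists>c. coordinates R M n E c"
proof -
  define S where "S x = (\<Oplus>\<^bsub>M\<^esub>i\<in>{..<n}. x i \<odot>\<^bsub>M\<^esub> E i)" for x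
  have Sc: "S x \<in> carrier M" if "x \<in> {..<n} \<rightarrow> carrier R" for x
    unfolding S_def using that E by (intro M.finsum_closed) auto
  have Sadd: "S (\<lambda>i. x i \<oplus> y i) = S x \<oplus>\<^bsub>M\<^esub> S y" if "x \<in> {..<n} \<rightarrow> carrier R" "y \<in> {..<n} \<rightarrow> carrier R" for x y
  proof -
    have "S (\<lambda>i. x i \<oplus> y i) = (\<Oplus>\<^bsub>M\<^esub>i\<in>{..<n}. x i \<odot>\<^bsub>M\<^esub> E i \<oplus>\<^bsub>M\<^esub> y i \<odot>\<^bsub>M\<^esub> E i)"
      unfolding S_def using that E by (intro M.finsum_cong') (auto simp: smult_l_distr Pi_iff)
    then show ?thesis unfolding S_def using that E by (subst M.finsum_addf[symmetric]) auto
  qed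
  have Ssm: "S (\<lambda>i. a \<otimes> x i) = a \<odot>\<^bsub>M\<^esub> S x" if "x \<in> {..<n} \<rightarrow> carrier R" "a \<in> carrier R" for a x
  proof -
    have "S (\<lambda>i. a \<otimes> x i) = (\<Oplus>\<^bsub>M\<^esub>i\<in>{..<n}. a \<odot>\<^bsub>M\<^esub> (x i \<odot>\<^bsub>M\<^esub> E i))"
      unfolding S_def using that E by (intro M.finsum_cong') (auto simp: smult_assoc1 Pi_iff)
    then show ?thesis unfolding S_def using that E by (subst finsum_smult_ldistr) auto
  qed
  \<comment> \<open>The difference of the two families is a relation among the \<open>E i\<close>;
    it is written with the scalar minus one so that \<open>Sadd\<close> and \<open>Ssm\<close>
    suffice to evaluate it.\<close>
  have uniq: "x i = y i" if x: "x \<in> {..<n} \<rightarrow> carrier R" and y: "y \<in> {..<n} \<rightarrow> carrier R" and "S x = S y" "i < n" for x y i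
  proof -
    have n1: "\<ominus> \<one> \<in> carrier R" by simp
    have my: "(\<lambda>i. \<ominus> \<one> \<otimes> y i) \<in> {..<n} \<rightarrow> carrier R" using y by auto
    have "S (\<lambda>i. x i \<oplus> \<ominus> \<one> \<otimes> y i) = S y \<oplus>\<^bsub>M\<^esub> \<ominus> \<one> \<odot>\<^bsub>M\<^esub> S y"
      using Sadd[OF x my] Ssm[OF y n1] that(3) by simp
    also have "\<dots> = \<zero>\<^bsub>M\<^esub>" using Sc[OF y] by (simp add: smult_l_minus M.r_neg)
    finally have "x i \<oplus> \<ominus> \<one> \<otimes> y i = \<zero>"
      using indep[of "\<lambda>i. x i \<oplus> \<ominus> \<one> \<otimes> y i" i] x y that(4) unfolding S_def by auto
    moreover have "x i \<in> carrier R" "y i \<in> carrier R" using x y that(4) by auto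
    ultimately show ?thesis by (simp add: R.l_minus R.minus_equality R.minus_unique) (metis R.minus_equality R.minus_minus R.a_inv_closed)
  qed
  have "\<exists>x. v \<in> carrier M \<longrightarrow> x \<in> {..<n} \<rightarrow> carrier R \<and> S x = v" for v
    using span unfolding S_def by metis
  then obtain X where X: "\<And>v. v \<in> carrier M \<Longrightarrow> X v \<in> {..<n} \<rightarrow> carrier R" "\<And>v. v \<in> carrier M \<Longrightarrow> S (X v) = v"
    by metis
  have "coordinates R M n E (\<lambda>i v. X v i)"
  proof (unfold_locales)
    fix i u v assume h: "i < n" "u \<in> carrier M" "v \<in> carrier M"
    show "X (u \<oplus>\<^bsub>M\<^esub> v) i = X u i \<oplus> X v i"
      using X h Sadd[OF X(1) X(1)] by (intro uniq) (auto simp: Pi_iff)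
  next
    fix i a v assume h: "i < n" "a \<in> carrier R" "v \<in> carrier M"
    show "X (a \<odot>\<^bsub>M\<^esub> v) i = a \<otimes> X v i"
      using X h Ssm[OF X(1)] by (intro uniq) (auto simp: Pi_iff)
  next
    fix i j assume h: "i < n" "j < n"
    have "S (\<lambda>i. if j = i then \<one> else \<zero>) = (\<Oplus>\<^bsub>M\<^esub>i\<in>{..<n}. if j = i then E i else \<zero>\<^bsub>M\<^esub>)"
      unfolding S_def using E by (intro M.finsum_cong') auto
    also have "\<dots> = E j" using E h by (intro M.finsum_singleton) auto
    finally have "X (E j) i = (if j = i then \<one> else \<zero>)" using X E h by (intro uniq[of _ "\<lambda>i. if j = i then \<one> else \<zero>"]) auto
    then show "X (E j) i = (if i = j then \<one> else \<zero>)" by auto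
  next
    fix v assume "v \<in> carrier M"
    then show "(\<Oplus>\<^bsub>M\<^esub>i\<in>{..<n}. X v i \<odot>\<^bsub>M\<^esub> E i) = v" using X(2) unfolding S_def by simp
  qed (use X E in \<open>auto simp: Pi_iff\<close>)
  then show ?thesis by blast
qed

lemma ordered_basis_coordinates:
  assumes b: "ordered_basis R M bs"
  shows "\<exists>c. coordinates R M (length bs) ((!) bs) c"
proof (rule coordinates_exist)
  have bs: "distinct bs" "set bs \<subseteq> carrier M" "lin_indpt (set bs)" "span (set bs) = carrier M"
    using b unfolding ordered_basis_def by auto
  have img: "(!) bs ` {..<length bs} = set bs" by (auto simp: set_conv_nth)
  have inj: "inj_on ((!) bs) {..<length bs}" using bs(1) by (auto simp: inj_on_def nth_eq_iff_index_eq)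
  have lc: "lincomb a (set bs) = (\<Oplus>\<^bsub>M\<^esub>i\<in>{..<length bs}. a (bs ! i) \<odot>\<^bsub>M\<^esub> bs ! i)" if "a \<in> set bs \<rightarrow> carrier R" for a
    unfolding lincomb_def img[symmetric] using that bs(2) inj by (intro M.finsum_reindex) (auto simp: Pi_iff subset_iff)
  show "bs ! i \<in> carrier M" if "i < length bs" for i using that bs(2) by auto
  show "\<exists>x\<in>{..<length bs} \<rightarrow> carrier R. (\<Oplus>\<^bsub>M\<^esub>i\<in>{..<length bs}. x i \<odot>\<^bsub>M\<^esub> bs ! i) = v" if v: "v \<in> carrier M" for v
  proof -
    have "v \<in> {lincomb a (set bs) | a. a \<in> set bs \<rightarrow> carrier R}"
      using v bs(2,4) finite_span[of "set bs"] by simp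
    then obtain a where "a \<in> set bs \<rightarrow> carrier R" "v = lincomb a (set bs)" by blast
    then show ?thesis using lc by (intro bexI[of _ "\<lambda>i. a (bs ! i)"]) auto
  qed
  show "x i = \<zero>" if x: "x \<in> {..<length bs} \<rightarrow> carrier R" and z: "(\<Oplus>\<^bsub>M\<^esub>i\<in>{..<length bs}. x i \<odot>\<^bsub>M\<^esub> bs ! i) = \<zero>\<^bsub>M\<^esub>"
    and i: "i < length bs" for x i
  proof -
    define a where "a = x \<circ> the_inv_into {..<length bs} ((!) bs)"
    have ai: "a (bs ! j) = x j" if "j < length bs" for j
      unfolding a_def using the_inv_into_f_f[OF inj] that by simp
    have a: "a \<in> set bs \<rightarrow> carrier R" using ai x by (auto simp: set_conv_nth)
    have "lincomb a (set bs) = (\<Oplus>\<^bsub>M\<^esub>i\<in>{..<length bs}. x i \<odot>\<^bsub>M\<^esub> bs ! i)"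
      unfolding lc[OF a] using ai x bs(2) by (intro M.finsum_cong') (auto simp: Pi_iff subset_iff)
    then have "a (bs ! i) = \<zero>"
      using bs(3) z a i unfolding lin_dep_def by (metis List.finite_set nth_mem subset_refl)
    then show ?thesis using ai i by simp
  qed
qed

end

section \<open>Determinants of endomorphisms\<close>

context coordinates
begin

lemma alternating_form_compose:
  assumes f: "alternating_form R M r f" and h: "h \<in> module_hom R M M"
  shows "alternating_form R M r (\<lambda>vs. f (map h vs))"
proof -
  note m = alternating_form_multilinear[OF f]
  have hc: "h x \<in> carrier M" if "x \<in> carrier M" for x using h that by (auto simp: module_hom_def)
  have t: "map h vs \<in> tuples M r" if "vs \<in> tuples M r" for vs using that hc by (intro tuples_map) auto
  have "multilinear_form R M r (\<lambda>vs. f (map h vs))"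
  proof (rule multilinear_formI)
    show "f (map h vs) \<in> carrier R" if "vs \<in> tuples M r" for vs using form_closed[OF m t[OF that]] .
    fix vs i assume vs: "vs \<in> tuples M r" "i < r"
    show "f (map h (vs[i := u \<oplus>\<^bsub>M\<^esub> w])) = f (map h (vs[i := u])) \<oplus> f (map h (vs[i := w]))"
      if "u \<in> carrier M" "w \<in> carrier M" for u w
      using form_add[OF m t[OF vs(1)] vs(2), of "h u" "h w"] h hc that by (simp add: map_update module_hom_def)
    show "f (map h (vs[i := a \<odot>\<^bsub>M\<^esub> u])) = a \<otimes> f (map h (vs[i := u]))"
      if "a \<in> carrier R" "u \<in> carrier M" for u a
      using form_smult[OF m t[OF vs(1)] vs(2), of a "h u"] h hc that by (simp add: map_update module_hom_def)
  qed
  moreover have "f (map h vs) = \<zero>" if "vs \<in> tuples M r" "i < r" "j < r" "i \<noteq> j" "vs ! i = vs ! j" for vs i j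
    using alternating_form_zero[OF f t[OF that(1)] that(2-4)] that tuples_length[OF that(1)] by simp
  ultimately show ?thesis unfolding alternating_form_def by simp
qed

text \<open>Pulling back along \<open>h\<close> keeps \<open>coord_det\<close> alternating, so the
  result is a multiple of \<open>coord_det\<close>; the factor is read off at the basis.\<close>

lemma coord_det_hom:
  assumes h: "h \<in> module_hom R M M" and vs: "vs \<in> tuples M n"
  shows "coord_det (map h vs) = coord_det (map h (map E [0..<n])) \<otimes> coord_det vs"
  using alternating_form_eq_coord_det[OF alternating_form_compose[OF coord_det_alternating h] vs] .

lemma matrix_det:
  assumes h: "h \<in> module_hom R M M"
    and A: "\<And>i j. i < n \<Longrightarrow> j < n \<Longrightarrow> A i j \<in> carrier R"
    and eq: "\<And>j. j < n \<Longrightarrow> h (E j) = (\<Oplus>\<^bsub>M\<^esub>i\<in>{..<n}. A i j \<odot>\<^bsub>M\<^esub> E i)"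
  shows "leibniz_det R n A = coord_det (map h (map E [0..<n]))"
  unfolding coord_det_def
proof (rule R.leibniz_det_cong)
  fix i j assume "i < n" "j < n"
  then show "A i j = c i (map h (map E [0..<n]) ! j)"
    using c_combination[of i "\<lambda>i. A i j"] A eq by auto
qed (use A in auto)

text \<open>The form \<open>coord_det\<close> at the images of \<open>E'\<close> is evaluated in two
  ways: through the determinant form of \<open>E'\<close>, and by extracting the factor that
  \<open>h\<close> contributes. The common factor, \<open>coord_det\<close> at \<open>E'\<close>, is
  a unit and cancels.\<close>

lemma det_basis_change:
  assumes h: "h \<in> module_hom R M M" and c': "coordinates R M n E' c'"
  shows "coordinates.coord_det R n c' (map h (map E' [0..<n])) = coord_det (map h (map E [0..<n]))"
proof -
  interpret B: coordinates R M n E' c' by fact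
  let ?E = "map E [0..<n]" and ?E' = "map E' [0..<n]"
  have hE: "map h ?E' \<in> tuples M n" "map h ?E \<in> tuples M n"
    using h by (auto intro!: tuples_map[OF _ B.tuples_E] tuples_map[OF _ tuples_E] simp del: map_map simp: module_hom_def)
  note cl = coord_det_closed[OF B.tuples_E] B.coord_det_closed[OF tuples_E]
    coord_det_closed[OF hE(2)] B.coord_det_closed[OF hE(1)]
  \<comment> \<open>The two change-of-basis determinants are inverse to each other.\<close>
  have 1: "coord_det ?E' \<otimes> B.coord_det ?E = \<one>"
    using B.alternating_form_eq_coord_det[OF coord_det_alternating tuples_E] coord_det_basis by simp
  have "coord_det ?E' \<otimes> B.coord_det (map h ?E') = coord_det (map h ?E) \<otimes> coord_det ?E'"
    using B.alternating_form_eq_coord_det[OF coord_det_alternating hE(1)]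
      coord_det_hom[OF h B.tuples_E] by simp
  then have "B.coord_det ?E \<otimes> (coord_det ?E' \<otimes> B.coord_det (map h ?E')) = B.coord_det ?E \<otimes> (coord_det ?E' \<otimes> coord_det (map h ?E))"
    using cl by (simp add: R.m_comm)
  then have "(coord_det ?E' \<otimes> B.coord_det ?E) \<otimes> B.coord_det (map h ?E') = (coord_det ?E' \<otimes> B.coord_det ?E) \<otimes> coord_det (map h ?E)"
    using cl by (metis R.m_assoc R.m_comm)
  then show ?thesis unfolding 1 using cl by simp
qed

text \<open>Over a nontrivial ring \<open>E\<close> itself solves the definite description, and
  every other basis also has \<open>n\<close> elements and yields the same value.\<close>

lemma lin_det_eq:
  assumes h: "h \<in> module_hom R M M"
  shows "lin_det R M h = coord_det (map h (map E [0..<n]))"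
proof -
  let ?P = "\<lambda>d. \<exists>bs A. ordered_basis R M bs \<and>
        (\<forall>i<length bs. \<forall>j<length bs. A i j \<in> carrier R) \<and>
        (\<forall>j<length bs. h (bs ! j) = (\<Oplus>\<^bsub>M\<^esub>i\<in>{..<length bs}. A i j \<odot>\<^bsub>M\<^esub> bs ! i)) \<and>
        d = leibniz_det R (length bs) A"
  have hc: "h x \<in> carrier M" if "x \<in> carrier M" for x using h that by (auto simp: module_hom_def)
  have dc: "coord_det (map h (map E [0..<n])) \<in> carrier R"
    using hc by (intro coord_det_closed tuples_map[OF _ tuples_E]) auto
  show ?thesis
  proof (cases "\<one> = \<zero>")
    case True \<comment> \<open>bases need not have length \<open>n\<close> here, but all determinants vanish\<close>
    then have z: "x = \<zero>" if "x \<in> carrier R" for x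
      using that by (metis R.l_one R.l_null)
    have zM: "v = \<zero>\<^bsub>M\<^esub>" if "v \<in> carrier M" for v
      using that True by (metis smult_one smult_l_null)
    have "carrier M = {\<zero>\<^bsub>M\<^esub>}" using zM by auto
    \<comment> \<open>Here the \<open>E i\<close> all coincide and fail to be distinct once
      \<open>n\<close> exceeds one. The empty list is a basis of the zero module and supplies a
      solution.\<close>
    then have "ordered_basis R M []"
      unfolding ordered_basis_def by (auto simp: lin_dep_def span_def lincomb_def)
    then have P: "?P (leibniz_det R 0 (\<lambda>_ _. \<zero>))" by (intro exI[of _ "[]"] exI[of _ "\<lambda>_ _. \<zero>"]) auto
    have d0: "d = \<zero>" if d: "?P d" for d
    proof -
      obtain bs A where "ordered_basis R M bs" "\<forall>i<length bs. \<forall>j<length bs. A i j \<in> carrier R"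
        "\<forall>j<length bs. h (bs ! j) = (\<Oplus>\<^bsub>M\<^esub>i\<in>{..<length bs}. A i j \<odot>\<^bsub>M\<^esub> bs ! i)"
        "d = leibniz_det R (length bs) A"
        using d by blast
      moreover from this have "A \<in> {..<length bs} \<rightarrow> {..<length bs} \<rightarrow> carrier R" by simp
      ultimately show ?thesis using z[OF R.leibniz_det_closed] by simp
    qed
    have "lin_det R M h = \<zero>" unfolding lin_det_def
    proof (rule the_equality)
      show "?P \<zero>" using P d0[OF P] by (simp only:)
      show "\<And>d. ?P d \<Longrightarrow> d = \<zero>" by (rule d0)
    qed
    then show ?thesis using z[OF dc] by simp
  next
    case False
    show ?thesis unfolding lin_det_def
    proof (rule the_equality)
      let ?A = "\<lambda>i j. c i (h (E j))"
      let ?bs = "map E [0..<n]"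
      have l: "length ?bs = n" by simp
      have 1: "leibniz_det R n ?A = coord_det (map h ?bs)"
        by (rule matrix_det[OF h]) (auto simp: hc expand)
      have 2: "h (?bs ! j) = (\<Oplus>\<^bsub>M\<^esub>i\<in>{..<n}. ?A i j \<odot>\<^bsub>M\<^esub> ?bs ! i)" if "j < n" for j
      proof -
        have "(\<Oplus>\<^bsub>M\<^esub>i\<in>{..<n}. ?A i j \<odot>\<^bsub>M\<^esub> ?bs ! i) = (\<Oplus>\<^bsub>M\<^esub>i\<in>{..<n}. ?A i j \<odot>\<^bsub>M\<^esub> E i)"
          using that hc by (intro M.finsum_cong') auto
        then show ?thesis using expand[of "h (E j)"] hc that by simp
      qed
      have 3: "?A i j \<in> carrier R" if "i < n" "j < n" for i j using hc that by simp
      show "?P (coord_det (map h ?bs))"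
        by (rule exI[of _ ?bs], rule exI[of _ ?A], unfold l, intro conjI allI impI)
          (fact ordered_basis_E[OF False] 3 2 1[symmetric])+
    next
      fix d assume "?P d"
      then obtain bs A where bs: "ordered_basis R M bs" and A: "\<forall>i<length bs. \<forall>j<length bs. A i j \<in> carrier R"
        and hA: "\<forall>j<length bs. h (bs ! j) = (\<Oplus>\<^bsub>M\<^esub>i\<in>{..<length bs}. A i j \<odot>\<^bsub>M\<^esub> bs ! i)"
        and d: "d = leibniz_det R (length bs) A" by blast
      obtain c' where c': "coordinates R M (length bs) ((!) bs) c'" using ordered_basis_coordinates[OF bs] by blast
      have len: "length bs = n"
        using coordinates_rank_le[OF c' coordinates_axioms False] coordinates_rank_le[OF coordinates_axioms c' False] by simp
      interpret B: coordinates R M n "(!) bs" c' using c' unfolding len .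
      have "d = B.coord_det (map h (map ((!) bs) [0..<n]))"
        unfolding d len by (rule B.matrix_det[OF h]) (use A hA len in auto)
      then show "d = coord_det (map h (map E [0..<n]))"
        using det_basis_change[OF h B.coordinates_axioms] by simp
    qed
  qed
qed

lemma coord_det_lin_det:
  assumes h: "h \<in> module_hom R M M" and vs: "vs \<in> tuples M n"
  shows "coord_det (map h vs) = lin_det R M h \<otimes> coord_det vs"
  unfolding lin_det_eq[OF h] by (rule coord_det_hom[OF h vs])

lemma lin_det_closed: "h \<in> module_hom R M M \<Longrightarrow> lin_det R M h \<in> carrier R"
  unfolding lin_det_eq by (rule coord_det_closed, rule tuples_map[OF _ tuples_E]) (auto simp: module_hom_def)

end

section \<open>Extension of scalars\<close>

locale base_change =
  fixes F :: "('f, 'm) ring_scheme" and V :: "('f, 'v, 'k) module_scheme"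
    and R :: "('f, 'r, 'l) module_scheme"
  assumes V_module: "module F V" and R_algebra: "algebra F R"
begin

sublocale V: module F V by (rule V_module)

sublocale A: module F R using R_algebra by (rule algebra.axioms)

sublocale S: cring R using R_algebra by (rule algebra.M_cring)

lemma smult_mult_left: "a \<in> carrier F \<Longrightarrow> x \<in> carrier R \<Longrightarrow> y \<in> carrier R \<Longrightarrow>
    (a \<odot>\<^bsub>R\<^esub> x) \<otimes>\<^bsub>R\<^esub> y = a \<odot>\<^bsub>R\<^esub> (x \<otimes>\<^bsub>R\<^esub> y)"
  using algebra.smult_assoc2[OF R_algebra] .

lemma smult_mult_right: "a \<in> carrier F \<Longrightarrow> x \<in> carrier R \<Longrightarrow> y \<in> carrier R \<Longrightarrow>
    x \<otimes>\<^bsub>R\<^esub> (a \<odot>\<^bsub>R\<^esub> y) = a \<odot>\<^bsub>R\<^esub> (x \<otimes>\<^bsub>R\<^esub> y)"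
  using smult_mult_left[of a y x] by (simp add: S.m_comm)

abbreviation "G \<equiv> tensor_free V R"
abbreviation "N \<equiv> tensor_kernel F V R"
abbreviation "VR \<equiv> scalar_extension F V R"
abbreviation tens where "tens \<equiv> pure_tensor F V R"

section \<open>V_R as an abelian group of classes of formal sums\<close>

definition cls where "cls x = N #>\<^bsub>G\<^esub> x"

lemma G_comm_group: "comm_group G"
  unfolding tensor_free_def by (rule abelian_free_Abelian_group)

interpretation G: comm_group G by (rule G_comm_group)

lemma G_carrier: "x \<in> carrier G \<longleftrightarrow> Poly_Mapping.keys x \<subseteq> carrier V \<times> carrier R"
  unfolding tensor_free_def by simp

lemma G_mult [simp]: "x \<otimes>\<^bsub>G\<^esub> y = x + y" and G_one [simp]: "\<one>\<^bsub>G\<^esub> = 0"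
  unfolding tensor_free_def by simp_all

lemma G_inv [simp]: "x \<in> carrier G \<Longrightarrow> inv\<^bsub>G\<^esub> x = - x"
  unfolding tensor_free_def by simp

lemma G_closed [intro]:
  "0 \<in> carrier G"
  "x \<in> carrier G \<Longrightarrow> y \<in> carrier G \<Longrightarrow> x + y \<in> carrier G"
  "x \<in> carrier G \<Longrightarrow> - x \<in> carrier G"
  "x \<in> carrier G \<Longrightarrow> y \<in> carrier G \<Longrightarrow> x - y \<in> carrier G"
  "v \<in> carrier V \<Longrightarrow> s \<in> carrier R \<Longrightarrow> frag_of (v, s) \<in> carrier G"
proof -
  show *: "x \<in> carrier G \<Longrightarrow> y \<in> carrier G \<Longrightarrow> x + y \<in> carrier G" for x y
    using G.m_closed[of x y] by simp
  show **: "x \<in> carrier G \<Longrightarrow> - x \<in> carrier G" for x using G.inv_closed[of x] by simp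
  show "x \<in> carrier G \<Longrightarrow> y \<in> carrier G \<Longrightarrow> x - y \<in> carrier G"
    using *[of x "- y"] **[of y] by simp
qed (auto simp: G_carrier)

lemma relations_carrier: "tensor_relations F V R \<subseteq> carrier G"
  unfolding tensor_relations_def by (auto intro!: G_closed)

lemma N_subgroup: "subgroup N G"
  unfolding tensor_kernel_def by (rule G.generate_is_subgroup[OF relations_carrier])

lemma N_normal: "normal N G"
  by (rule G.subgroup_imp_normal[OF N_subgroup])

lemma N_carrier: "x \<in> N \<Longrightarrow> x \<in> carrier G"
  using subgroup.subset[OF N_subgroup] by blast

lemma N_closed: "0 \<in> N" "x \<in> N \<Longrightarrow> y \<in> N \<Longrightarrow> x + y \<in> N" "x \<in> N \<Longrightarrow> - x \<in> N"
proof -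
  show "0 \<in> N" using subgroup.one_closed[OF N_subgroup] by simp
  show "x \<in> N \<Longrightarrow> y \<in> N \<Longrightarrow> x + y \<in> N" using subgroup.m_closed[OF N_subgroup] by fastforce
  show "x \<in> N \<Longrightarrow> - x \<in> N" using subgroup.m_inv_closed[OF N_subgroup, of x] N_carrier by simp
qed

lemma mem_cls: "y \<in> cls x \<longleftrightarrow> y - x \<in> N"
  unfolding cls_def r_coset_def by (auto intro!: exI[of _ "y - x"] bexI[of _ "y - x"])

lemma cls_eq: "cls x = cls y \<longleftrightarrow> x - y \<in> N"
proof
  assume "cls x = cls y"
  then show "x - y \<in> N" using mem_cls[of x x] mem_cls[of x y] N_closed(1) by simp
next
  assume xy: "x - y \<in> N"
  have "z - x \<in> N \<longleftrightarrow> z - y \<in> N" for z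
    using N_closed(2)[of "z - x" "x - y"] N_closed(2)[of "z - y" "- (x - y)"] N_closed(3)[OF xy] xy by auto
  then show "cls x = cls y" by (auto simp: mem_cls)
qed

lemma VR_carrier: "carrier VR = cls ` carrier G"
  unfolding scalar_extension_def Let_def by (simp add: carrier_FactGroup cls_def)

lemma VR_zero: "\<zero>\<^bsub>VR\<^esub> = cls 0"
  using G.coset_mult_one[of N] N_carrier unfolding scalar_extension_def Let_def cls_def by auto

lemma VR_add: "x \<in> carrier G \<Longrightarrow> y \<in> carrier G \<Longrightarrow> cls x \<oplus>\<^bsub>VR\<^esub> cls y = cls (x + y)"
  using normal.rcos_sum[OF N_normal, of x y] unfolding scalar_extension_def Let_def cls_def by simp

lemma cls_carrier: "x \<in> carrier G \<Longrightarrow> cls x \<in> carrier VR"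
  unfolding VR_carrier by simp

lemma VR_abelian_group: "abelian_group VR"
proof (rule abelian_groupI)
  show "x \<oplus>\<^bsub>VR\<^esub> y \<in> carrier VR" if "x \<in> carrier VR" "y \<in> carrier VR" for x y
    using that by (auto simp: VR_carrier VR_add)
  show "\<zero>\<^bsub>VR\<^esub> \<in> carrier VR" by (auto simp: VR_zero VR_carrier)
  show "(x \<oplus>\<^bsub>VR\<^esub> y) \<oplus>\<^bsub>VR\<^esub> z = x \<oplus>\<^bsub>VR\<^esub> (y \<oplus>\<^bsub>VR\<^esub> z)"
    if "x \<in> carrier VR" "y \<in> carrier VR" "z \<in> carrier VR" for x y z
    using that by (auto simp: VR_carrier VR_add G_closed add.assoc)
  show "x \<oplus>\<^bsub>VR\<^esub> y = y \<oplus>\<^bsub>VR\<^esub> x" if "x \<in> carrier VR" "y \<in> carrier VR" for x y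
    using that by (auto simp: VR_carrier VR_add add.commute)
  show "\<zero>\<^bsub>VR\<^esub> \<oplus>\<^bsub>VR\<^esub> x = x" if "x \<in> carrier VR" for x
    using that by (auto simp: VR_carrier VR_zero VR_add G_closed)
  show "\<exists>y\<in>carrier VR. y \<oplus>\<^bsub>VR\<^esub> x = \<zero>\<^bsub>VR\<^esub>" if x: "x \<in> carrier VR" for x
  proof -
    obtain a where "a \<in> carrier G" "x = cls a" using x VR_carrier by auto
    then show ?thesis by (intro bexI[of _ "cls (- a)"]) (auto simp: VR_zero VR_add G_closed cls_carrier)
  qed
qed

sublocale VR: abelian_group VR by (rule VR_abelian_group)

lemma tens_eq_cls: "tens v s = cls (frag_of (v, s))"
  unfolding pure_tensor_def cls_def ..

lemma tens_closed [intro, simp]: "v \<in> carrier V \<Longrightarrow> s \<in> carrier R \<Longrightarrow> tens v s \<in> carrier VR"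
  unfolding tens_eq_cls by (intro cls_carrier G_closed)

lemma relation_N: "x \<in> tensor_relations F V R \<Longrightarrow> x \<in> N"
  unfolding tensor_kernel_def by (rule generate.incl)

lemma tens_add_left:
  assumes "u \<in> carrier V" "v \<in> carrier V" "s \<in> carrier R"
  shows "tens (u \<oplus>\<^bsub>V\<^esub> v) s = tens u s \<oplus>\<^bsub>VR\<^esub> tens v s"
proof -
  have "frag_of (u \<oplus>\<^bsub>V\<^esub> v, s) - frag_of (u, s) - frag_of (v, s) \<in> N"
    by (rule relation_N) (use assms in \<open>auto simp: tensor_relations_def\<close>)
  then show ?thesis unfolding tens_eq_cls using assms
    by (simp add: VR_add G_closed cls_eq diff_diff_eq)
qed

lemma tens_add_right:
  assumes "v \<in> carrier V" "s \<in> carrier R" "t \<in> carrier R"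
  shows "tens v (s \<oplus>\<^bsub>R\<^esub> t) = tens v s \<oplus>\<^bsub>VR\<^esub> tens v t"
proof -
  have "frag_of (v, s \<oplus>\<^bsub>R\<^esub> t) - frag_of (v, s) - frag_of (v, t) \<in> N"
    by (rule relation_N) (use assms in \<open>auto simp: tensor_relations_def\<close>)
  then show ?thesis unfolding tens_eq_cls using assms
    by (simp add: VR_add G_closed cls_eq diff_diff_eq)
qed

lemma tens_smult:
  assumes "v \<in> carrier V" "a \<in> carrier F" "s \<in> carrier R"
  shows "tens (a \<odot>\<^bsub>V\<^esub> v) s = tens v (a \<odot>\<^bsub>R\<^esub> s)"
proof -
  have "frag_of (a \<odot>\<^bsub>V\<^esub> v, s) - frag_of (v, a \<odot>\<^bsub>R\<^esub> s) \<in> N"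
    by (rule relation_N) (use assms in \<open>auto simp: tensor_relations_def\<close>)
  then show ?thesis unfolding tens_eq_cls by (simp add: cls_eq)
qed

lemma tens_zero_left: "s \<in> carrier R \<Longrightarrow> tens \<zero>\<^bsub>V\<^esub> s = \<zero>\<^bsub>VR\<^esub>"
  using tens_add_left[of "\<zero>\<^bsub>V\<^esub>" "\<zero>\<^bsub>V\<^esub>" s] VR.add.l_cancel_one[of "tens \<zero>\<^bsub>V\<^esub> s" "tens \<zero>\<^bsub>V\<^esub> s"] by auto

text \<open>Every element is a finite sum of pure tensors: the negative of a pure tensor is again
  pure, with the vector negated, so integer coefficients of either sign are reached by sums.\<close>

lemma VR_induct [consumes 1, case_names zero tens add]:
  assumes x: "x \<in> carrier VR" and zero: "P \<zero>\<^bsub>VR\<^esub>"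
    and tens: "\<And>v s. v \<in> carrier V \<Longrightarrow> s \<in> carrier R \<Longrightarrow> P (tens v s)"
    and add: "\<And>x y. x \<in> carrier VR \<Longrightarrow> y \<in> carrier VR \<Longrightarrow> P x \<Longrightarrow> P y \<Longrightarrow> P (x \<oplus>\<^bsub>VR\<^esub> y)"
  shows "P x"
proof -
  obtain a where a: "a \<in> carrier G" "x = cls a" using x VR_carrier by auto
  \<comment> \<open>Induction on the free abelian group proceeds by differences, while
    \<open>add\<close> provides sums only; the claim is therefore carried for \<open>a\<close> and
    \<open>- a\<close> together.\<close>
  have "P (cls a) \<and> P (cls (- a))"
  proof (rule free_Abelian_group_induct[where P = "\<lambda>a. P (cls a) \<and> P (cls (- a))"])
    show "Poly_Mapping.keys a \<subseteq> carrier V \<times> carrier R" using a(1) G_carrier by simp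
    show "P (cls 0) \<and> P (cls (- 0))" using zero by (simp add: VR_zero)
  next
    fix x y assume h: "Poly_Mapping.keys x \<subseteq> carrier V \<times> carrier R" "Poly_Mapping.keys y \<subseteq> carrier V \<times> carrier R"
      "P (cls x) \<and> P (cls (- x))" "P (cls y) \<and> P (cls (- y))"
    then have "x \<in> carrier G" "y \<in> carrier G" by (auto simp: G_carrier)
    then show "P (cls (x - y)) \<and> P (cls (- (x - y)))"
      using h add[of "cls x" "cls (- y)"] add[of "cls (- x)" "cls y"]
      by (simp add: cls_carrier G_closed VR_add)
  next
    fix p assume "p \<in> carrier V \<times> carrier R"
    then obtain v s where p: "p = (v, s)" "v \<in> carrier V" "s \<in> carrier R" by auto
    have "tens (\<ominus>\<^bsub>V\<^esub> v) s \<oplus>\<^bsub>VR\<^esub> tens v s = \<zero>\<^bsub>VR\<^esub>"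
      using p tens_add_left[of "\<ominus>\<^bsub>V\<^esub> v" v s] tens_zero_left by (simp add: V.M.l_neg)
    then have "cls (frag_of (\<ominus>\<^bsub>V\<^esub> v, s) + frag_of (v, s)) = cls 0"
      unfolding tens_eq_cls VR_zero using p by (simp add: VR_add G_closed)
    then have "- (frag_of (\<ominus>\<^bsub>V\<^esub> v, s) + frag_of (v, s) - 0) \<in> N"
      unfolding cls_eq by (rule N_closed(3))
    then have "cls (- frag_of (v, s)) = tens (\<ominus>\<^bsub>V\<^esub> v) s"
      unfolding tens_eq_cls cls_eq by (simp add: algebra_simps)
    then show "P (cls (frag_of p)) \<and> P (cls (- frag_of p))"
      using tens[of v s] tens[of "\<ominus>\<^bsub>V\<^esub> v" s] p by (simp add: tens_eq_cls)
  qed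
  then show ?thesis using a by simp
qed

section \<open>The action of R on V_R\<close>

definition scale where "scale r = frag_extend (\<lambda>(v, s). frag_of (v :: 'v, r \<otimes>\<^bsub>R\<^esub> s))"

lemma scale_closed: "r \<in> carrier R \<Longrightarrow> x \<in> carrier G \<Longrightarrow> scale r x \<in> carrier G"
  unfolding scale_def G_carrier
  using keys_frag_extend[of "\<lambda>(v, s). frag_of (v :: 'v, r \<otimes>\<^bsub>R\<^esub> s)" x] by fastforce

lemma scale_add: "scale r (x + y) = scale r x + scale r y"
  and scale_minus: "scale r (- x) = - scale r x"
  and scale_diff: "scale r (x - y) = scale r x - scale r y"
  and scale_of: "scale r (frag_of (v, s)) = frag_of (v, r \<otimes>\<^bsub>R\<^esub> s)"
  unfolding scale_def by (simp_all add: frag_extend_add frag_extend_minus frag_extend_diff)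

lemma tensor_relationsI:
  "u \<in> carrier V \<Longrightarrow> v \<in> carrier V \<Longrightarrow> s \<in> carrier R \<Longrightarrow>
    frag_of (u \<oplus>\<^bsub>V\<^esub> v, s) - frag_of (u, s) - frag_of (v, s) \<in> tensor_relations F V R"
  "v \<in> carrier V \<Longrightarrow> s \<in> carrier R \<Longrightarrow> t \<in> carrier R \<Longrightarrow>
    frag_of (v, s \<oplus>\<^bsub>R\<^esub> t) - frag_of (v, s) - frag_of (v, t) \<in> tensor_relations F V R"
  "a \<in> carrier F \<Longrightarrow> v \<in> carrier V \<Longrightarrow> s \<in> carrier R \<Longrightarrow>
    frag_of (a \<odot>\<^bsub>V\<^esub> v, s) - frag_of (v, a \<odot>\<^bsub>R\<^esub> s) \<in> tensor_relations F V R"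
  unfolding tensor_relations_def by blast+

lemma tensor_relations_cases:
  assumes "x \<in> tensor_relations F V R"
  obtains (left) u v s where "u \<in> carrier V" "v \<in> carrier V" "s \<in> carrier R"
      "x = frag_of (u \<oplus>\<^bsub>V\<^esub> v, s) - frag_of (u, s) - frag_of (v, s)"
    | (right) v s t where "v \<in> carrier V" "s \<in> carrier R" "t \<in> carrier R"
      "x = frag_of (v, s \<oplus>\<^bsub>R\<^esub> t) - frag_of (v, s) - frag_of (v, t)"
    | (balanced) a v s where "a \<in> carrier F" "v \<in> carrier V" "s \<in> carrier R"
      "x = frag_of (a \<odot>\<^bsub>V\<^esub> v, s) - frag_of (v, a \<odot>\<^bsub>R\<^esub> s)"
  using assms unfolding tensor_relations_def
  by (elim UnE CollectE exE conjE) (rule left right balanced, assumption+)+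

lemma scale_relation:
  assumes r: "r \<in> carrier R" and x: "x \<in> tensor_relations F V R"
  shows "scale r x \<in> tensor_relations F V R"
  using x
proof (cases rule: tensor_relations_cases)
  case (left u v s)
  then show ?thesis using r tensor_relationsI(1)[of u v "r \<otimes>\<^bsub>R\<^esub> s"] by (simp add: scale_diff scale_of)
next
  case (right v s t)
  then show ?thesis using r tensor_relationsI(2)[of v "r \<otimes>\<^bsub>R\<^esub> s" "r \<otimes>\<^bsub>R\<^esub> t"]
    by (simp add: scale_diff scale_of S.r_distr)
next
  case (balanced a v s)
  then show ?thesis using r tensor_relationsI(3)[of a v "r \<otimes>\<^bsub>R\<^esub> s"]
    by (simp add: scale_diff scale_of smult_mult_right)
qed

text \<open>Multiplication by \<open>r\<close> sends each defining relation to a relation of the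
  same kind. It therefore preserves the subgroup they generate and descends to classes.\<close>

lemma scale_N:
  assumes r: "r \<in> carrier R" and x: "x \<in> N"
  shows "scale r x \<in> N"
  using x unfolding tensor_kernel_def
proof (induction x rule: generate.induct)
  case one
  then show ?case using N_closed(1) unfolding tensor_kernel_def by (simp add: scale_def)
next
  case (incl h)
  then show ?case using scale_relation[OF r] by (intro generate.incl)
next
  case (inv h)
  then have "- scale r h \<in> N" "h \<in> carrier G"
    using scale_relation[OF r] relation_N N_closed(3) relations_carrier by blast+
  then show ?case unfolding tensor_kernel_def by (simp add: scale_minus)
next
  case (eng x y)
  then show ?case using N_closed(2) unfolding tensor_kernel_def by (simp add: scale_add)
qed

lemma VR_smult: 
  assumes r: "r \<in> carrier R" and x: "x \<in> carrier G"
  shows "r \<odot>\<^bsub>VR\<^esub> cls x = cls (scale r x)"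
proof -
  have "r \<odot>\<^bsub>VR\<^esub> cls x = (\<Union>y\<in>cls x. cls (scale r y))"
    unfolding scalar_extension_def Let_def cls_def scale_def by simp
  also have "\<dots> = (\<Union>y\<in>cls x. cls (scale r x))"
  proof (rule SUP_cong)
    fix y assume "y \<in> cls x"
    then have "scale r (y - x) \<in> N" using scale_N[OF r] by (simp add: mem_cls)
    then show "cls (scale r y) = cls (scale r x)" by (simp add: cls_eq scale_diff)
  qed simp
  also have "\<dots> = cls (scale r x)" using mem_cls[of x x] N_closed(1) by auto
  finally show ?thesis .
qed

lemma VR_smult_tens:
  "r \<in> carrier R \<Longrightarrow> v \<in> carrier V \<Longrightarrow> s \<in> carrier R \<Longrightarrow> r \<odot>\<^bsub>VR\<^esub> tens v s = tens v (r \<otimes>\<^bsub>R\<^esub> s)"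
  unfolding tens_eq_cls by (simp add: VR_smult G_closed scale_def)

lemma VR_smult_closed: "r \<in> carrier R \<Longrightarrow> x \<in> carrier VR \<Longrightarrow> r \<odot>\<^bsub>VR\<^esub> x \<in> carrier VR"
  by (auto simp: VR_carrier VR_smult scale_closed)

lemma VR_smult_add: "r \<in> carrier R \<Longrightarrow> x \<in> carrier VR \<Longrightarrow> y \<in> carrier VR \<Longrightarrow>
    r \<odot>\<^bsub>VR\<^esub> (x \<oplus>\<^bsub>VR\<^esub> y) = r \<odot>\<^bsub>VR\<^esub> x \<oplus>\<^bsub>VR\<^esub> r \<odot>\<^bsub>VR\<^esub> y"
  by (auto simp: VR_carrier VR_add VR_smult scale_closed G_closed scale_add)

lemma VR_smult_zero: "r \<in> carrier R \<Longrightarrow> r \<odot>\<^bsub>VR\<^esub> \<zero>\<^bsub>VR\<^esub> = \<zero>\<^bsub>VR\<^esub>"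
  unfolding VR_zero by (simp add: VR_smult G_closed scale_def)

lemma VR_module: "module R VR"
proof (rule moduleI[OF S.cring_axioms VR_abelian_group])
  show "a \<odot>\<^bsub>VR\<^esub> x \<in> carrier VR" if "a \<in> carrier R" "x \<in> carrier VR" for a x
    using that by (rule VR_smult_closed)
  show "a \<odot>\<^bsub>VR\<^esub> (x \<oplus>\<^bsub>VR\<^esub> y) = a \<odot>\<^bsub>VR\<^esub> x \<oplus>\<^bsub>VR\<^esub> a \<odot>\<^bsub>VR\<^esub> y" if "a \<in> carrier R" "x \<in> carrier VR" "y \<in> carrier VR" for a x y
    using that by (rule VR_smult_add)
  show "(a \<oplus>\<^bsub>R\<^esub> b) \<odot>\<^bsub>VR\<^esub> x = a \<odot>\<^bsub>VR\<^esub> x \<oplus>\<^bsub>VR\<^esub> b \<odot>\<^bsub>VR\<^esub> x" if ab: "a \<in> carrier R" "b \<in> carrier R" and x: "x \<in> carrier VR" for a b x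
    using x
  proof (induction x rule: VR_induct)
    case (add x y)
    then show ?case using ab VR_smult_closed by (simp add: VR_smult_add VR.a_ac)
  qed (use ab in \<open>simp_all add: VR_smult_zero VR_smult_tens S.l_distr tens_add_right\<close>)
  show "(a \<otimes>\<^bsub>R\<^esub> b) \<odot>\<^bsub>VR\<^esub> x = a \<odot>\<^bsub>VR\<^esub> (b \<odot>\<^bsub>VR\<^esub> x)" if ab: "a \<in> carrier R" "b \<in> carrier R" and x: "x \<in> carrier VR" for a b x
    using x
  proof (induction x rule: VR_induct)
    case (add x y)
    then show ?case using ab VR_smult_closed by (simp add: VR_smult_add)
  qed (use ab in \<open>simp_all add: VR_smult_zero VR_smult_tens S.m_assoc\<close>)
  show "\<one>\<^bsub>R\<^esub> \<odot>\<^bsub>VR\<^esub> x = x" if x: "x \<in> carrier VR" for x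
    using x
    by (induction x rule: VR_induct) (simp_all add: VR_smult_zero VR_smult_tens VR_smult_add)
qed

text \<open>The universal property of the tensor product, for additive maps to \<open>R\<close>. The
  homomorphism on formal sums given by \<open>f\<close> kills the relations, so its value on a class
  may be read at any representative. It serves to construct coordinate functionals on V_R.\<close>

lemma lift_exists:
  assumes f: "\<And>v s. v \<in> carrier V \<Longrightarrow> s \<in> carrier R \<Longrightarrow> f v s \<in> carrier R"
    and add_left: "\<And>u v s. u \<in> carrier V \<Longrightarrow> v \<in> carrier V \<Longrightarrow> s \<in> carrier R \<Longrightarrow> f (u \<oplus>\<^bsub>V\<^esub> v) s = f u s \<oplus>\<^bsub>R\<^esub> f v s"
    and add_right: "\<And>v s t. v \<in> carrier V \<Longrightarrow> s \<in> carrier R \<Longrightarrow> t \<in> carrier R \<Longrightarrow> f v (s \<oplus>\<^bsub>R\<^esub> t) = f v s \<oplus>\<^bsub>R\<^esub> f v t"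
    and bal: "\<And>a v s. a \<in> carrier F \<Longrightarrow> v \<in> carrier V \<Longrightarrow> s \<in> carrier R \<Longrightarrow> f (a \<odot>\<^bsub>V\<^esub> v) s = f v (a \<odot>\<^bsub>R\<^esub> s)"
  shows "\<exists>g. (\<forall>v\<in>carrier V. \<forall>s\<in>carrier R. g (tens v s) = f v s) \<and> (\<forall>x\<in>carrier VR. g x \<in> carrier R) \<and>
     (\<forall>x\<in>carrier VR. \<forall>y\<in>carrier VR. g (x \<oplus>\<^bsub>VR\<^esub> y) = g x \<oplus>\<^bsub>R\<^esub> g y)"
proof -
  have H: "comm_group (add_monoid R)" by (rule abelian_group.a_comm_group[OF S.is_abelian_group])
  have "(\<lambda>(v, s). f v s) ` (carrier V \<times> carrier R) \<subseteq> carrier (add_monoid R)" using f by auto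
  then obtain h where h: "h \<in> hom G (add_monoid R)"
    and hf: "\<And>p. p \<in> carrier V \<times> carrier R \<Longrightarrow> h (frag_of p) = (\<lambda>(v, s). f v s) p"
    unfolding tensor_free_def by (rule comm_group.free_Abelian_group_universal[OF H]) blast
  have hc: "h x \<in> carrier R" if "x \<in> carrier G" for x using h that by (auto simp: hom_def)
  have ha: "h (x + y) = h x \<oplus>\<^bsub>R\<^esub> h y" if "x \<in> carrier G" "y \<in> carrier G" for x y
    using h that by (auto simp: hom_def)
  have h0: "h 0 = \<zero>\<^bsub>R\<^esub>"
  proof -
    have "h 0 \<oplus>\<^bsub>R\<^esub> h 0 = h 0" using ha[of 0 0] G_closed(1) by simp
    then show ?thesis using hc[OF G_closed(1)] by simp
  qed
  have hm: "h (- x) = \<ominus>\<^bsub>R\<^esub> h x" if "x \<in> carrier G" for x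
    using ha[of "- x" x] that hc h0 G_closed(3)[OF that] by (simp add: A.M.minus_equality)
  have hd: "h (x - y) = h x \<ominus>\<^bsub>R\<^esub> h y" if "x \<in> carrier G" "y \<in> carrier G" for x y
    using ha[of x "- y"] hm that G_closed(3)[OF that(2)] by (simp add: a_minus_def)
  have cancel: "x \<oplus>\<^bsub>R\<^esub> (y \<oplus>\<^bsub>R\<^esub> (\<ominus>\<^bsub>R\<^esub> x \<oplus>\<^bsub>R\<^esub> \<ominus>\<^bsub>R\<^esub> y)) = \<zero>\<^bsub>R\<^esub>" if "x \<in> carrier R" "y \<in> carrier R" for x y
    using that A.M.r_neg[of "x \<oplus>\<^bsub>R\<^esub> y"] by (simp add: A.M.minus_add A.M.a_assoc)
  have hr: "h x = \<zero>\<^bsub>R\<^esub>" if "x \<in> tensor_relations F V R" for x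
    using that unfolding tensor_relations_def
    by (auto simp: hd G_closed hf f add_left add_right bal a_minus_def A.M.a_assoc A.M.r_neg cancel)
  have hN: "h x = \<zero>\<^bsub>R\<^esub>" if "x \<in> N" for x
    using that unfolding tensor_kernel_def
  proof (induction x rule: generate.induct)
    case (inv x)
    then show ?case using hm hr relations_carrier by auto
  next
    case (eng x y)
    then have "x \<in> carrier G" "y \<in> carrier G" using N_carrier unfolding tensor_kernel_def by auto
    then show ?case using eng ha by simp
  qed (use h0 hr in auto)
  have hcls: "h (SOME y. y \<in> cls x) = h x" if x: "x \<in> carrier G" for x
  proof -
    have "x \<in> cls x" by (simp add: mem_cls N_closed)
    then have "(SOME y. y \<in> cls x) \<in> cls x" by (rule someI)
    then have d: "(SOME y. y \<in> cls x) - x \<in> N" by (simp add: mem_cls)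
    then show ?thesis using ha[OF N_carrier[OF d] x] hN[OF d] hc[OF x] by simp
  qed
  show ?thesis
  proof (intro exI conjI ballI)
    let ?g = "\<lambda>X. h (SOME y. y \<in> X)"
    show "?g (tens v s) = f v s" if "v \<in> carrier V" "s \<in> carrier R" for v s
      using that hcls[of "frag_of (v, s)"] hf[of "(v, s)"] by (simp add: tens_eq_cls G_closed)
    show "?g x \<in> carrier R" if "x \<in> carrier VR" for x
      using that by (auto simp: VR_carrier hcls hc)
    show "?g (x \<oplus>\<^bsub>VR\<^esub> y) = ?g x \<oplus>\<^bsub>R\<^esub> ?g y" if "x \<in> carrier VR" "y \<in> carrier VR" for x y
      using that by (auto simp: VR_carrier hcls ha VR_add G_closed)
  qed
qed

text \<open>Each \<open>c i\<close> extends by the universal property, and the extended functionals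
  witness that the tensors of the \<open>E i\<close> with one are independent. Their formula on pure
  tensors is kept because it ties coordinates over \<open>R\<close> to those over
  \<open>F\<close>.\<close>

lemma coordinates_base_change:
  assumes "coordinates F V n E c"
  shows "\<exists>c'. coordinates R VR n (\<lambda>i. tens (E i) \<one>\<^bsub>R\<^esub>) c' \<and>
     (\<forall>i<n. \<forall>v\<in>carrier V. \<forall>s\<in>carrier R. c' i (tens v s) = c i v \<odot>\<^bsub>R\<^esub> s)"
proof -
  interpret E: coordinates F V n E c by fact
  interpret M: module R VR by (rule VR_module)
  define P where "P i g \<longleftrightarrow> (\<forall>v\<in>carrier V. \<forall>s\<in>carrier R. g (tens v s) = c i v \<odot>\<^bsub>R\<^esub> s) \<and>
     (\<forall>x\<in>carrier VR. g x \<in> carrier R) \<and>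
     (\<forall>x\<in>carrier VR. \<forall>y\<in>carrier VR. g (x \<oplus>\<^bsub>VR\<^esub> y) = g x \<oplus>\<^bsub>R\<^esub> g y)" for i g
  have "\<exists>g. P i g" if i: "i < n" for i
    unfolding P_def
  proof (rule lift_exists)
    fix a v s assume h: "a \<in> carrier F" "v \<in> carrier V" "s \<in> carrier R"
    have "(a \<otimes>\<^bsub>F\<^esub> c i v) \<odot>\<^bsub>R\<^esub> s = (c i v \<otimes>\<^bsub>F\<^esub> a) \<odot>\<^bsub>R\<^esub> s"
      using h i by (simp add: V.R.m_comm)
    then show "c i (a \<odot>\<^bsub>V\<^esub> v) \<odot>\<^bsub>R\<^esub> s = c i v \<odot>\<^bsub>R\<^esub> (a \<odot>\<^bsub>R\<^esub> s)"
      using h i by (simp add: E.c_smult A.smult_assoc1)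
  qed (use i in \<open>simp_all add: E.c_add A.smult_l_distr A.smult_r_distr\<close>)
  then obtain c' where P: "\<And>i. i < n \<Longrightarrow> P i (c' i)" by metis
  have c': "\<And>i v s. i < n \<Longrightarrow> v \<in> carrier V \<Longrightarrow> s \<in> carrier R \<Longrightarrow> c' i (tens v s) = c i v \<odot>\<^bsub>R\<^esub> s"
    and cc: "\<And>i x. i < n \<Longrightarrow> x \<in> carrier VR \<Longrightarrow> c' i x \<in> carrier R"
    and ca: "\<And>i x y. i < n \<Longrightarrow> x \<in> carrier VR \<Longrightarrow> y \<in> carrier VR \<Longrightarrow> c' i (x \<oplus>\<^bsub>VR\<^esub> y) = c' i x \<oplus>\<^bsub>R\<^esub> c' i y"
    using P unfolding P_def by simp_all
  have c0: "c' i \<zero>\<^bsub>VR\<^esub> = \<zero>\<^bsub>R\<^esub>" if "i < n" for i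
    using ca[OF that VR.zero_closed VR.zero_closed] cc[OF that VR.zero_closed] by simp
  have Ec: "tens (E i) \<one>\<^bsub>R\<^esub> \<in> carrier VR" if "i < n" for i using that by simp
  have "coordinates R VR n (\<lambda>i. tens (E i) \<one>\<^bsub>R\<^esub>) c'"
  proof (unfold_locales)
    show "c' i (a \<odot>\<^bsub>VR\<^esub> x) = a \<otimes>\<^bsub>R\<^esub> c' i x" if i: "i < n" and a: "a \<in> carrier R" and x: "x \<in> carrier VR" for i a x
      using x
    proof (induction x rule: VR_induct)
      case (add x y)
      then show ?case using i a by (simp add: M.smult_r_distr ca cc S.r_distr)
    qed (use i a in \<open>simp_all add: c0 c' VR_smult_tens smult_mult_right\<close>)
    show "c' i (tens (E j) \<one>\<^bsub>R\<^esub>) = (if i = j then \<one>\<^bsub>R\<^esub> else \<zero>\<^bsub>R\<^esub>)" if "i < n" "j < n" for i j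
      using that by (simp add: c' E.c_E)
    show "(\<Oplus>\<^bsub>VR\<^esub>i\<in>{..<n}. c' i x \<odot>\<^bsub>VR\<^esub> tens (E i) \<one>\<^bsub>R\<^esub>) = x" if x: "x \<in> carrier VR" for x
      using x
    proof (induction x rule: VR_induct)
      case zero
      have "(\<Oplus>\<^bsub>VR\<^esub>i\<in>{..<n}. c' i \<zero>\<^bsub>VR\<^esub> \<odot>\<^bsub>VR\<^esub> tens (E i) \<one>\<^bsub>R\<^esub>) = (\<Oplus>\<^bsub>VR\<^esub>i\<in>{..<n}. \<zero>\<^bsub>VR\<^esub>)"
        by (intro VR.finsum_cong') (auto simp: c0)
      then show ?case by simp
    next
      case (tens v s)
      have *: "tens (\<Oplus>\<^bsub>V\<^esub>i\<in>I. c i v \<odot>\<^bsub>V\<^esub> E i) s = (\<Oplus>\<^bsub>VR\<^esub>i\<in>I. tens (c i v \<odot>\<^bsub>V\<^esub> E i) s)" if "finite I" "I \<subseteq> {..<n}" for I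
        using that
      proof (induction I)
        case empty
        then show ?case using tens by (simp add: tens_zero_left)
      next
        case (insert i I)
        then have "(\<lambda>i. c i v \<odot>\<^bsub>V\<^esub> E i) \<in> I \<rightarrow> carrier V" "c i v \<odot>\<^bsub>V\<^esub> E i \<in> carrier V"
          using tens by auto
        moreover from this have "(\<lambda>i. tens (c i v \<odot>\<^bsub>V\<^esub> E i) s) \<in> I \<rightarrow> carrier VR"
          using tens by (auto simp: Pi_iff)
        ultimately show ?case using insert tens by (simp add: tens_add_left V.M.finsum_closed)
      qed
      have "(\<Oplus>\<^bsub>VR\<^esub>i\<in>{..<n}. c' i (tens v s) \<odot>\<^bsub>VR\<^esub> tens (E i) \<one>\<^bsub>R\<^esub>) = (\<Oplus>\<^bsub>VR\<^esub>i\<in>{..<n}. tens (c i v \<odot>\<^bsub>V\<^esub> E i) s)"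
        using tens by (intro VR.finsum_cong') (auto simp: c' VR_smult_tens tens_smult)
      also have "\<dots> = tens v s" using *[of "{..<n}"] E.expand[of v] tens by simp
      finally show ?case .
    next
      case (add x y)
      have "(\<Oplus>\<^bsub>VR\<^esub>i\<in>{..<n}. c' i (x \<oplus>\<^bsub>VR\<^esub> y) \<odot>\<^bsub>VR\<^esub> tens (E i) \<one>\<^bsub>R\<^esub>) =
          (\<Oplus>\<^bsub>VR\<^esub>i\<in>{..<n}. c' i x \<odot>\<^bsub>VR\<^esub> tens (E i) \<one>\<^bsub>R\<^esub> \<oplus>\<^bsub>VR\<^esub> c' i y \<odot>\<^bsub>VR\<^esub> tens (E i) \<one>\<^bsub>R\<^esub>)"
        using add by (intro VR.finsum_cong') (auto simp: ca cc M.smult_l_distr)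
      also have "\<dots> = (\<Oplus>\<^bsub>VR\<^esub>i\<in>{..<n}. c' i x \<odot>\<^bsub>VR\<^esub> tens (E i) \<one>\<^bsub>R\<^esub>) \<oplus>\<^bsub>VR\<^esub> (\<Oplus>\<^bsub>VR\<^esub>i\<in>{..<n}. c' i y \<odot>\<^bsub>VR\<^esub> tens (E i) \<one>\<^bsub>R\<^esub>)"
        using add cc by (intro VR.finsum_addf) auto
      finally show ?case using add by simp
    qed
  qed (auto simp: cc ca)
  then show ?thesis using c' by blast
qed

end

section \<open>Cross products in orthogonal coordinates\<close>

lemma bilinear_formI:
  assumes "\<And>u v. u \<in> carrier M \<Longrightarrow> v \<in> carrier M \<Longrightarrow> b u v \<in> carrier R"
    and "\<And>u v w. u \<in> carrier M \<Longrightarrow> v \<in> carrier M \<Longrightarrow> w \<in> carrier M \<Longrightarrow> b (u \<oplus>\<^bsub>M\<^esub> v) w = b u w \<oplus>\<^bsub>R\<^esub> b v w"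
    and "\<And>u v w. u \<in> carrier M \<Longrightarrow> v \<in> carrier M \<Longrightarrow> w \<in> carrier M \<Longrightarrow> b w (u \<oplus>\<^bsub>M\<^esub> v) = b w u \<oplus>\<^bsub>R\<^esub> b w v"
    and "\<And>a u v. a \<in> carrier R \<Longrightarrow> u \<in> carrier M \<Longrightarrow> v \<in> carrier M \<Longrightarrow> b (a \<odot>\<^bsub>M\<^esub> u) v = a \<otimes>\<^bsub>R\<^esub> b u v"
    and "\<And>a u v. a \<in> carrier R \<Longrightarrow> u \<in> carrier M \<Longrightarrow> v \<in> carrier M \<Longrightarrow> b u (a \<odot>\<^bsub>M\<^esub> v) = a \<otimes>\<^bsub>R\<^esub> b u v"
  shows "bilinear_form R M b"
  unfolding bilinear_form_def using assms by simp

context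
  fixes R M b
  assumes b: "bilinear_form R M b"
begin

lemma bilinear_closed: "u \<in> carrier M \<Longrightarrow> v \<in> carrier M \<Longrightarrow> b u v \<in> carrier R"
  using b unfolding bilinear_form_def by simp

lemma bilinear_add_left:
  "u \<in> carrier M \<Longrightarrow> v \<in> carrier M \<Longrightarrow> w \<in> carrier M \<Longrightarrow> b (u \<oplus>\<^bsub>M\<^esub> v) w = b u w \<oplus>\<^bsub>R\<^esub> b v w"
  using b unfolding bilinear_form_def by simp

lemma bilinear_add_right:
  "u \<in> carrier M \<Longrightarrow> v \<in> carrier M \<Longrightarrow> w \<in> carrier M \<Longrightarrow> b w (u \<oplus>\<^bsub>M\<^esub> v) = b w u \<oplus>\<^bsub>R\<^esub> b w v"
  using b unfolding bilinear_form_def by simp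

lemma bilinear_smult_left:
  "a \<in> carrier R \<Longrightarrow> u \<in> carrier M \<Longrightarrow> v \<in> carrier M \<Longrightarrow> b (a \<odot>\<^bsub>M\<^esub> u) v = a \<otimes>\<^bsub>R\<^esub> b u v"
  using b unfolding bilinear_form_def by simp

lemma bilinear_smult_right:
  "a \<in> carrier R \<Longrightarrow> u \<in> carrier M \<Longrightarrow> v \<in> carrier M \<Longrightarrow> b u (a \<odot>\<^bsub>M\<^esub> v) = a \<otimes>\<^bsub>R\<^esub> b u v"
  using b unfolding bilinear_form_def by simp

text \<open>Lists of length two make bilinear forms a case of multilinear forms, so that expansion
  in a slot and comparison on a basis apply to them.\<close>

lemma bilinear_multilinear: "multilinear_form R M 2 (\<lambda>vs. b (vs ! 0) (vs ! 1))"
proof (rule multilinear_formI)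
  show "b (vs ! 0) (vs ! 1) \<in> carrier R" if "vs \<in> tuples M 2" for vs
    using tuples_nth[OF that] by (intro bilinear_closed) auto
  fix vs i assume vs: "vs \<in> tuples M 2" and i: "i < (2 :: nat)"
  have l: "length vs = 2" using vs by (rule tuples_length)
  have c: "vs ! 0 \<in> carrier M" "vs ! 1 \<in> carrier M" using tuples_nth[OF vs] by auto
  have i': "i = 0 \<or> i = 1" using i by auto
  show "b (vs[i := u \<oplus>\<^bsub>M\<^esub> w] ! 0) (vs[i := u \<oplus>\<^bsub>M\<^esub> w] ! 1) =
      b (vs[i := u] ! 0) (vs[i := u] ! 1) \<oplus>\<^bsub>R\<^esub> b (vs[i := w] ! 0) (vs[i := w] ! 1)"
    if "u \<in> carrier M" "w \<in> carrier M" for u w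
    using i' that c l by (auto simp: bilinear_add_left bilinear_add_right)
  show "b (vs[i := a \<odot>\<^bsub>M\<^esub> u] ! 0) (vs[i := a \<odot>\<^bsub>M\<^esub> u] ! 1) = a \<otimes>\<^bsub>R\<^esub> b (vs[i := u] ! 0) (vs[i := u] ! 1)"
    if "a \<in> carrier R" "u \<in> carrier M" for a u
    using i' that c l by (auto simp: bilinear_smult_left bilinear_smult_right)
qed

end

lemma multilinear_mapI:
  assumes "\<And>vs. vs \<in> tuples M r \<Longrightarrow> f vs \<in> carrier M"
    and "\<And>vs i u w. vs \<in> tuples M r \<Longrightarrow> i < r \<Longrightarrow> u \<in> carrier M \<Longrightarrow> w \<in> carrier M \<Longrightarrow>
        f (vs[i := u \<oplus>\<^bsub>M\<^esub> w]) = f (vs[i := u]) \<oplus>\<^bsub>M\<^esub> f (vs[i := w])"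
    and "\<And>vs i a u. vs \<in> tuples M r \<Longrightarrow> i < r \<Longrightarrow> a \<in> carrier R \<Longrightarrow> u \<in> carrier M \<Longrightarrow>
        f (vs[i := a \<odot>\<^bsub>M\<^esub> u]) = a \<odot>\<^bsub>M\<^esub> f (vs[i := u])"
  shows "multilinear_map R M r f"
  unfolding multilinear_map_def using assms by simp

context
  fixes R M r f
  assumes f: "multilinear_map R M r f"
begin

lemma multilinear_map_closed: "vs \<in> tuples M r \<Longrightarrow> f vs \<in> carrier M"
  using f unfolding multilinear_map_def by simp

lemma multilinear_map_add: "vs \<in> tuples M r \<Longrightarrow> i < r \<Longrightarrow> u \<in> carrier M \<Longrightarrow> w \<in> carrier M \<Longrightarrow>
    f (vs[i := u \<oplus>\<^bsub>M\<^esub> w]) = f (vs[i := u]) \<oplus>\<^bsub>M\<^esub> f (vs[i := w])"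
  using f unfolding multilinear_map_def by simp

lemma multilinear_map_smult: "vs \<in> tuples M r \<Longrightarrow> i < r \<Longrightarrow> a \<in> carrier R \<Longrightarrow> u \<in> carrier M \<Longrightarrow>
    f (vs[i := a \<odot>\<^bsub>M\<^esub> u]) = a \<odot>\<^bsub>M\<^esub> f (vs[i := u])"
  using f unfolding multilinear_map_def by simp

end

section \<open>Comparison on a basis, diagonal forms and weighted vector products\<close>

context coordinates
begin

lemma bilinear_form_eqI:
  assumes b: "bilinear_form R M b" and b': "bilinear_form R M b'"
    and eq: "\<And>i j. i < n \<Longrightarrow> j < n \<Longrightarrow> b (E i) (E j) = b' (E i) (E j)"
    and uv: "u \<in> carrier M" "v \<in> carrier M"
  shows "b u v = b' u v"
proof -
  have "b ([u, v] ! 0) ([u, v] ! 1) = b' ([u, v] ! 0) ([u, v] ! 1)"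
  proof (rule multilinear_form_eqI[OF bilinear_multilinear[OF b] bilinear_multilinear[OF b']])
    show "[u, v] \<in> tuples M 2" using uv by (simp add: tuples_def)
    fix ws assume ws: "set ws \<subseteq> {..<n}" "length ws = 2"
    then have "ws ! 0 < n" "ws ! 1 < n" by (auto simp: subset_iff)
    then show "b (map E ws ! 0) (map E ws ! 1) = b' (map E ws ! 0) (map E ws ! 1)"
      using eq ws by simp
  qed
  then show ?thesis by simp
qed

lemma multilinear_map_eqI:
  assumes f: "multilinear_map R M r f" and g: "multilinear_map R M r g"
    and eq: "\<And>ws. set ws \<subseteq> {..<n} \<Longrightarrow> length ws = r \<Longrightarrow> f (map E ws) = g (map E ws)"
    and vs: "vs \<in> tuples M r"
  shows "f vs = g vs"
proof (rule coordinates_eqI)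
  have *: "multilinear_form R M r (\<lambda>vs. c i (f vs))" if "i < n" "multilinear_map R M r f" for i f
    using that multilinear_map_closed[OF that(2)]
    by (intro multilinear_formI) (auto simp: multilinear_map_add[OF that(2)] multilinear_map_smult[OF that(2)] c_add c_smult tuples_update)
  show "c i (f vs) = c i (g vs)" if "i < n" for i
    using multilinear_form_eqI[OF *[OF that f] *[OF that g] _ vs] eq by simp
qed (use multilinear_map_closed[OF f vs] multilinear_map_closed[OF g vs] in auto)

definition diag_form :: "(nat \<Rightarrow> 'a) \<Rightarrow> 'c \<Rightarrow> 'c \<Rightarrow> 'a" where
  "diag_form q u v = (\<Oplus>i\<in>{..<n}. q i \<otimes> (c i u \<otimes> c i v))"

lemma diag_form_bilinear:
  assumes q: "\<And>i. i < n \<Longrightarrow> q i \<in> carrier R"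
  shows "bilinear_form R M (diag_form q)"
proof (rule bilinear_formI)
  have cl: "(\<lambda>i. q i \<otimes> (c i u \<otimes> c i v)) \<in> {..<n} \<rightarrow> carrier R" if "u \<in> carrier M" "v \<in> carrier M" for u v
    using q that by auto
  show "diag_form q u v \<in> carrier R" if "u \<in> carrier M" "v \<in> carrier M" for u v
    unfolding diag_form_def using cl[OF that] by (rule R.finsum_closed)
  show "diag_form q (u \<oplus>\<^bsub>M\<^esub> v) w = diag_form q u w \<oplus> diag_form q v w"
    if h: "u \<in> carrier M" "v \<in> carrier M" "w \<in> carrier M" for u v w
    unfolding diag_form_def R.finsum_addf[OF cl[OF h(1,3)] cl[OF h(2,3)], symmetric]
    using q h by (intro R.finsum_cong') (auto simp: c_add R.l_distr R.r_distr)
  show "diag_form q w (u \<oplus>\<^bsub>M\<^esub> v) = diag_form q w u \<oplus> diag_form q w v"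
    if h: "u \<in> carrier M" "v \<in> carrier M" "w \<in> carrier M" for u v w
    unfolding diag_form_def R.finsum_addf[OF cl[OF h(3,1)] cl[OF h(3,2)], symmetric]
    using q h by (intro R.finsum_cong') (auto simp: c_add R.r_distr)
  show "diag_form q (a \<odot>\<^bsub>M\<^esub> u) v = a \<otimes> diag_form q u v"
    if h: "a \<in> carrier R" "u \<in> carrier M" "v \<in> carrier M" for a u v
    unfolding diag_form_def R.finsum_rdistr[OF finite_lessThan h(1) cl[OF h(2,3)]]
    using q h by (intro R.finsum_cong') (auto simp: c_smult R.m_ac)
  show "diag_form q u (a \<odot>\<^bsub>M\<^esub> v) = a \<otimes> diag_form q u v"
    if h: "a \<in> carrier R" "u \<in> carrier M" "v \<in> carrier M" for a u v
    unfolding diag_form_def R.finsum_rdistr[OF finite_lessThan h(1) cl[OF h(2,3)]]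
    using q h by (intro R.finsum_cong') (auto simp: c_smult R.m_ac)
qed

lemma diag_form_E:
  assumes q: "\<And>i. i < n \<Longrightarrow> q i \<in> carrier R" and j: "j < n" and u: "u \<in> carrier M"
  shows "diag_form q u (E j) = q j \<otimes> c j u"
proof -
  have "diag_form q u (E j) = (\<Oplus>i\<in>{..<n}. if j = i then q i \<otimes> c i u else \<zero>)"
    unfolding diag_form_def using q j u by (intro R.finsum_cong') (auto simp: c_E)
  also have "\<dots> = q j \<otimes> c j u"
    using q j u by (intro R.finsum_singleton) auto
  finally show ?thesis .
qed

text \<open>The classical vector product as a formal expansion of a determinant in its last column,
  with weights. If \<open>q i\<close> times \<open>w i\<close> is a constant \<delta>, this is the
  vector whose pairing with \<open>u\<close> under \<open>diag_form q\<close> is \<delta> times the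
  determinant of \<open>vs\<close> followed by \<open>u\<close>.\<close>

definition cross :: "(nat \<Rightarrow> 'a) \<Rightarrow> 'c list \<Rightarrow> 'c" where
  "cross w vs = (\<Oplus>\<^bsub>M\<^esub>i\<in>{..<n}. (w i \<otimes> coord_det (vs @ [E i])) \<odot>\<^bsub>M\<^esub> E i)"

context
  fixes r w
  assumes n: "n = Suc r" and w: "\<And>i. i < n \<Longrightarrow> w i \<in> carrier R"
begin

lemma append_E: "vs \<in> tuples M r \<Longrightarrow> i < n \<Longrightarrow> vs @ [E i] \<in> tuples M n"
  unfolding n by (intro tuples_append1) (auto simp: n)

lemma cross_coefficient: "vs \<in> tuples M r \<Longrightarrow> (\<lambda>i. w i \<otimes> coord_det (vs @ [E i])) \<in> {..<n} \<rightarrow> carrier R"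
  using append_E coord_det_closed w by auto

lemma cross_closed: "vs \<in> tuples M r \<Longrightarrow> cross w vs \<in> carrier M"
  unfolding cross_def using cross_coefficient by (intro M.finsum_closed) (auto simp: Pi_iff)

lemma c_cross: "vs \<in> tuples M r \<Longrightarrow> i < n \<Longrightarrow> c i (cross w vs) = w i \<otimes> coord_det (vs @ [E i])"
  unfolding cross_def using c_combination[OF _ cross_coefficient] by simp

lemma cross_multilinear: "multilinear_map R M r (cross w)"
proof (rule multilinear_mapI)
  show "cross w vs \<in> carrier M" if "vs \<in> tuples M r" for vs by (rule cross_closed[OF that])
next
  fix vs k u v assume h: "vs \<in> tuples M r" "k < r" "u \<in> carrier M" "v \<in> carrier M"
  note t = tuples_update[OF h(1,3)] tuples_update[OF h(1,4)] tuples_update[OF h(1) M.a_closed[OF h(3,4)]]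
  show "cross w (vs[k := u \<oplus>\<^bsub>M\<^esub> v]) = cross w (vs[k := u]) \<oplus>\<^bsub>M\<^esub> cross w (vs[k := v])"
  proof (rule coordinates_eqI)
    fix i assume i: "i < n"
    have "(vs @ [E i])[k := x] = vs[k := x] @ [E i]" for x
      using tuples_length[OF h(1)] h(2) by (simp add: list_update_append)
    then have "coord_det (vs[k := u \<oplus>\<^bsub>M\<^esub> v] @ [E i]) = coord_det (vs[k := u] @ [E i]) \<oplus> coord_det (vs[k := v] @ [E i])"
      using form_add[OF coord_det_multilinear append_E[OF h(1) i], of k u v] h n by simp
    then show "c i (cross w (vs[k := u \<oplus>\<^bsub>M\<^esub> v])) = c i (cross w (vs[k := u]) \<oplus>\<^bsub>M\<^esub> cross w (vs[k := v]))"
      using i t cross_closed w coord_det_closed append_E by (simp add: c_cross c_add R.r_distr)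
  qed (use t cross_closed in auto)
next
  fix vs k a u assume h: "vs \<in> tuples M r" "k < r" "a \<in> carrier R" "u \<in> carrier M"
  note t = tuples_update[OF h(1,4)] tuples_update[OF h(1) smult_closed[OF h(3,4)]]
  show "cross w (vs[k := a \<odot>\<^bsub>M\<^esub> u]) = a \<odot>\<^bsub>M\<^esub> cross w (vs[k := u])"
  proof (rule coordinates_eqI)
    fix i assume i: "i < n"
    have "(vs @ [E i])[k := x] = vs[k := x] @ [E i]" for x
      using tuples_length[OF h(1)] h(2) by (simp add: list_update_append)
    then have "coord_det (vs[k := a \<odot>\<^bsub>M\<^esub> u] @ [E i]) = a \<otimes> coord_det (vs[k := u] @ [E i])"
      using form_smult[OF coord_det_multilinear append_E[OF h(1) i], of k a u] h n by simp
    then show "c i (cross w (vs[k := a \<odot>\<^bsub>M\<^esub> u])) = c i (a \<odot>\<^bsub>M\<^esub> cross w (vs[k := u]))"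
      using i h(3) t cross_closed w coord_det_closed append_E by (simp add: c_cross c_smult R.m_lcomm)
  qed (use t h cross_closed in auto)
qed

end
end

text \<open>The data in a shape that survives scalar extension: units and equations between ring
  elements. The quotient of \<delta> by \<open>q i\<close> is recorded as \<open>w i\<close> with
  its defining equation, so that its transport needs multiplicativity alone.\<close>

locale cross_coordinates = coordinates R M n E c
  for R (structure) and M (structure) and n :: nat and E :: "nat \<Rightarrow> 'c" and c :: "nat \<Rightarrow> 'c \<Rightarrow> 'a" +
  fixes r :: nat and q w :: "nat \<Rightarrow> 'a" and \<delta> :: 'a
  assumes n_Suc: "n = Suc r"
    and q_unit: "i < n \<Longrightarrow> q i \<in> Units R"
    and w_closed: "i < n \<Longrightarrow> w i \<in> carrier R"
    and \<delta>_unit: "\<delta> \<in> Units R"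
    and q_w: "i < n \<Longrightarrow> q i \<otimes> w i = \<delta>"
begin

abbreviation "B \<equiv> diag_form q"
abbreviation "Y \<equiv> cross w"

lemma q_closed [intro]: "i < n \<Longrightarrow> q i \<in> carrier R"
  using q_unit by auto

lemma \<delta>_closed: "\<delta> \<in> carrier R"
  using \<delta>_unit by auto

lemma B_bilinear: "bilinear_form R M B"
  by (rule diag_form_bilinear) (rule q_closed)

lemma B_E: "j < n \<Longrightarrow> u \<in> carrier M \<Longrightarrow> B u (E j) = q j \<otimes> c j u"
  by (rule diag_form_E) (rule q_closed)

lemma Y_closed: "vs \<in> tuples M r \<Longrightarrow> Y vs \<in> carrier M"
  by (rule cross_closed[OF n_Suc]) (rule w_closed)

lemma c_Y: "vs \<in> tuples M r \<Longrightarrow> i < n \<Longrightarrow> c i (Y vs) = w i \<otimes> coord_det (vs @ [E i])"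
  by (rule c_cross[OF n_Suc]) (rule w_closed)

lemma append_closed: "vs \<in> tuples M r \<Longrightarrow> u \<in> carrier M \<Longrightarrow> vs @ [u] \<in> tuples M n"
  unfolding n_Suc by (rule tuples_append1)

text \<open>Expanding the determinant in its last slot produces the coordinates of \<open>u\<close>.
  In \<open>B (Y vs) u\<close> the factor \<open>q i\<close> meets \<open>w i\<close>, and their
  product is the same \<delta> for every \<open>i\<close>.\<close>

lemma B_Y:
  assumes vs: "vs \<in> tuples M r" and u: "u \<in> carrier M"
  shows "B (Y vs) u = \<delta> \<otimes> coord_det (vs @ [u])"
proof -
  have upd: "(vs @ [u])[r := x] = vs @ [x]" for x
    using tuples_length[OF vs] by (simp add: list_update_append)
  have d: "coord_det (vs @ [E i]) \<in> carrier R" if "i < n" for i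
    using coord_det_closed append_closed[OF vs] that by simp
  have "coord_det (vs @ [u]) = (\<Oplus>i\<in>{..<n}. c i u \<otimes> coord_det (vs @ [E i]))"
    using form_slot_expand[OF coord_det_multilinear append_closed[OF vs u] _ u, of r] n_Suc by (simp add: upd)
  then have "\<delta> \<otimes> coord_det (vs @ [u]) = (\<Oplus>i\<in>{..<n}. \<delta> \<otimes> (c i u \<otimes> coord_det (vs @ [E i])))"
    using R.finsum_rdistr[OF _ \<delta>_closed, of "{..<n}" "\<lambda>i. c i u \<otimes> coord_det (vs @ [E i])"] d u by auto
  also have "\<dots> = B (Y vs) u"
    unfolding diag_form_def
  proof (rule R.finsum_cong')
    fix i assume "i \<in> {..<n}"
    then have i: "i < n" by simp
    have "q i \<otimes> (c i (Y vs) \<otimes> c i u) = q i \<otimes> (w i \<otimes> coord_det (vs @ [E i]) \<otimes> c i u)"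
      using c_Y[OF vs i] by simp
    also have "\<dots> = (q i \<otimes> w i) \<otimes> (c i u \<otimes> coord_det (vs @ [E i]))"
      using d[OF i] w_closed[OF i] q_closed[OF i] u i by (simp add: R.m_ac)
    finally show "\<delta> \<otimes> (c i u \<otimes> coord_det (vs @ [E i])) = q i \<otimes> (c i (Y vs) \<otimes> c i u)"
      using q_w[OF i] by simp
  qed (use Y_closed[OF vs] u q_closed in auto)
  finally show ?thesis by simp
qed

text \<open>Pairing with \<open>E i\<close> returns the \<open>i\<close>-th coordinate times
  \<open>q i\<close>, and a unit can be cancelled even in the presence of zero divisors.\<close>

lemma B_nondegenerate:
  assumes xy: "x \<in> carrier M" "y \<in> carrier M" and eq: "\<And>u. u \<in> carrier M \<Longrightarrow> B x u = B y u"
  shows "x = y"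
proof (rule coordinates_eqI[OF xy])
  fix i assume i: "i < n"
  have "q i \<otimes> c i x = q i \<otimes> c i y" using eq[OF E_closed[OF i]] B_E[OF i] xy by simp
  then show "c i x = c i y" using R.Units_l_cancel[OF q_unit[OF i]] xy i by simp
qed

text \<open>\<open>Y\<close> applied to the remaining basis vectors has a unit as its
  \<open>i\<close>-th coordinate and zeros elsewhere. Hence each basis vector is a multiple of a
  single value of \<open>Y\<close>.\<close>

lemma E_from_Y:
  assumes i: "i < n"
  obtains a vs where "a \<in> carrier R" "vs \<in> tuples M r" "E i = a \<odot>\<^bsub>M\<^esub> Y vs"
proof -
  \<comment> \<open>\<open>E r\<close> fills the gap left by \<open>E i\<close>. For
    \<open>i = r\<close> the update lies outside the list of length \<open>r\<close> and changes
    nothing, which is the list wanted in that case.\<close>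
  let ?vs = "(map E [0..<r])[i := E r]"
  define d where "d = coord_det (?vs @ [E i])"
  have vs: "?vs \<in> tuples M r" using n_Suc by (intro tuples_update) (auto simp: tuples_def)
  \<comment> \<open>Appending \<open>E i\<close> gives the basis with entries \<open>i\<close> and
    \<open>r\<close> exchanged, so the determinant \<open>d\<close> is one or minus one.\<close>
  have "?vs @ [E i] = (map E [0..<n])[i := map E [0..<n] ! r, r := map E [0..<n] ! i]"
    using i n_Suc by (auto intro!: nth_equalityI simp: nth_append nth_list_update less_Suc_eq)
  then have "d = (if i = r then \<one> else \<ominus> \<one>)"
    using form_swap[OF coord_det_alternating tuples_E i, of r] n_Suc coord_det_basis
    by (auto simp: d_def list_update_same_conv)
  then have d: "d \<in> carrier R" "d \<otimes> d = \<one>" by (auto simp: R.l_minus R.r_minus)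
  \<comment> \<open>For \<open>k\<close> other than \<open>i\<close> the vector \<open>E k\<close>
    already occurs in \<open>?vs\<close>: in slot \<open>i\<close> if \<open>k = r\<close>, in slot
    \<open>k\<close> otherwise.\<close>
  have z: "coord_det (?vs @ [E k]) = \<zero>" if "k < n" "k \<noteq> i" for k
  proof (rule alternating_form_zero[OF coord_det_alternating append_closed[OF vs E_closed[OF that(1)]], of "if k = r then i else k" r])
    show "(?vs @ [E k]) ! (if k = r then i else k) = (?vs @ [E k]) ! r"
      using that i n_Suc by (auto simp: nth_append nth_list_update)
  qed (use that i n_Suc in auto)
  \<comment> \<open>The inverse of the surviving coordinate \<open>w i\<close> times
    \<open>d\<close>, because \<open>q i\<close> times \<open>w i\<close> is \<delta> and
    \<open>d\<close> squares to one.\<close>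
  define a where "a = inv \<delta> \<otimes> (q i \<otimes> d)"
  have a: "a \<in> carrier R" unfolding a_def using d q_closed[OF i] \<delta>_unit by simp
  have awd: "a \<otimes> (w i \<otimes> d) = \<one>"
  proof -
    have "a \<otimes> (w i \<otimes> d) = inv \<delta> \<otimes> ((q i \<otimes> w i) \<otimes> (d \<otimes> d))"
      unfolding a_def using d(1) q_closed[OF i] w_closed[OF i] \<delta>_unit by (simp add: R.m_ac)
    then show ?thesis using q_w[OF i] d \<delta>_unit \<delta>_closed by simp
  qed
  have "E i = a \<odot>\<^bsub>M\<^esub> Y ?vs"
  proof (rule coordinates_eqI)
    fix k assume k: "k < n"
    show "c k (E i) = c k (a \<odot>\<^bsub>M\<^esub> Y ?vs)"
      using k i a Y_closed[OF vs] z[of k] awd w_closed[OF k]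
      by (cases "k = i") (auto simp: c_smult c_Y[OF vs] c_E d_def)
  qed (use i a Y_closed[OF vs] in auto)
  then show ?thesis using a vs that by blast
qed

lemma B_Y_hom:
  assumes h: "h \<in> module_hom R M M" and vs: "vs \<in> tuples M r" and u: "u \<in> carrier M"
  shows "B (Y (map h vs)) (h u) = lin_det R M h \<otimes> B (Y vs) u"
proof -
  have hc: "h x \<in> carrier M" if "x \<in> carrier M" for x using h that by (auto simp: module_hom_def)
  have "map h vs \<in> tuples M r" using vs hc by (intro tuples_map) auto
  then have "B (Y (map h vs)) (h u) = \<delta> \<otimes> coord_det (map h (vs @ [u]))"
    using B_Y hc[OF u] by simp
  also have "\<dots> = lin_det R M h \<otimes> (\<delta> \<otimes> coord_det (vs @ [u]))"
    using coord_det_lin_det[OF h append_closed[OF vs u]] lin_det_closed[OF h] \<delta>_closed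
      coord_det_closed[OF append_closed[OF vs u]] by (simp add: R.m_lcomm)
  finally show ?thesis using B_Y[OF vs u] by simp
qed

lemma preserves_cross_iff:
  assumes h: "h \<in> module_hom R M M" and bij: "bij_betw h (carrier M) (carrier M)"
  shows "(\<forall>vs\<in>tuples M r. h (Y vs) = Y (map h vs)) \<longleftrightarrow>
    (\<forall>u\<in>carrier M. \<forall>v\<in>carrier M. B (h u) (h v) = lin_det R M h \<otimes> B u v)"
    (is "?L \<longleftrightarrow> ?R")
proof -
  have hc: "h x \<in> carrier M" if "x \<in> carrier M" for x using h that by (auto simp: module_hom_def)
  have ha: "h (x \<oplus>\<^bsub>M\<^esub> y) = h x \<oplus>\<^bsub>M\<^esub> h y" if "x \<in> carrier M" "y \<in> carrier M" for x y
    using h that by (auto simp: module_hom_def)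
  have hs: "h (a \<odot>\<^bsub>M\<^esub> x) = a \<odot>\<^bsub>M\<^esub> h x" if "a \<in> carrier R" "x \<in> carrier M" for a x
    using h that by (auto simp: module_hom_def)
  note d = lin_det_closed[OF h]
  note Bs = bilinear_closed[OF B_bilinear] bilinear_add_left[OF B_bilinear] bilinear_add_right[OF B_bilinear]
    bilinear_smult_left[OF B_bilinear] bilinear_smult_right[OF B_bilinear]
  show ?thesis
  proof
    assume L: ?L
    \<comment> \<open>Both sides of the similitude law are bilinear, so it is enough to test basis
      vectors, the left one written as a multiple of a value of \<open>Y\<close>.\<close>
    have b1: "bilinear_form R M (\<lambda>u v. B (h u) (h v))"
      by (rule bilinear_formI) (simp_all add: hc ha hs Bs)
    have b2: "bilinear_form R M (\<lambda>u v. lin_det R M h \<otimes> B u v)"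
      by (rule bilinear_formI) (simp_all add: d Bs R.r_distr R.m_lcomm)
    have "B (h (E i)) (h (E j)) = lin_det R M h \<otimes> B (E i) (E j)" if ij: "i < n" "j < n" for i j
    proof -
      obtain a vs where a: "a \<in> carrier R" and vs: "vs \<in> tuples M r" and Ei: "E i = a \<odot>\<^bsub>M\<^esub> Y vs"
        using E_from_Y[OF ij(1)] .
      have "Y (map h vs) \<in> carrier M" using vs hc by (intro Y_closed tuples_map) auto
      then have "B (h (E i)) (h (E j)) = a \<otimes> B (Y (map h vs)) (h (E j))"
        using a vs ij L Y_closed[OF vs] hc by (simp add: Ei hs Bs)
      also have "\<dots> = lin_det R M h \<otimes> (a \<otimes> B (Y vs) (E j))"
        using B_Y_hom[OF h vs E_closed[OF ij(2)]] a d ij Y_closed[OF vs] Bs(1) by (simp add: R.m_lcomm)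
      also have "a \<otimes> B (Y vs) (E j) = B (E i) (E j)"
        unfolding Ei using a ij Y_closed[OF vs] by (simp add: Bs)
      finally show ?thesis .
    qed
    then show ?R using bilinear_form_eqI[OF b1 b2] by blast
  next
    assume Rt: ?R
    show ?L
    proof
      fix vs assume vs: "vs \<in> tuples M r"
      have hvs: "map h vs \<in> tuples M r" using vs hc by (intro tuples_map) auto
      show "h (Y vs) = Y (map h vs)"
      proof (rule B_nondegenerate)
        fix u assume "u \<in> carrier M"
        \<comment> \<open>Surjectivity of \<open>h\<close> provides the preimage that
          \<open>B_Y_hom\<close> requires in its second argument.\<close>
        then obtain u' where u': "u' \<in> carrier M" "u = h u'" using bij unfolding bij_betw_def by blast
        then show "B (h (Y vs)) u = B (Y (map h vs)) u"
          using Rt Y_closed[OF vs] B_Y_hom[OF h vs] by simp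
      qed (use Y_closed vs hvs hc in auto)
    qed
  qed
qed

text \<open>Testing on the pair \<open>E 0\<close>, \<open>E 0\<close> shows that \<open>d\<close>
  fixes \<open>q 0\<close> under multiplication, and the unit \<open>q 0\<close> cancels.\<close>

lemma isometry_similitude_iff:
  assumes d: "d \<in> carrier R"
    and iso: "\<forall>u\<in>carrier M. \<forall>v\<in>carrier M. B (h u) (h v) = B u v"
  shows "(\<forall>u\<in>carrier M. \<forall>v\<in>carrier M. B (h u) (h v) = d \<otimes> B u v) \<longleftrightarrow> d = \<one>"
proof
  assume L: "\<forall>u\<in>carrier M. \<forall>v\<in>carrier M. B (h u) (h v) = d \<otimes> B u v"
  have i: "0 < n" using n_Suc by simp
  then have "B (E 0) (E 0) = d \<otimes> B (E 0) (E 0)" using L iso by (metis E_closed)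
  moreover have "B (E 0) (E 0) = q 0" using B_E[OF i E_closed[OF i]] q_closed[OF i] i by (simp add: c_E)
  ultimately have "q 0 \<otimes> d = q 0 \<otimes> \<one>" using d q_closed[OF i] by (simp add: R.m_comm)
  then show "d = \<one>" using R.Units_l_cancel[OF q_unit[OF i] d R.one_closed] by blast
next
  assume "d = \<one>"
  then show "\<forall>u\<in>carrier M. \<forall>v\<in>carrier M. B (h u) (h v) = d \<otimes> B u v"
    using iso bilinear_closed[OF B_bilinear] by simp
qed

end

section \<open>Multilinear extensions in coordinates\<close>

context base_change
begin

text \<open>The structure homomorphism of the algebra \<open>R\<close>. The values prescribed in
  \<open>bilinear_extension\<close> are its values at \<open>b u v\<close>.\<close>

definition \<iota> where "\<iota> a = a \<odot>\<^bsub>R\<^esub> \<one>\<^bsub>R\<^esub>"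

lemma \<iota>_ring_hom_cring: "ring_hom_cring F R \<iota>"
proof (intro ring_hom_cring.intro ring_hom_cring_axioms.intro)
  show "\<iota> \<in> ring_hom F R"
  proof (rule ring_hom_memI)
    show "\<iota> (x \<otimes>\<^bsub>F\<^esub> y) = \<iota> x \<otimes>\<^bsub>R\<^esub> \<iota> y" if "x \<in> carrier F" "y \<in> carrier F" for x y
      using that unfolding \<iota>_def by (simp add: smult_mult_left A.smult_assoc1)
  qed (auto simp: \<iota>_def A.smult_l_distr)
qed (rule V.R.is_cring S.is_cring)+

sublocale \<iota>: ring_hom_cring F R \<iota> by (rule \<iota>_ring_hom_cring)

lemma \<iota>_Units: "a \<in> Units F \<Longrightarrow> \<iota> a \<in> Units R"
proof -
  assume a: "a \<in> Units F"
  then have "\<iota> (inv\<^bsub>F\<^esub> a) \<otimes>\<^bsub>R\<^esub> \<iota> a = \<one>\<^bsub>R\<^esub>" "\<iota> a \<otimes>\<^bsub>R\<^esub> \<iota> (inv\<^bsub>F\<^esub> a) = \<one>\<^bsub>R\<^esub>"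
    using \<iota>.hom_mult[of "inv\<^bsub>F\<^esub> a" a] \<iota>.hom_mult[of a "inv\<^bsub>F\<^esub> a"] V.R.Units_l_inv V.R.Units_r_inv
    by auto
  then show "\<iota> a \<in> Units R" using a unfolding Units_def[of R] by auto
qed

lemma tens1_tuples: "vs \<in> tuples V r \<Longrightarrow> map (\<lambda>v. tens v \<one>\<^bsub>R\<^esub>) vs \<in> tuples VR r"
  by (rule tuples_map) auto

text \<open>Evaluates the definite description: the restriction of \<open>Y\<close> satisfies its
  clauses, and any competitor agrees with \<open>Y\<close> on lists of basis tensors, where the
  values are prescribed, hence everywhere by multilinearity.\<close>

lemma multilinear_extension_eq:
  assumes E: "coordinates F V n E c" and Y: "multilinear_map R VR r Y"
    and X: "\<And>vs. vs \<in> tuples V r \<Longrightarrow> Y (map (\<lambda>v. tens v \<one>\<^bsub>R\<^esub>) vs) = tens (X vs) \<one>\<^bsub>R\<^esub>"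
    and vs: "vs \<in> tuples VR r"
  shows "multilinear_extension F V r X R vs = Y vs"
proof -
  interpret E: coordinates F V n E c by (rule E)
  obtain c' where c': "coordinates R VR n (\<lambda>i. tens (E i) \<one>\<^bsub>R\<^esub>) c'"
    using coordinates_base_change[OF E] by blast
  interpret E': coordinates R VR n "\<lambda>i. tens (E i) \<one>\<^bsub>R\<^esub>" c' by (rule c')
  have "multilinear_extension F V r X R = restrict Y (tuples VR r)"
    unfolding multilinear_extension_def
  proof (rule the_equality, intro conjI ballI)
    show "multilinear_map R VR r (restrict Y (tuples VR r))"
      by (rule multilinear_mapI) (use multilinear_map_closed[OF Y] multilinear_map_add[OF Y] multilinear_map_smult[OF Y] in
          \<open>simp_all add: tuples_update E'.smult_closed\<close>)
    show "restrict Y (tuples VR r) (map (\<lambda>v. tens v \<one>\<^bsub>R\<^esub>) vs) = tens (X vs) \<one>\<^bsub>R\<^esub>" if "vs \<in> tuples V r" for vs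
      using X[OF that] tens1_tuples[OF that] by simp
  next
    fix Z assume Z: "Z \<in> extensional (tuples VR r) \<and> multilinear_map R VR r Z \<and>
       (\<forall>vs\<in>tuples V r. Z (map (\<lambda>v. tens v \<one>\<^bsub>R\<^esub>) vs) = tens (X vs) \<one>\<^bsub>R\<^esub>)"
    show "Z = restrict Y (tuples VR r)"
    proof (rule extensionalityI[of _ "tuples VR r"])
      fix us assume us: "us \<in> tuples VR r"
      have "Z us = Y us"
      proof (rule E'.multilinear_map_eqI[OF _ Y _ us])
        fix ws assume ws: "set ws \<subseteq> {..<n}" "length ws = r"
        have *: "map (\<lambda>i. tens (E i) \<one>\<^bsub>R\<^esub>) ws = map (\<lambda>v. tens v \<one>\<^bsub>R\<^esub>) (map E ws)" by simp
        show "Z (map (\<lambda>i. tens (E i) \<one>\<^bsub>R\<^esub>) ws) = Y (map (\<lambda>i. tens (E i) \<one>\<^bsub>R\<^esub>) ws)"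
          unfolding * using Z X E.tuples_basis[OF ws] by metis
      qed (use Z in blast)
      then show "Z us = restrict Y (tuples VR r) us" using us by simp
    qed (use Z in auto)
  qed auto
  then show ?thesis using vs by simp
qed

lemma bilinear_extension_eq:
  assumes E: "coordinates F V n E c" and B: "bilinear_form R VR B"
    and b: "\<And>u v. u \<in> carrier V \<Longrightarrow> v \<in> carrier V \<Longrightarrow> B (tens u \<one>\<^bsub>R\<^esub>) (tens v \<one>\<^bsub>R\<^esub>) = b u v \<odot>\<^bsub>R\<^esub> \<one>\<^bsub>R\<^esub>"
    and uv: "u \<in> carrier VR" "v \<in> carrier VR"
  shows "bilinear_extension F V b R u v = B u v"
proof -
  interpret E: coordinates F V n E c by (rule E)
  obtain c' where c': "coordinates R VR n (\<lambda>i. tens (E i) \<one>\<^bsub>R\<^esub>) c'"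
    using coordinates_base_change[OF E] by blast
  interpret E': coordinates R VR n "\<lambda>i. tens (E i) \<one>\<^bsub>R\<^esub>" c' by (rule c')
  \<comment> \<open>Extensionality is imposed on the uncurried function, so the solution is the
    restriction to pairs, curried back.\<close>
  define B' where "B' = curry (restrict (case_prod B) (carrier VR \<times> carrier VR))"
  have B': "B' x y = B x y" if "x \<in> carrier VR" "y \<in> carrier VR" for x y
    unfolding B'_def using that by simp
  have "bilinear_extension F V b R = B'"
    unfolding bilinear_extension_def
  proof (rule the_equality, intro conjI ballI)
    show "case_prod B' \<in> extensional (carrier VR \<times> carrier VR)" unfolding B'_def by simp
    show "bilinear_form R VR B'"
      by (rule bilinear_formI) (use bilinear_closed[OF B] bilinear_add_left[OF B] bilinear_add_right[OF B]
          bilinear_smult_left[OF B] bilinear_smult_right[OF B] in \<open>simp_all add: B' E'.smult_closed\<close>)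
    show "B' (tens u \<one>\<^bsub>R\<^esub>) (tens v \<one>\<^bsub>R\<^esub>) = b u v \<odot>\<^bsub>R\<^esub> \<one>\<^bsub>R\<^esub>" if "u \<in> carrier V" "v \<in> carrier V" for u v
      using b[OF that] that by (simp add: B')
  next
    fix D assume D: "case_prod D \<in> extensional (carrier VR \<times> carrier VR) \<and> bilinear_form R VR D \<and>
      (\<forall>u\<in>carrier V. \<forall>v\<in>carrier V. D (tens u \<one>\<^bsub>R\<^esub>) (tens v \<one>\<^bsub>R\<^esub>) = b u v \<odot>\<^bsub>R\<^esub> \<one>\<^bsub>R\<^esub>)"
    have DB: "D x y = B x y" if "x \<in> carrier VR" "y \<in> carrier VR" for x y
    proof (rule E'.bilinear_form_eqI[OF _ B _ that])
      show "bilinear_form R VR D" using D by (elim conjE)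
      fix i j assume "i < n" "j < n"
      then show "D (tens (E i) \<one>\<^bsub>R\<^esub>) (tens (E j) \<one>\<^bsub>R\<^esub>) = B (tens (E i) \<one>\<^bsub>R\<^esub>) (tens (E j) \<one>\<^bsub>R\<^esub>)"
        using D b[of "E i" "E j"] by simp
    qed
    show "D = B'"
    proof (intro ext)
      fix x y
      show "D x y = B' x y"
      proof (cases "(x, y) \<in> carrier VR \<times> carrier VR")
        case True
        then show ?thesis using DB B' by simp
      next
        case False
        have "case_prod D (x, y) = undefined" using D extensional_arb[OF _ False] by blast
        then show ?thesis unfolding B'_def using False by (auto simp: curry_def restrict_def)
      qed
    qed
  qed
  then show ?thesis using B' uv by simp
qed

text \<open>On tensors of a vector with one, the coordinates over \<open>R\<close> are the images
  under \<iota> of those over \<open>F\<close>, and the Leibniz formula commutes with \<iota>. So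
  the explicit formulas with transported scalars satisfy the characterizations of the extended form
  and of the extended map.\<close>

lemma cross_coordinates_base_change:
  assumes "cross_coordinates F V n E c r q w \<delta>"
    and b: "\<And>u v. u \<in> carrier V \<Longrightarrow> v \<in> carrier V \<Longrightarrow> b u v = coordinates.diag_form F n c q u v"
    and X: "\<And>vs. vs \<in> tuples V r \<Longrightarrow> X vs = coordinates.cross F V n E c w vs"
  obtains E' c' q' w' \<delta>' where "cross_coordinates R VR n E' c' r q' w' \<delta>'"
    and "\<And>u v. u \<in> carrier VR \<Longrightarrow> v \<in> carrier VR \<Longrightarrow>
      bilinear_extension F V b R u v = coordinates.diag_form R n c' q' u v"
    and "\<And>vs. vs \<in> tuples VR r \<Longrightarrow>
      multilinear_extension F V r X R vs = coordinates.cross R VR n E' c' w' vs"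
proof -
  interpret E: cross_coordinates F V n E c r q w \<delta> by fact
  note E = E.coordinates_axioms
  let ?E = "\<lambda>i. tens (E i) \<one>\<^bsub>R\<^esub>" and ?q = "\<lambda>i. \<iota> (q i)" and ?w = "\<lambda>i. \<iota> (w i)"
  obtain c' where c': "coordinates R VR n ?E c'"
    and ct0: "\<forall>i<n. \<forall>v\<in>carrier V. \<forall>s\<in>carrier R. c' i (tens v s) = c i v \<odot>\<^bsub>R\<^esub> s"
    using coordinates_base_change[OF E] by blast
  have ct: "c' i (tens v \<one>\<^bsub>R\<^esub>) = \<iota> (c i v)" if "i < n" "v \<in> carrier V" for i v
    using ct0 that unfolding \<iota>_def by simp
  interpret E': coordinates R VR n ?E c' by (rule c')
  have cc: "cross_coordinates R VR n ?E c' r ?q ?w (\<iota> \<delta>)"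
  proof (unfold_locales)
    show "\<iota> (q i) \<otimes>\<^bsub>R\<^esub> \<iota> (w i) = \<iota> \<delta>" if "i < n" for i
      using E.q_w[OF that] \<iota>.hom_mult[of "q i" "w i"] E.q_closed[OF that] E.w_closed[OF that] by simp
  qed (use E.n_Suc E.q_unit E.w_closed E.\<delta>_unit \<iota>_Units in auto)
  interpret E': cross_coordinates R VR n ?E c' r ?q ?w "\<iota> \<delta>" by (rule cc)
  have det: "E'.coord_det (map (\<lambda>v. tens v \<one>\<^bsub>R\<^esub>) vs) = \<iota> (E.coord_det vs)" if vs: "vs \<in> tuples V n" for vs
  proof -
    have cl: "(\<lambda>i j. c i (vs ! j)) \<in> {..<n} \<rightarrow> {..<n} \<rightarrow> carrier F" using tuples_nth[OF vs] by auto
    have "E'.coord_det (map (\<lambda>v. tens v \<one>\<^bsub>R\<^esub>) vs) = leibniz_det R n (\<lambda>i j. \<iota> (c i (vs ! j)))"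
      unfolding E'.coord_det_def
      by (rule S.leibniz_det_cong) (use tuples_nth[OF vs] tuples_length[OF vs] ct in auto)
    then show ?thesis unfolding E.coord_det_def \<iota>.leibniz_det_hom[OF cl] .
  qed
  have be: "bilinear_extension F V b R u v = E'.diag_form ?q u v" if "u \<in> carrier VR" "v \<in> carrier VR" for u v
  proof (rule bilinear_extension_eq[OF E E'.B_bilinear _ that])
    fix u v assume uv: "u \<in> carrier V" "v \<in> carrier V"
    have cl: "(\<lambda>i. q i \<otimes>\<^bsub>F\<^esub> (c i u \<otimes>\<^bsub>F\<^esub> c i v)) \<in> {..<n} \<rightarrow> carrier F" using E.q_closed uv by auto
    have "E'.diag_form ?q (tens u \<one>\<^bsub>R\<^esub>) (tens v \<one>\<^bsub>R\<^esub>) = (\<Oplus>\<^bsub>R\<^esub>i\<in>{..<n}. \<iota> (q i \<otimes>\<^bsub>F\<^esub> (c i u \<otimes>\<^bsub>F\<^esub> c i v)))"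
      unfolding E'.diag_form_def using uv E.q_closed by (intro A.M.finsum_cong') (auto simp: ct)
    also have "\<dots> = \<iota> (b u v)" using \<iota>.hom_finsum[OF cl] b[OF uv] by (simp add: E.diag_form_def comp_def)
    finally show "E'.diag_form ?q (tens u \<one>\<^bsub>R\<^esub>) (tens v \<one>\<^bsub>R\<^esub>) = b u v \<odot>\<^bsub>R\<^esub> \<one>\<^bsub>R\<^esub>" unfolding \<iota>_def .
  qed
  have me: "multilinear_extension F V r X R vs = E'.cross ?w vs" if "vs \<in> tuples VR r" for vs
  proof (rule multilinear_extension_eq[OF E E'.cross_multilinear[OF E.n_Suc] _ that])
    show "\<iota> (w i) \<in> carrier R" if "i < n" for i using E.w_closed[OF that] by simp
    fix vs assume vs: "vs \<in> tuples V r"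
    let ?vs = "map (\<lambda>v. tens v \<one>\<^bsub>R\<^esub>) vs"
    show "E'.cross ?w ?vs = tens (X vs) \<one>\<^bsub>R\<^esub>"
    proof (rule E'.coordinates_eqI)
      fix i assume i: "i < n"
      have t: "vs @ [E i] \<in> tuples V n" using E.append_closed[OF vs] i by simp
      have "c' i (E'.cross ?w ?vs) = \<iota> (w i) \<otimes>\<^bsub>R\<^esub> \<iota> (E.coord_det (vs @ [E i]))"
        using E'.c_Y[OF tens1_tuples[OF vs] i] det[OF t] by simp
      also have "\<dots> = \<iota> (c i (X vs))"
        using E.c_Y[OF vs i] X[OF vs] E.w_closed[OF i] E.coord_det_closed[OF t] by simp
      also have "\<dots> = c' i (tens (X vs) \<one>\<^bsub>R\<^esub>)" using ct[OF i] X[OF vs] E.Y_closed[OF vs] by simp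
      finally show "c' i (E'.cross ?w ?vs) = c' i (tens (X vs) \<one>\<^bsub>R\<^esub>)" .
    qed (use E'.Y_closed[OF tens1_tuples[OF vs]] X[OF vs] E.Y_closed[OF vs] in auto)
  qed
  show ?thesis by (rule that[OF cc be me])
qed

end

section \<open>Orthogonal bases\<close>

text \<open>Indexing by all of \<open>nat\<close>, with only the values below \<open>k\<close>
  constrained, lets a system be enlarged by updating the function at \<open>k\<close>.\<close>

definition orthogonal_system ::
  "('r, 'm) ring_scheme \<Rightarrow> ('r, 'v, 'k) module_scheme \<Rightarrow> ('v \<Rightarrow> 'v \<Rightarrow> 'r) \<Rightarrow> nat \<Rightarrow> (nat \<Rightarrow> 'v) \<Rightarrow> bool" where
  "orthogonal_system R M b k E \<longleftrightarrow>
     (\<forall>i<k. E i \<in> carrier M \<and> b (E i) (E i) \<noteq> \<zero>\<^bsub>R\<^esub>) \<and>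
     (\<forall>i<k. \<forall>j<k. i \<noteq> j \<longrightarrow> b (E i) (E j) = \<zero>\<^bsub>R\<^esub>)"

lemma (in module) bilinear_sum_left:
  assumes b: "bilinear_form R M b" and u: "u \<in> carrier M" and I: "finite I"
    and a: "a \<in> I \<rightarrow> carrier R" and e: "e \<in> I \<rightarrow> carrier M"
  shows "b (\<Oplus>\<^bsub>M\<^esub>i\<in>I. a i \<odot>\<^bsub>M\<^esub> e i) u = (\<Oplus>i\<in>I. a i \<otimes> b (e i) u)"
  using form_slot_sum[OF bilinear_multilinear[OF b], of "[u, u]" 0 I a e] assms
  by (simp add: tuples_def)

locale bilinear_space = vectorspace F V for F (structure) and V (structure) +
  fixes b :: "'c \<Rightarrow> 'c \<Rightarrow> 'a"
  assumes char_not_two: "\<one> \<oplus> \<one> \<noteq> \<zero>"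
    and finite_dimensional: "fin_dim"
    and bilinear: "bilinear_form F V b"
    and symmetric: "symmetric_form V b"
    and nondegenerate: "nondegenerate_form F V b"
begin

lemmas b_closed = bilinear_closed[OF bilinear]
lemmas b_add_left = bilinear_add_left[OF bilinear]
lemmas b_add_right = bilinear_add_right[OF bilinear]
lemmas b_smult_left = bilinear_smult_left[OF bilinear]
lemmas b_smult_right = bilinear_smult_right[OF bilinear]

lemma b_sym: "u \<in> carrier V \<Longrightarrow> v \<in> carrier V \<Longrightarrow> b u v = b v u"
  using symmetric unfolding symmetric_form_def by simp

text \<open>The coefficient of the orthogonal projection of \<open>v\<close> to the line spanned by
  \<open>E i\<close>, for an anisotropic \<open>E i\<close>.\<close>

definition coeff where "coeff E i v = inv (b (E i) (E i)) \<otimes> b v (E i)" for E :: "nat \<Rightarrow> 'c" and i :: nat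

context
  fixes k E
  assumes E: "orthogonal_system F V b k E"
begin

lemma orth_closed: "i < k \<Longrightarrow> E i \<in> carrier V"
  and orth_Units: "i < k \<Longrightarrow> b (E i) (E i) \<in> Units F"
  and orth_zero: "i < k \<Longrightarrow> j < k \<Longrightarrow> i \<noteq> j \<Longrightarrow> b (E i) (E j) = \<zero>"
  using E b_closed unfolding orthogonal_system_def by (auto simp: field_Units)

lemma orth_combination:
  assumes a: "a \<in> {..<k} \<rightarrow> carrier F" and j: "j < k"
  shows "b (\<Oplus>\<^bsub>V\<^esub>i\<in>{..<k}. a i \<odot>\<^bsub>V\<^esub> E i) (E j) = a j \<otimes> b (E j) (E j)"
proof -
  have "b (\<Oplus>\<^bsub>V\<^esub>i\<in>{..<k}. a i \<odot>\<^bsub>V\<^esub> E i) (E j) = (\<Oplus>i\<in>{..<k}. a i \<otimes> b (E i) (E j))"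
    using a j orth_closed by (intro bilinear_sum_left[OF bilinear]) auto
  also have "\<dots> = (\<Oplus>i\<in>{..<k}. if j = i then a i \<otimes> b (E i) (E i) else \<zero>)"
    using a j orth_closed b_closed by (intro R.finsum_cong') (auto simp: orth_zero Pi_iff)
  also have "\<dots> = a j \<otimes> b (E j) (E j)"
    using a j orth_closed b_closed by (intro R.finsum_singleton) auto
  finally show ?thesis .
qed

lemma coeff_closed: "i < k \<Longrightarrow> v \<in> carrier V \<Longrightarrow> coeff E i v \<in> carrier F"
  unfolding coeff_def using orth_Units orth_closed b_closed by simp

lemma coeff_b: "i < k \<Longrightarrow> v \<in> carrier V \<Longrightarrow> coeff E i v \<otimes> b (E i) (E i) = b v (E i)"
proof -
  assume h: "i < k" "v \<in> carrier V"
  note u = orth_Units[OF h(1)] b_closed[OF h(2) orth_closed[OF h(1)]]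
  have "coeff E i v \<otimes> b (E i) (E i) = (inv (b (E i) (E i)) \<otimes> b (E i) (E i)) \<otimes> b v (E i)"
    unfolding coeff_def using u R.Units_closed[OF u(1)] by (simp add: R.m_ac)
  then show ?thesis using u by simp
qed

text \<open>One Gram-Schmidt step: \<open>p\<close> is the projection to the span of the system,
  \<open>x\<close> the remainder.\<close>

lemma rest_orthogonal:
  assumes v: "v \<in> carrier V"
  obtains p x where "p \<in> carrier V" "x \<in> carrier V" "p = (\<Oplus>\<^bsub>V\<^esub>i\<in>{..<k}. coeff E i v \<odot>\<^bsub>V\<^esub> E i)"
    "v = p \<oplus>\<^bsub>V\<^esub> x" "\<forall>j<k. b x (E j) = \<zero>"
proof -
  define p where "p = (\<Oplus>\<^bsub>V\<^esub>i\<in>{..<k}. coeff E i v \<odot>\<^bsub>V\<^esub> E i)"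
  define x where "x = v \<oplus>\<^bsub>V\<^esub> \<ominus> \<one> \<odot>\<^bsub>V\<^esub> p"
  have a: "(\<lambda>i. coeff E i v) \<in> {..<k} \<rightarrow> carrier F" using coeff_closed v by auto
  have p: "p \<in> carrier V" unfolding p_def using coeff_closed v orth_closed by (intro M.finsum_closed) auto
  then have x: "x \<in> carrier V" unfolding x_def using v by simp
  have px: "v = p \<oplus>\<^bsub>V\<^esub> x"
    unfolding x_def using p v by (simp add: smult_l_minus M.a_lcomm[of p] M.r_neg)
  have "b x (E j) = \<zero>" if j: "j < k" for j
  proof -
    have "b p (E j) = b v (E j)" unfolding p_def orth_combination[OF a j] by (rule coeff_b[OF j v])
    then show ?thesis unfolding x_def using v p orth_closed[OF j] b_closed
      by (simp add: b_add_left b_smult_left R.l_minus R.r_neg)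
  qed
  then have "\<forall>j<k. b x (E j) = \<zero>" by blast
  then show ?thesis by (rule that[OF p x p_def px])
qed

text \<open>The remainder of the projection lies in the orthogonal complement, which
  \<open>max\<close> makes trivial, so the projection formula becomes the basis expansion.\<close>

lemma orth_coordinates:
  assumes max: "\<And>v. v \<in> carrier V \<Longrightarrow> (\<And>j. j < k \<Longrightarrow> b v (E j) = \<zero>) \<Longrightarrow> v = \<zero>\<^bsub>V\<^esub>"
  shows "coordinates F V k E (coeff E)"
proof (unfold_locales)
  show "coeff E i (u \<oplus>\<^bsub>V\<^esub> v) = coeff E i u \<oplus> coeff E i v" if "i < k" "u \<in> carrier V" "v \<in> carrier V" for i u v
    unfolding coeff_def using that orth_closed orth_Units b_closed by (simp add: b_add_left R.r_distr)
  show "coeff E i (a \<odot>\<^bsub>V\<^esub> v) = a \<otimes> coeff E i v" if "i < k" "a \<in> carrier F" "v \<in> carrier V" for i a v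
    unfolding coeff_def using that orth_closed orth_Units b_closed by (simp add: b_smult_left R.m_lcomm)
  show "coeff E i (E j) = (if i = j then \<one> else \<zero>)" if "i < k" "j < k" for i j
    unfolding coeff_def using that orth_Units orth_zero by simp
  show "(\<Oplus>\<^bsub>V\<^esub>i\<in>{..<k}. coeff E i v \<odot>\<^bsub>V\<^esub> E i) = v" if v: "v \<in> carrier V" for v
  proof -
    obtain p x where px: "p \<in> carrier V" "x \<in> carrier V" "p = (\<Oplus>\<^bsub>V\<^esub>i\<in>{..<k}. coeff E i v \<odot>\<^bsub>V\<^esub> E i)"
      "v = p \<oplus>\<^bsub>V\<^esub> x" "\<forall>j<k. b x (E j) = \<zero>" by (rule rest_orthogonal[OF v])
    have "x = \<zero>\<^bsub>V\<^esub>" using max[OF px(2)] px(5) by blast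
    then have "p = v" using px(1,4) M.r_zero by metis
    then show ?thesis using px(3) by metis
  qed
qed (auto simp: orth_closed coeff_closed)

text \<open>Characteristic not two enters here: polarization turns the vanishing of
  \<open>b x x\<close> on the complement into the vanishing of \<open>b\<close> on all pairs from
  it. As every vector splits into a part in the span and a part in the complement, \<open>v\<close>
  is orthogonal to all of \<open>V\<close>, and nondegeneracy applies.\<close>

lemma isotropic_complement:
  assumes iso: "\<And>x. x \<in> carrier V \<Longrightarrow> (\<And>j. j < k \<Longrightarrow> b x (E j) = \<zero>) \<Longrightarrow> b x x = \<zero>"
    and v: "v \<in> carrier V" "\<And>j. j < k \<Longrightarrow> b v (E j) = \<zero>"
  shows "v = \<zero>\<^bsub>V\<^esub>"
proof -
  have pol: "b v x = \<zero>" if x: "x \<in> carrier V" "\<And>j. j < k \<Longrightarrow> b x (E j) = \<zero>" for x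
  proof -
    have "b (v \<oplus>\<^bsub>V\<^esub> x) (v \<oplus>\<^bsub>V\<^esub> x) = \<zero>"
      using v x orth_closed by (intro iso) (auto simp: b_add_left)
    then have "(\<one> \<oplus> \<one>) \<otimes> b v x = \<zero>"
      using v(1) x(1) iso[OF v] iso[OF x] b_closed b_sym[OF x(1) v(1)]
      by (simp add: b_add_left b_add_right R.l_distr)
    then show ?thesis
      using char_not_two integral_iff[of "\<one> \<oplus> \<one>" "b v x"] b_closed[OF v(1) x(1)] by simp
  qed
  have "b v y = \<zero>" if y: "y \<in> carrier V" for y
  proof -
    obtain p x where px: "p \<in> carrier V" "x \<in> carrier V" "p = (\<Oplus>\<^bsub>V\<^esub>i\<in>{..<k}. coeff E i y \<odot>\<^bsub>V\<^esub> E i)"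
      "y = p \<oplus>\<^bsub>V\<^esub> x" "\<forall>j<k. b x (E j) = \<zero>" by (rule rest_orthogonal[OF y])
    have "b p v = (\<Oplus>i\<in>{..<k}. coeff E i y \<otimes> b (E i) v)"
      unfolding px(3) using y v orth_closed coeff_closed by (intro bilinear_sum_left[OF bilinear]) auto
    also have "\<dots> = (\<Oplus>i\<in>{..<k}. \<zero>)"
      using y v orth_closed coeff_closed b_sym[OF v(1)] by (intro R.finsum_cong') auto
    finally have "b v p = \<zero>" using b_sym[OF v(1) px(1)] by simp
    then have "b v (p \<oplus>\<^bsub>V\<^esub> x) = \<zero>" using pol[OF px(2)] px(1,2,5) v(1) by (simp add: b_add_right)
    then show ?thesis by (simp only: px(4)[symmetric])
  qed
  then show ?thesis using nondegenerate v(1) unfolding nondegenerate_form_def by blast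
qed

text \<open>Pairing a linear relation with \<open>E j\<close> isolates the coefficient of
  \<open>E j\<close>, so the system is independent. The bound guarantees that a longest system
  exists.\<close>

lemma orth_le_dim: "k \<le> dim"
proof -
  have inj: "inj_on E {..<k}"
  proof (rule inj_onI)
    fix i j assume ij: "i \<in> {..<k}" "j \<in> {..<k}" "E i = E j"
    then have "b (E i) (E j) \<noteq> \<zero>" using E unfolding orthogonal_system_def by simp
    then show "i = j" using orth_zero[of i j] ij by auto
  qed
  have "lin_indpt (E ` {..<k})"
  proof (rule finite_lin_indpt2)
    fix a assume a: "a \<in> E ` {..<k} \<rightarrow> carrier F" "lincomb a (E ` {..<k}) = \<zero>\<^bsub>V\<^esub>"
    have "lincomb a (E ` {..<k}) = (\<Oplus>\<^bsub>V\<^esub>i\<in>{..<k}. a (E i) \<odot>\<^bsub>V\<^esub> E i)"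
      unfolding lincomb_def using a inj orth_closed by (intro M.finsum_reindex) auto
    then have z: "(\<Oplus>\<^bsub>V\<^esub>i\<in>{..<k}. a (E i) \<odot>\<^bsub>V\<^esub> E i) = \<zero>\<^bsub>V\<^esub>" using a by simp
    have "a (E j) = \<zero>" if j: "j < k" for j
    proof -
      have aj: "a (E j) \<in> carrier F" "(\<lambda>i. a (E i)) \<in> {..<k} \<rightarrow> carrier F" using a j by auto
      have "b \<zero>\<^bsub>V\<^esub> (E j) = \<zero>" using b_smult_left[of \<zero> "\<zero>\<^bsub>V\<^esub>" "E j"] orth_closed[OF j] b_closed by simp
      then have "a (E j) \<otimes> b (E j) (E j) = \<zero>" using orth_combination[OF aj(2) j] z by simp
      then show ?thesis
        using integral[of "a (E j)" "b (E j) (E j)"] aj(1) E j b_closed orth_closed unfolding orthogonal_system_def by auto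
    qed
    then show "\<forall>v\<in>E ` {..<k}. a v = \<zero>" by auto
  qed (auto simp: orth_closed)
  then have "card (E ` {..<k}) \<le> dim"
    by (intro li_le_dim(2)[OF finite_dimensional]) (auto simp: orth_closed)
  then show ?thesis using inj by (simp add: card_image)
qed

lemma orth_extend:
  assumes x: "x \<in> carrier V" "\<And>j. j < k \<Longrightarrow> b x (E j) = \<zero>" "b x x \<noteq> \<zero>"
  shows "orthogonal_system F V b (Suc k) (E(k := x))"
proof -
  have "b (E j) x = \<zero>" if "j < k" for j using b_sym[OF x(1) orth_closed[OF that]] x(2)[OF that] by simp
  then show ?thesis using x E unfolding orthogonal_system_def less_Suc_eq by simp
qed

end

text \<open>A longest system leaves no anisotropic vector in its complement, hence no nonzero vector
  at all, and is therefore a basis.\<close>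

lemma orthogonal_basis_exists:
  obtains E where "orthogonal_system F V b dim E" "coordinates F V dim E (coeff E)"
proof -
  let ?P = "\<lambda>k. \<exists>E. orthogonal_system F V b k E"
  have "?P 0" unfolding orthogonal_system_def by simp
  moreover have bound: "\<And>k. ?P k \<Longrightarrow> k \<le> dim" using orth_le_dim by blast
  ultimately have "?P (Greatest ?P)" by (rule GreatestI_nat)
  then obtain k E where k: "k = Greatest ?P" and E: "orthogonal_system F V b k E" by blast
  have "\<not> ?P (Suc k)" using Greatest_le_nat[of ?P "Suc k" dim] bound k by auto
  then have "b x x = \<zero>" if "x \<in> carrier V" "\<And>j. j < k \<Longrightarrow> b x (E j) = \<zero>" for x
    using orth_extend[OF E that] by blast
  then have c: "coordinates F V k E (coeff E)"
    using orth_coordinates[OF E isotropic_complement[OF E]] by blast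
  then have ob: "ordered_basis F V (map E [0..<k])"
    using coordinates.ordered_basis_E[OF c] one_not_zero by blast
  have "basis (set (map E [0..<k]))"
    using ob unfolding ordered_basis_def basis_def by auto
  then have "dim = card (set (map E [0..<k]))" by (intro dim_basis) auto
  also have "\<dots> = k" using ob distinct_card[of "map E [0..<k]"] unfolding ordered_basis_def by simp
  finally show ?thesis using that E c by simp
qed

end

section \<open>Cross products on a bilinear space\<close>

locale cross_product_space = bilinear_space F V b
  for F (structure) and V (structure) and b :: "'c \<Rightarrow> 'c \<Rightarrow> 'a" +
  fixes r :: nat and X :: "'c list \<Rightarrow> 'c"
  assumes dim_eq: "dim = Suc r"
    and cross_product: "cross_product F V b r X"
begin

lemma X_multilinear: "multilinear_map F V r X"
  and X_orthogonal: "xs \<in> tuples V r \<Longrightarrow> i < r \<Longrightarrow> b (X xs) (xs ! i) = \<zero>"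
  and X_norm: "xs \<in> tuples V r \<Longrightarrow> b (X xs) (X xs) = leibniz_det F r (\<lambda>i j. b (xs ! i) (xs ! j))"
  using cross_product unfolding cross_product_def by simp_all

lemmas X_closed = multilinear_map_closed[OF X_multilinear]

section \<open>The volume form of a cross product\<close>

definition vol where "vol xs = b (X (take r xs)) (xs ! r)"

lemma take_tuples: "xs \<in> tuples V (Suc r) \<Longrightarrow> take r xs \<in> tuples V r"
  unfolding tuples_def using set_take_subset[of r xs] by auto

lemma vol_append: "xs \<in> tuples V r \<Longrightarrow> vol (xs @ [u]) = b (X xs) u"
  unfolding vol_def using tuples_length[of xs V r] by (simp add: nth_append)

lemma vol_multilinear: "multilinear_form F V (Suc r) vol"
proof (rule multilinear_formI)
  show "vol xs \<in> carrier F" if "xs \<in> tuples V (Suc r)" for xs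
    unfolding vol_def using that by (intro b_closed X_closed take_tuples tuples_nth[OF that]) auto
next
  fix xs i u w assume h: "xs \<in> tuples V (Suc r)" "i < Suc r" "u \<in> carrier V" "w \<in> carrier V"
  note t = take_tuples[OF h(1)] and c = tuples_nth[OF h(1), of r]
  show "vol (xs[i := u \<oplus>\<^bsub>V\<^esub> w]) = vol (xs[i := u]) \<oplus> vol (xs[i := w])"
  \<comment> \<open>Slot \<open>r\<close> enters through the second argument of \<open>b\<close>,
    all earlier slots through \<open>X\<close>.\<close>
  proof (cases "i = r")
    case True
    then show ?thesis unfolding vol_def using h X_closed[OF t] tuples_length[OF h(1)]
      by (simp add: take_update_cancel b_add_right)
  next
    case False
    then have "i < r" using h(2) by simp
    then show ?thesis unfolding vol_def
      using h t c X_closed[OF tuples_update[OF t]] by (simp add: take_update_swap multilinear_map_add[OF X_multilinear] b_add_left)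
  qed
next
  fix xs i a u assume h: "xs \<in> tuples V (Suc r)" "i < Suc r" "a \<in> carrier F" "u \<in> carrier V"
  note t = take_tuples[OF h(1)] and c = tuples_nth[OF h(1), of r]
  show "vol (xs[i := a \<odot>\<^bsub>V\<^esub> u]) = a \<otimes> vol (xs[i := u])"
  proof (cases "i = r")
    case True
    then show ?thesis unfolding vol_def using h X_closed[OF t] tuples_length[OF h(1)]
      by (simp add: take_update_cancel b_smult_right)
  next
    case False
    then have "i < r" using h(2) by simp
    then show ?thesis unfolding vol_def
      using h t c X_closed[OF tuples_update[OF t]] by (simp add: take_update_swap multilinear_map_smult[OF X_multilinear] b_smult_left)
  qed
qed

lemma vol_last_repeated:
  assumes "xs \<in> tuples V (Suc r)" "i < r" "xs ! i = xs ! r"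
  shows "vol xs = \<zero>"
  using X_orthogonal[OF take_tuples[OF assms(1)] assms(2)] assms unfolding vol_def by simp

text \<open>For \<open>u = v\<^sub>i = v\<^sub>j\<close> and \<open>z = v\<^sub>r\<close>, swapping slots \<open>i\<close> and \<open>r\<close> puts \<open>u\<close> into both slots \<open>j\<close> and \<open>r\<close>.\<close>

lemma vol_alternating: "alternating_form F V (Suc r) vol"
proof -
  have two: "vol xs = \<zero>" if xs: "xs \<in> tuples V (Suc r)" and ij: "i < r" "j < r" "i \<noteq> j" and eq: "xs ! i = xs ! j" for xs i j
  proof -
    let ?u = "xs ! i" and ?z = "xs ! r"
    have uz: "?u \<in> carrier V" "?z \<in> carrier V" using tuples_nth[OF xs] ij by auto
    have l: "length xs = Suc r" using xs by (rule tuples_length)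
    have t: "xs[r := y, i := x] \<in> tuples V (Suc r)" if "x \<in> carrier V" "y \<in> carrier V" for x y
      using that xs by auto
    have diag: "vol (xs[r := x, i := x]) = \<zero>" if "x \<in> carrier V" for x
      using t[OF that that] ij l by (intro vol_last_repeated[of _ i]) auto
    have zu: "vol (xs[r := ?u, i := ?z]) = \<zero>"
      using t[OF uz(2,1)] ij l eq by (intro vol_last_repeated[of _ j]) auto
    have id: "xs[r := ?z, i := ?u] = xs" by (simp add: list_update_swap)
    have add: "vol (xs[r := ?u \<oplus>\<^bsub>V\<^esub> ?z, i := x]) = vol (xs[r := ?u, i := x]) \<oplus> vol (xs[r := ?z, i := x])"
      if "x \<in> carrier V" for x
    proof -
      have "r \<noteq> i" using ij by simp
      show ?thesis unfolding list_update_swap[OF \<open>r \<noteq> i\<close>] using that uz ij xs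
        by (intro form_add[OF vol_multilinear]) auto
    qed
    \<comment> \<open>Expansion in the slots \<open>i\<close> and \<open>r\<close> produces four
      terms. Three vanish by \<open>diag\<close> and \<open>zu\<close>, and the remaining one is
      \<open>vol xs\<close> itself.\<close>
    have "\<zero> = vol (xs[r := ?u \<oplus>\<^bsub>V\<^esub> ?z, i := ?u \<oplus>\<^bsub>V\<^esub> ?z])" using diag uz by simp
    also have "\<dots> = vol (xs[r := ?u \<oplus>\<^bsub>V\<^esub> ?z, i := ?u]) \<oplus> vol (xs[r := ?u \<oplus>\<^bsub>V\<^esub> ?z, i := ?z])"
      using uz ij xs by (intro form_add[OF vol_multilinear]) auto
    also have "\<dots> = (vol (xs[r := ?u, i := ?u]) \<oplus> vol (xs[r := ?z, i := ?u])) \<oplus>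
        (vol (xs[r := ?u, i := ?z]) \<oplus> vol (xs[r := ?z, i := ?z]))"
      by (simp only: add uz)
    finally show ?thesis
      unfolding id diag[OF uz(1)] diag[OF uz(2)] zu using uz form_closed[OF vol_multilinear xs] by simp
  qed
  have "vol xs = \<zero>" if xs: "xs \<in> tuples V (Suc r)" and ij: "i < Suc r" "j < Suc r" "i \<noteq> j" and eq: "xs ! i = xs ! j" for xs i j
  proof (cases "i = r \<or> j = r")
    case True
    then show ?thesis using vol_last_repeated[OF xs, of i] vol_last_repeated[OF xs, of j] ij eq by (auto simp: less_Suc_eq)
  next
    case False
    then show ?thesis using two[OF xs _ _ ij(3) eq] ij by simp
  qed
  then show ?thesis using vol_multilinear unfolding alternating_form_def by simp
qed

text \<open>In an orthogonal basis the \<open>i\<close>-th coordinate of \<open>X xs\<close> is its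
  pairing with \<open>E i\<close> divided by \<open>q i\<close>. That pairing is the volume form at
  \<open>xs\<close> followed by \<open>E i\<close>, hence \<delta> times a determinant; this
  dictates \<open>w i\<close>.\<close>

lemma cross_coordinates_exist:
  obtains E c q w \<delta> where "cross_coordinates F V (Suc r) E c r q w \<delta>"
    and "\<And>u v. u \<in> carrier V \<Longrightarrow> v \<in> carrier V \<Longrightarrow> b u v = coordinates.diag_form F (Suc r) c q u v"
    and "\<And>xs. xs \<in> tuples V r \<Longrightarrow> X xs = coordinates.cross F V (Suc r) E c w xs"
proof -
  obtain E where orth: "orthogonal_system F V b (Suc r) E" and co: "coordinates F V (Suc r) E (coeff E)"
    using orthogonal_basis_exists unfolding dim_eq by blast
  interpret E: coordinates F V "Suc r" E "coeff E" by (rule co)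
  define q where "q i = b (E i) (E i)" for i
  define \<delta> where "\<delta> = vol (map E [0..<Suc r])"
  define w where "w i = inv (q i) \<otimes> \<delta>" for i
  have q: "q i \<in> Units F" if "i < Suc r" for i unfolding q_def by (rule orth_Units[OF orth that])
  have qc: "q i \<in> carrier F" if "i < Suc r" for i using q[OF that] by auto
  have \<delta>c: "\<delta> \<in> carrier F" unfolding \<delta>_def by (rule form_closed[OF vol_multilinear E.tuples_E])
  have vol: "vol xs = \<delta> \<otimes> E.coord_det xs" if "xs \<in> tuples V (Suc r)" for xs
    unfolding \<delta>_def by (rule E.alternating_form_eq_coord_det[OF vol_alternating that])
  \<comment> \<open>If \<delta> vanished, so would every pairing with the value of \<open>X\<close>
    on the first \<open>r\<close> basis vectors, in particular its pairing with itself. The norm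
    axiom equates the latter with a Gram determinant, here the product of the units
    \<open>q i\<close> for \<open>i < r\<close>.\<close>
  have "\<delta> \<noteq> \<zero>"
  proof
    assume 0: "\<delta> = \<zero>"
    let ?xs = "map E [0..<r]"
    have xs: "?xs \<in> tuples V r" by (auto simp: tuples_def)
    have "b (X ?xs) u = \<zero>" if u: "u \<in> carrier V" for u
    proof -
      have t: "?xs @ [u] \<in> tuples V (Suc r)" using xs u by (rule tuples_append1)
      show ?thesis using vol[OF t] vol_append[OF xs] E.coord_det_closed[OF t] 0 by simp
    qed
    then have "b (X ?xs) (X ?xs) = \<zero>" using X_closed[OF xs] by simp
    moreover have "b (X ?xs) (X ?xs) = (\<Otimes>i\<in>{..<r}. q i)"
    proof -
      have "leibniz_det F r (\<lambda>i j. b (?xs ! i) (?xs ! j)) = (\<Otimes>i\<in>{..<r}. b (?xs ! i) (?xs ! i))"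
        by (rule R.leibniz_det_diagonal) (use orth_zero[OF orth] b_closed in auto)
      also have "\<dots> = (\<Otimes>i\<in>{..<r}. q i)"
        unfolding q_def using b_closed by (intro R.finprod_cong') auto
      finally show ?thesis using X_norm[OF xs] by simp
    qed
    moreover have "(\<Otimes>i\<in>I. q i) \<in> Units F" if "finite I" "I \<subseteq> {..<Suc r}" for I
      using that
    proof (induction I)
      case (insert i I)
      then have "q i \<in> Units F" "q i \<in> carrier F" "q \<in> I \<rightarrow> carrier F" using q qc by auto
      then show ?case using insert R.finprod_insert[of I i q] by simp
    qed simp
    ultimately have "\<zero> \<in> Units F" by (metis finite_lessThan lessThan_subset_iff le_SucI order_refl)
    then show False using field_Units by simp
  qed
  then have \<delta>u: "\<delta> \<in> Units F" using \<delta>c field_Units by simp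
  have qw: "q i \<otimes> w i = \<delta>" if "i < Suc r" for i
    unfolding w_def using q[OF that] qc[OF that] \<delta>c by (simp flip: R.m_assoc)
  have cc: "cross_coordinates F V (Suc r) E (coeff E) r q w \<delta>"
    by unfold_locales (use q \<delta>u qw in \<open>auto simp: w_def\<close>)
  interpret E: cross_coordinates F V "Suc r" E "coeff E" r q w \<delta> by (rule cc)
  have bq: "b u v = E.diag_form q u v" if "u \<in> carrier V" "v \<in> carrier V" for u v
  proof (rule E.bilinear_form_eqI[OF bilinear E.B_bilinear _ that])
    fix i j assume ij: "i < Suc r" "j < Suc r"
    show "b (E i) (E j) = E.diag_form q (E i) (E j)"
      unfolding E.B_E[OF ij(2) E.E_closed[OF ij(1)]]
      using ij qc by (cases "i = j") (auto simp: E.c_E q_def orth_zero[OF orth])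
  qed
  have Xw: "X xs = E.cross w xs" if xs: "xs \<in> tuples V r" for xs
  proof (rule E.coordinates_eqI)
    fix i assume i: "i < Suc r"
    have t: "xs @ [E i] \<in> tuples V (Suc r)" using E.append_closed[OF xs] i by simp
    have "coeff E i (X xs) = inv (q i) \<otimes> b (X xs) (E i)" by (simp add: coeff_def q_def)
    also have "b (X xs) (E i) = \<delta> \<otimes> E.coord_det (xs @ [E i])"
      using vol[OF t] vol_append[OF xs] by simp
    also have "inv (q i) \<otimes> (\<delta> \<otimes> E.coord_det (xs @ [E i])) = coeff E i (E.cross w xs)"
      unfolding E.c_Y[OF xs i] w_def using q[OF i] \<delta>c E.coord_det_closed[OF t] by (simp add: R.m_assoc)
    finally show "coeff E i (X xs) = coeff E i (E.cross w xs)" .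
  qed (use X_closed[OF xs] E.Y_closed[OF xs] in auto)
  show ?thesis by (rule that[OF cc bq Xw])
qed

text \<open>With the extended form and map in explicit coordinates over \<open>R\<close>, both
  equalities come down to \<open>preserves_cross_iff\<close> and
  \<open>isometry_similitude_iff\<close>, applied to each point of GL.\<close>

lemma schemes_eq:
  fixes R :: "('a, 'g, 'm) module_scheme"
  assumes R: "algebra F R"
  shows "Aut_scheme F V r X R = O_tilde_scheme F V b R"
    and "Aut_form_scheme F V r X b R = SO_scheme F V b R"
proof -
  interpret base_change F V R by (rule base_change.intro) (rule module_axioms, rule R)
  obtain E c q w \<delta> where ecq: "cross_coordinates F V (Suc r) E c r q w \<delta>"
    and b: "\<And>u v. u \<in> carrier V \<Longrightarrow> v \<in> carrier V \<Longrightarrow> b u v = coordinates.diag_form F (Suc r) c q u v"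
    and X: "\<And>xs. xs \<in> tuples V r \<Longrightarrow> X xs = coordinates.cross F V (Suc r) E c w xs"
    by (rule cross_coordinates_exist) blast
  obtain E' c' q' w' \<delta>' where ecq': "cross_coordinates R VR (Suc r) E' c' r q' w' \<delta>'"
    and be: "\<And>u v. u \<in> carrier VR \<Longrightarrow> v \<in> carrier VR \<Longrightarrow>
      bilinear_extension F V b R u v = coordinates.diag_form R (Suc r) c' q' u v"
    and me: "\<And>xs. xs \<in> tuples VR r \<Longrightarrow>
      multilinear_extension F V r X R xs = coordinates.cross R VR (Suc r) E' c' w' xs"
    by (rule cross_coordinates_base_change[OF ecq b X]) blast+
  interpret E': cross_coordinates R VR "Suc r" E' c' r q' w' \<delta>' by (rule ecq')
  have GL: "h \<in> module_hom R VR VR \<and> bij_betw h (carrier VR) (carrier VR)"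
    if "h \<in> carrier (GL_scheme F V R)" for h
    using that unfolding GL_scheme_def GL_module_def by (simp add: Bij_def)
  have Aut_iff: "(\<forall>xs\<in>tuples VR r. h (multilinear_extension F V r X R xs) = multilinear_extension F V r X R (map h xs)) \<longleftrightarrow>
      (\<forall>u\<in>carrier VR. \<forall>v\<in>carrier VR. bilinear_extension F V b R (h u) (h v) =
        lin_det R VR h \<otimes>\<^bsub>R\<^esub> bilinear_extension F V b R u v)"
    if "h \<in> carrier (GL_scheme F V R)" for h
  proof -
    have h: "h \<in> module_hom R VR VR" "bij_betw h (carrier VR) (carrier VR)" using GL[OF that] by auto
    have hc: "h x \<in> carrier VR" if "x \<in> carrier VR" for x using h(1) that by (auto simp: module_hom_def)
    have "map h xs \<in> tuples VR r" if "xs \<in> tuples VR r" for xs using that hc by (intro tuples_map) auto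
    then show ?thesis using E'.preserves_cross_iff[OF h] by (simp add: be me hc)
  qed
  have SO_iff: "(\<forall>u\<in>carrier VR. \<forall>v\<in>carrier VR. bilinear_extension F V b R (h u) (h v) =
        lin_det R VR h \<otimes>\<^bsub>R\<^esub> bilinear_extension F V b R u v) \<longleftrightarrow> lin_det R VR h = \<one>\<^bsub>R\<^esub>"
    if "h \<in> carrier (GL_scheme F V R)"
      and iso: "\<forall>u\<in>carrier VR. \<forall>v\<in>carrier VR. bilinear_extension F V b R (h u) (h v) = bilinear_extension F V b R u v"
    for h
  proof -
    have h: "h \<in> module_hom R VR VR" using GL[OF that(1)] by auto
    have hc: "h x \<in> carrier VR" if "x \<in> carrier VR" for x using h(1) that by (auto simp: module_hom_def)
    show ?thesis using E'.isometry_similitude_iff[OF E'.lin_det_closed[OF h], of h] iso by (simp add: be hc)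
  qed
  \<comment> \<open>The schemes are the same record up to the carrier, so only the defining
    predicates have to be compared.\<close>
  show "Aut_scheme F V r X R = O_tilde_scheme F V b R"
    unfolding Aut_scheme_def O_tilde_scheme_def
    by (intro arg_cong[where f = "\<lambda>C. (GL_scheme F V R)\<lparr>carrier := C\<rparr>"] Collect_cong conj_cong refl Aut_iff)
  have "carrier (Aut_scheme F V r X R) \<inter> carrier (O_scheme F V b R) = carrier (SO_scheme F V b R)"
  proof (rule Set.set_eqI)
    fix h
    have car: "carrier (S\<lparr>carrier := C\<rparr>) = C" for S :: "(('c \<times> 'g \<Rightarrow>\<^sub>0 int) set \<Rightarrow> ('c \<times> 'g \<Rightarrow>\<^sub>0 int) set) monoid" and C
      by simp
    \<comment> \<open>The propositional core: given membership \<open>G\<close> in GL and the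
      isometry condition \<open>Q\<close>, preservation \<open>P\<close> of the product may be
      exchanged for the determinant condition \<open>D\<close>.\<close>
    have taut: "((G \<and> P) \<and> G \<and> Q) = ((G \<and> Q) \<and> D)" if "G \<Longrightarrow> Q \<Longrightarrow> P = D" for G P Q D
      using that by blast
    show "h \<in> carrier (Aut_scheme F V r X R) \<inter> carrier (O_scheme F V b R) \<longleftrightarrow> h \<in> carrier (SO_scheme F V b R)"
      unfolding Aut_scheme_def O_scheme_def SO_scheme_def car Int_iff mem_Collect_eq
      by (rule taut) (rule trans[OF Aut_iff SO_iff])
  qed
  then show "Aut_form_scheme F V r X b R = SO_scheme F V b R"
    unfolding Aut_form_scheme_def by (simp add: SO_scheme_def)
qed

end

theorem theorem3p3:
  fixes F :: "'f ring" and V :: "('f, 'v) module"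
    and b :: "'v \<Rightarrow> 'v \<Rightarrow> 'f" and X :: "'v list \<Rightarrow> 'v" and n :: nat
  assumes "field F"
    and "\<one>\<^bsub>F\<^esub> \<oplus>\<^bsub>F\<^esub> \<one>\<^bsub>F\<^esub> \<noteq> \<zero>\<^bsub>F\<^esub>"
    and "vectorspace F V"
    and "vectorspace.fin_dim F V"
    and "vectorspace.dim F V = n"
    and "n \<ge> 3"
    and "bilinear_form F V b"
    and "symmetric_form V b"
    and "nondegenerate_form F V b"
    and "cross_product F V b (n - 1) X"
  shows "(\<forall>R :: ('f, 'r) module. algebra F R \<longrightarrow>
            Aut_scheme F V (n - 1) X R = O_tilde_scheme F V b R) \<and>
         (\<forall>R :: ('f, 'r) module. algebra F R \<longrightarrow>
            Aut_form_scheme F V (n - 1) X b R = SO_scheme F V b R)"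
proof -
  interpret vectorspace F V by fact
  \<comment> \<open>The lower bound on \<open>n\<close> makes the truncated difference harmless: the
    successor of \<open>n - 1\<close> is \<open>n\<close>, as \<open>dim_eq\<close> demands.\<close>
  interpret cross_product_space F V b "n - 1" X
    by unfold_locales (use assms in auto)
  show ?thesis using schemes_eq by blast
qed

end
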